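(* There exists an absolute constant $c_2>0$ such that, for every $n\geq 2$ and every convex body $K$ in $\mathbb{R}^n$, $$|K|\,\int_{S^{n-1}}S(P_{\xi^{\perp}}(K))\,d\sigma(\xi)\leq \frac{2(n-1)\omega_{n-1}}{n^2\omega_n}S(K)^2\leq \frac{c_2}{\sqrt{n}}S(K)^2.$$
   Context: A convex body in $\mathbb{R}^n$ is a compact convex set with non-empty interior. $|\cdot|$ denotes volume, $\omega_m$ is the volume of the Euclidean unit ball $B_2^m$ in $\mathbb{R}^m$, $\sigma$ is the rotationally invariant probability measure on the Euclidean unit sphere $S^{n-1}$, and $P_{\xi^{\perp}}$ is the orthogonal projection onto the hyperplane $\xi^{\perp}$. $S(A)$ is the surface area of a convex body $A$; $P_{\xi^\perp}(K)$ is regarded as a convex body in the $(n-1)$-dimensional Euclidean space $\xi^\perp$, and its surface area is taken there. In dimension $m$ one has $S(A)=mV((A,m-1),(B_2^m,1))$ (a mixed volume); in particular the surface area of a segment in a one-dimensional space is $2$. "Absolute constant" means a constant independent of $n$ and of $K$. *)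

theory Defs
  imports "HOL-Probability.Probability"
begin

text \<open>
  The dimension \<open>n\<close> is quantified inside the statement (after the absolute constant), so
  \<open>\<real>\<^sup>n\<close> is the library's \<^const>\<open>Euclidean_space\<close> \<open>n\<close>: the functions \<open>nat \<Rightarrow> real\<close> that vanish
  at all indices \<open>i \<ge> n\<close>, with the product topology. The unit sphere of \<open>\<real>\<^sup>n\<close> is
  the library's \<^const>\<open>nsphere\<close> \<open>(n - 1)\<close>.
\<close>

abbreviation Rn :: "nat \<Rightarrow> (nat \<Rightarrow> real) set" where
  "Rn n \<equiv> topspace (Euclidean_space n)"

abbreviation unit_sphere :: "nat \<Rightarrow> (nat \<Rightarrow> real) set" where
  "unit_sphere n \<equiv> topspace (nsphere (n - 1))"

definition ip :: "nat \<Rightarrow> (nat \<Rightarrow> real) \<Rightarrow> (nat \<Rightarrow> real) \<Rightarrow> real" where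
  "ip n x y = (\<Sum>i<n. x i * y i)"

definition unit_ball :: "nat \<Rightarrow> (nat \<Rightarrow> real) set" where
  "unit_ball n = {x \<in> Rn n. ip n x x \<le> 1}"

definition convex_body :: "nat \<Rightarrow> (nat \<Rightarrow> real) set \<Rightarrow> bool" where
  "convex_body n K \<longleftrightarrow>
     compactin (Euclidean_space n) K \<and>
     (\<forall>x\<in>K. \<forall>y\<in>K. \<forall>t\<in>{0..1}. (\<lambda>i. (1 - t) * x i + t * y i) \<in> K) \<and>
     Euclidean_space n interior_of K \<noteq> {}"

text \<open>
  The product measure lives on functions that are \<^const>\<open>undefined\<close> outside \<open>{..<n}\<close>; these are
  identified with \<open>Rn n\<close> by replacing the undefined values by \<open>0\<close>.
\<close>

definition vol :: "nat \<Rightarrow> (nat \<Rightarrow> real) set \<Rightarrow> real" where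
  "vol n A = measure (Pi\<^sub>M {..<n} (\<lambda>_. lborel))
     {x \<in> space (Pi\<^sub>M {..<n} (\<lambda>_. lborel)). (\<lambda>i. if i < n then x i else 0) \<in> A}"

definition \<omega> :: "nat \<Rightarrow> real" where
  "\<omega> n = vol n (unit_ball n)"

definition parallel_body :: "nat \<Rightarrow> (nat \<Rightarrow> real) set \<Rightarrow> real \<Rightarrow> (nat \<Rightarrow> real) set" where
  "parallel_body n A \<epsilon> = {\<lambda>i. a i + \<epsilon> * b i | a b. a \<in> A \<and> b \<in> unit_ball n}"

text \<open>
  Surface area in the sense of Minkowski, i.e. the right derivative at \<open>0\<close> of the volume of the
  outer parallel bodies. By Steiner's formula the limit exists for every convex body \<open>A\<close> and is
  \<open>n V((A, n - 1), (B, 1))\<close> with \<open>B\<close> the unit ball; for a segment in dimension 1 it is 2.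
\<close>

definition surface_area :: "nat \<Rightarrow> (nat \<Rightarrow> real) set \<Rightarrow> real" where
  "surface_area n A = Lim (at_right 0) (\<lambda>\<epsilon>. (vol n (parallel_body n A \<epsilon>) - vol n A) / \<epsilon>)"

definition orthonormal :: "nat \<Rightarrow> nat \<Rightarrow> (nat \<Rightarrow> nat \<Rightarrow> real) \<Rightarrow> bool" where
  "orthonormal n m u \<longleftrightarrow>
     (\<forall>j<m. u j \<in> Rn n) \<and> (\<forall>j<m. \<forall>k<m. ip n (u j) (u k) = (if j = k then 1 else 0))"

definition lincomb :: "nat \<Rightarrow> (nat \<Rightarrow> nat \<Rightarrow> real) \<Rightarrow> (nat \<Rightarrow> real) \<Rightarrow> nat \<Rightarrow> real" where
  "lincomb m u x = (\<lambda>i. \<Sum>j<m. x j * u j i)"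

definition proj_perp :: "nat \<Rightarrow> (nat \<Rightarrow> real) \<Rightarrow> (nat \<Rightarrow> real) \<Rightarrow> nat \<Rightarrow> real" where
  "proj_perp n \<xi> x = (\<lambda>i. x i - ip n x \<xi> * \<xi> i)"

text \<open>
  The hyperplane orthogonal to a unit vector \<open>\<xi>\<close> is identified with \<open>Rn (n - 1)\<close> by the linear
  isometry \<open>lincomb (n - 1) u\<close>, where \<open>u\<close> is an orthonormal basis of the hyperplane. Surface
  area is invariant under isometries, so the choice of \<open>u\<close> is immaterial.
\<close>

definition perp_basis :: "nat \<Rightarrow> (nat \<Rightarrow> real) \<Rightarrow> nat \<Rightarrow> nat \<Rightarrow> real" where
  "perp_basis n \<xi> = (SOME u. orthonormal n (n - 1) u \<and> (\<forall>j<n - 1. ip n (u j) \<xi> = 0))"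

definition perp_surface_area :: "nat \<Rightarrow> (nat \<Rightarrow> real) \<Rightarrow> (nat \<Rightarrow> real) set \<Rightarrow> real" where
  "perp_surface_area n \<xi> A =
     surface_area (n - 1) {x \<in> Rn (n - 1). lincomb (n - 1) (perp_basis n \<xi>) x \<in> A}"

text \<open>
  The orthogonal transformations of \<open>Rn n\<close> are the maps \<open>lincomb n u\<close> with \<open>u\<close> orthonormal of
  length \<open>n\<close>. For \<open>n \<ge> 2\<close> exactly one measure \<open>\<sigma>\<close> satisfies this predicate.
\<close>

definition rotation_invariant_prob :: "nat \<Rightarrow> (nat \<Rightarrow> real) measure \<Rightarrow> bool" where
  "rotation_invariant_prob n \<sigma> \<longleftrightarrow>
     prob_space \<sigma> \<and>
     space \<sigma> = unit_sphere n \<and>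
     sets \<sigma> = sets (restrict_space borel (unit_sphere n)) \<and>
     (\<forall>u. orthonormal n n u \<longrightarrow> distr \<sigma> \<sigma> (lincomb n u) = \<sigma>)"

end

theory Submission
  imports Defs "HOL-Library.Function_Algebras" "HOL-Library.Set_Algebras"
begin

text \<open>
  Let \<open>B\<close> be the unit ball, \<open>\<xi>\<close> a unit vector, \<open>I\<close> the centred unit segment in direction
  \<open>\<xi>\<close> and \<open>P\<close> the projection along \<open>\<xi>\<close>. Slicing along \<open>\<xi>\<close> gives
  \<open>|K + tB + sI| = f(t) + s g(t)\<close> with \<open>f(t) = |K + tB|\<close> and \<open>g(t) = |P K + t P B|\<close>, so that
  \<open>f'(0) = S(K)\<close>, \<open>g(0) = |P K|\<close> and \<open>g'(0) = S(P K)\<close>. By the Brunn--Minkowski inequality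
  the \<open>n\<close>-th root of \<open>f(t) + \<tau> t g(t)\<close> is concave in \<open>t\<close> for every \<open>\<tau> > 0\<close>. As
  \<open>f(t) \<ge> f(0) + t f'(0)\<close>, the terms of order \<open>t\<^sup>2\<close> yield
  \<open>\<tau> |K| S(P K) \<le> (n - 1) / (2n) (S(K) + \<tau> |P K|)\<^sup>2\<close>, and the best \<open>\<tau>\<close> gives
  \<open>|K| S(P K) \<le> 2 (n - 1) / n |P K| S(K)\<close>.

  It remains to average over \<open>\<xi>\<close>. Up to a constant \<open>\<kappa> / 2\<close>, the ball is a limit of sums of
  segments \<open>s\<^sub>i I\<^sub>i\<close>, where the weights \<open>s\<^sub>i\<close> and the directions form a quadrature rule for
  \<open>\<sigma>\<close>. Adding one segment at a time gives Cauchy's bound \<open>\<integral> |P K| d\<sigma> \<le> \<kappa> / 2 S(K)\<close>, and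
  applied to \<open>K = B\<close> it bounds \<open>\<kappa>\<close>. It also gives \<open>f(t) \<ge> f(0) + t f'(0)\<close>, because the
  increment of volume caused by a segment is monotone in the body.
\<close>

section \<open>Lebesgue measure on sequences supported on an initial segment\<close>

text \<open>The comparison of second order needs only first derivatives: \<open>f\<close> is bounded
  below by its tangent, \<open>g\<close> has a right derivative at 0, and the upper bound is the
  tangent of the concave root. The best \<tau> is the quotient of S(K) and |P K|, where the square
  equals 4 times the product of its two terms; this turns (n - 1) / (2n) into 2 (n - 1) / n.

  A surface area defined by \<open>Lim\<close> says nothing until the limit exists. For K, the
  difference quotients of the root of the volume are monotone, and zonotopes bound them. For P K,
  the volume of P K + t P B is the difference of the parallel volumes of K + I and of K, so
  existence is inherited from dimension n.

  No regularity of S(P K) in \<xi> is established. The quadrature is therefore one-sided: the sphere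
  is cut into small cells, a weight is the measure of a cell, and its node is a point where the
  integrand is not below its mean over the cell. Smallness alone brings the zonotope close to a
  ball, so one rule serves both purposes. A function that is not integrable has Bochner integral 0,
  and then the bound is trivial.\<close>

type_synonym vec = "nat \<Rightarrow> real"

definition scl :: "real \<Rightarrow> vec \<Rightarrow> vec" where
  "scl c x = (\<lambda>i. c * x i)"

definition emb :: "nat \<Rightarrow> vec \<Rightarrow> vec" where
  "emb n x = (\<lambda>i. if i < n then x i else 0)"

text \<open>Pushed forward to all sequences, the measures of all dimensions share one Borel
  sigma-algebra, and passing from \<open>n\<close> to \<open>Suc n\<close> is an update at index
  \<open>n\<close>.\<close>

definition leb :: "nat \<Rightarrow> vec measure" where
  "leb n = distr (Pi\<^sub>M {..<n} (\<lambda>_. lborel)) borel (emb n)"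

lemma Rn_iff: "x \<in> Rn n \<longleftrightarrow> (\<forall>i\<ge>n. x i = 0)"
  by (simp add: topspace_Euclidean_space)

lemma scl_apply [simp]: "scl c x i = c * x i"
  by (simp add: scl_def)

lemma emb_in_Rn [simp]: "emb n x \<in> Rn n"
  by (simp add: Rn_iff emb_def)

lemma emb_id: "x \<in> Rn n \<Longrightarrow> emb n x = x"
  by (auto simp: Rn_iff emb_def fun_eq_iff)

lemma Rn_add [intro]: "x \<in> Rn n \<Longrightarrow> y \<in> Rn n \<Longrightarrow> x + y \<in> Rn n"
  by (simp add: Rn_iff)

lemma Rn_diff [intro]: "x \<in> Rn n \<Longrightarrow> y \<in> Rn n \<Longrightarrow> x - y \<in> Rn n"
  by (simp add: Rn_iff)

lemma Rn_scl [intro]: "x \<in> Rn n \<Longrightarrow> scl c x \<in> Rn n"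
  by (simp add: Rn_iff)

lemma Rn_zero [simp]: "0 \<in> Rn n"
  by (simp add: Rn_iff)

lemma sets_leb [measurable_cong, simp]: "sets (leb n) = sets borel"
  by (simp add: leb_def)

lemma space_leb [simp]: "space (leb n) = UNIV"
  by (simp add: leb_def)

lemma measurable_component [measurable]: "(\<lambda>x::vec. x i) \<in> borel_measurable borel"
  by (rule borel_measurable_continuous_onI) (auto intro: continuous_on_product_coordinates)

lemma measurable_vecI:
  fixes f :: "'a \<Rightarrow> vec"
  assumes "\<And>i. (\<lambda>x. f x i) \<in> borel_measurable M"
  shows "f \<in> borel_measurable M"
  using assms by (rule measurable_coordinatewise_then_product)

lemma measurable_emb [measurable]: "emb n \<in> borel_measurable (Pi\<^sub>M {..<n} (\<lambda>_. lborel))"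
proof (rule measurable_vecI)
  fix i
  show "(\<lambda>x. emb n x i) \<in> borel_measurable (Pi\<^sub>M {..<n} (\<lambda>_. lborel))"
  proof (cases "i < n")
    case True
    then show ?thesis
      using measurable_component_singleton[of i "{..<n}" "\<lambda>_. lborel :: real measure"]
      by (simp add: emb_def)
  qed (simp add: emb_def)
qed

lemma measurable_emb_borel [measurable]: "emb n \<in> borel_measurable borel"
  by (rule measurable_vecI) (auto simp: emb_def)

lemma measurable_upd [measurable]:
  assumes [measurable]: "f \<in> borel_measurable M" "g \<in> borel_measurable M"
  shows "(\<lambda>x. (f x :: vec)(n := g x)) \<in> borel_measurable M"
proof (rule measurable_vecI)
  fix i
  have [measurable]: "(\<lambda>x. f x j) \<in> borel_measurable M" for j
    using measurable_compose[OF assms(1) measurable_component] .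
  show "(\<lambda>x. ((f x)(n := g x)) i) \<in> borel_measurable M"
    by (cases "i = n") auto
qed

lemma measurable_affine [measurable]: "(\<lambda>x. z + scl c x) \<in> borel_measurable borel"
  by (rule measurable_vecI) auto

lemma vol_eq: "A \<in> sets borel \<Longrightarrow> vol n A = measure (leb n) A"
  unfolding leb_def vol_def
  by (subst measure_distr) (auto intro!: arg_cong[where f = "measure _"] simp: emb_def)

lemma nn_integral_leb:
  assumes "f \<in> borel_measurable borel"
  shows "(\<integral>\<^sup>+x. f x \<partial>leb n) = (\<integral>\<^sup>+x. f (emb n x) \<partial>Pi\<^sub>M {..<n} (\<lambda>_. lborel))"
  unfolding leb_def using assms by (subst nn_integral_distr) auto

lemma nn_integral_leb_0:
  assumes "f \<in> borel_measurable borel"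
  shows "(\<integral>\<^sup>+x. f x \<partial>leb 0) = f 0"
proof -
  interpret product_sigma_finite "\<lambda>_::nat. lborel :: real measure" by standard
  show ?thesis
    using assms by (simp add: nn_integral_leb emb_def zero_fun_def PiM_empty nn_integral_count_space_finite)
qed

text \<open>Fubini for the last coordinate, the step of every induction on the dimension.\<close>

lemma nn_integral_leb_Suc:
  assumes [measurable]: "f \<in> borel_measurable borel"
  shows "(\<integral>\<^sup>+x. f x \<partial>leb (Suc n)) = (\<integral>\<^sup>+x. (\<integral>\<^sup>+t. f (x(n := t)) \<partial>lborel) \<partial>leb n)"
proof -
  interpret product_sigma_finite "\<lambda>_::nat. lborel :: real measure" by standard
  have [measurable]: "(\<lambda>x. \<integral>\<^sup>+t. f (x(n := t)) \<partial>lborel) \<in> borel_measurable borel"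
    by (rule lborel.borel_measurable_nn_integral) simp
  have emb: "emb (Suc n) (x(n := t)) = (emb n x)(n := t)" for x :: vec and t
    by (auto simp: emb_def fun_eq_iff)
  have m: "(\<lambda>x. f (emb (Suc n) x)) \<in> borel_measurable (Pi\<^sub>M (insert n {..<n}) (\<lambda>_. lborel))"
    using measurable_compose[OF measurable_emb[of "Suc n"] assms] by (simp add: lessThan_Suc)
  have "(\<integral>\<^sup>+x. f x \<partial>leb (Suc n))
      = (\<integral>\<^sup>+x. f (emb (Suc n) x) \<partial>Pi\<^sub>M (insert n {..<n}) (\<lambda>_. lborel))"
    by (simp add: nn_integral_leb lessThan_Suc)
  also have "\<dots> = (\<integral>\<^sup>+x. (\<integral>\<^sup>+t. f ((emb n x)(n := t)) \<partial>lborel) \<partial>Pi\<^sub>M {..<n} (\<lambda>_. lborel))"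
    by (subst product_nn_integral_insert[OF _ _ m]) (auto simp: emb)
  also have "\<dots> = (\<integral>\<^sup>+x. (\<integral>\<^sup>+t. f (x(n := t)) \<partial>lborel) \<partial>leb n)"
    by (subst nn_integral_leb) auto
  finally show ?thesis .
qed

text \<open>One-dimensional substitution in the last coordinate yields one factor \<open>c\<close>;
  the induction hypothesis treats the others, with the shift \<open>emb n z\<close>.\<close>

lemma nn_integral_leb_affine:
  assumes "f \<in> borel_measurable borel" "c > 0" "z \<in> Rn n"
  shows "(\<integral>\<^sup>+x. f x \<partial>leb n) = ennreal (c ^ n) * (\<integral>\<^sup>+x. f (z + scl c x) \<partial>leb n)"
  using assms
proof (induction n arbitrary: f z)
  case 0
  then have "z = 0" by (auto simp: Rn_iff fun_eq_iff)
  then show ?case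
    using measurable_compose[OF measurable_affine[of z c] 0(1)]
    by (simp add: nn_integral_leb_0[OF 0(1)] nn_integral_leb_0 scl_def zero_fun_def plus_fun_def)
next
  case (Suc n)
  note [measurable] = Suc.prems(1)
  define F where "F = (\<lambda>x. \<integral>\<^sup>+t. f (x(n := t)) \<partial>lborel)"
  have [measurable]: "F \<in> borel_measurable borel"
    unfolding F_def by (rule lborel.borel_measurable_nn_integral) simp
  have upd: "(emb n z + scl c x)(n := z n + c * t) = z + scl c (x(n := t))" for x t
    using Suc.prems(3) by (auto simp: fun_eq_iff emb_def Rn_iff)
  have "F (emb n z + scl c x) = ennreal c * (\<integral>\<^sup>+t. f (z + scl c (x(n := t))) \<partial>lborel)" for x
  proof -
    have m: "(\<lambda>t. f ((emb n z + scl c x)(n := t))) \<in> borel_measurable borel"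
      by measurable
    show ?thesis
      unfolding F_def
      by (subst nn_integral_real_affine[OF m, of c "z n"]) (use \<open>c > 0\<close> in \<open>auto simp: upd\<close>)
  qed
  note F_eq = this
  have m2: "(\<lambda>x. f (z + scl c x)) \<in> borel_measurable borel" by measurable
  have m3: "(\<lambda>x. \<integral>\<^sup>+t. f (z + scl c (x(n := t))) \<partial>lborel) \<in> borel_measurable borel"
    by (rule lborel.borel_measurable_nn_integral) simp
  have "(\<integral>\<^sup>+x. f x \<partial>leb (Suc n)) = (\<integral>\<^sup>+x. F x \<partial>leb n)"
    by (simp add: nn_integral_leb_Suc F_def)
  also have "\<dots> = ennreal (c ^ n) * (\<integral>\<^sup>+x. F (emb n z + scl c x) \<partial>leb n)"
    by (rule Suc.IH) (use Suc.prems in auto)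
  also have "\<dots> = ennreal (c ^ n) * (ennreal c * (\<integral>\<^sup>+x. f (z + scl c x) \<partial>leb (Suc n)))"
    using m3 by (simp add: F_eq nn_integral_leb_Suc[OF m2] nn_integral_cmult)
  also have "\<dots> = ennreal (c ^ Suc n) * (\<integral>\<^sup>+x. f (z + scl c x) \<partial>leb (Suc n))"
    unfolding mult.assoc[symmetric] using \<open>c > 0\<close>
    by (subst ennreal_mult[symmetric]) (simp_all only: power_Suc mult.commute[of c], simp_all)
  finally show ?case .
qed

lemma emeasure_leb_affine:
  assumes "A \<in> sets borel" "c > 0" "z \<in> Rn n"
  shows "emeasure (leb n) A = ennreal (c ^ n) * emeasure (leb n) {x. z + scl c x \<in> A}"
proof -
  note [measurable] = assms(1)
  have "{x. z + scl c x \<in> A} = (\<lambda>x. z + scl c x) -` A \<inter> space borel" by auto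
  also have "\<dots> \<in> sets borel" by measurable
  finally have [measurable]: "{x. z + scl c x \<in> A} \<in> sets borel" .
  have "emeasure (leb n) A = (\<integral>\<^sup>+x. indicator A x \<partial>leb n)" by simp
  also have "\<dots> = ennreal (c ^ n) * (\<integral>\<^sup>+x. indicator A (z + scl c x) \<partial>leb n)"
    by (rule nn_integral_leb_affine) (use assms in auto)
  also have "(\<integral>\<^sup>+x. indicator A (z + scl c x) \<partial>leb n) = (\<integral>\<^sup>+x. indicator {x. z + scl c x \<in> A} x \<partial>leb n)"
    by (intro nn_integral_cong) (auto simp: indicator_def)
  also have "\<dots> = emeasure (leb n) {x. z + scl c x \<in> A}"
    by simp
  finally show ?thesis .
qed

lemma measurable_ip [measurable]: "(\<lambda>x. ip n x y) \<in> borel_measurable borel" "(\<lambda>x. ip n y x) \<in> borel_measurable borel"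
  "(\<lambda>x. ip n x x) \<in> borel_measurable borel"
  unfolding ip_def by measurable

text \<open>A ball in the first \<open>n\<close> coordinates with all later ones free, so that
  membership in \<open>Rn n\<close> need not be carried along.\<close>

definition cyl_ball :: "nat \<Rightarrow> real \<Rightarrow> vec set" where
  "cyl_ball n r = {x. ip n x x \<le> r\<^sup>2}"

lemma sets_cyl_ball [measurable]: "cyl_ball n r \<in> sets borel"
proof -
  have "cyl_ball n r = {x \<in> space borel. ip n x x \<le> r\<^sup>2}" by (simp add: cyl_ball_def)
  also have "\<dots> \<in> sets borel" by measurable
  finally show ?thesis .
qed

lemma emeasure_cyl_ball:
  assumes "r > 0"
  shows "emeasure (leb n) (cyl_ball n r) = ennreal (unit_ball_vol n * r ^ n)"
proof -
  have "emeasure (leb n) (cyl_ball n r) = emeasure (Pi\<^sub>M {..<n} (\<lambda>_. lborel)) (emb n -` cyl_ball n r \<inter> space (Pi\<^sub>M {..<n} (\<lambda>_. lborel)))"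
    unfolding leb_def by (rule emeasure_distr) auto
  also have "emb n -` cyl_ball n r \<inter> space (Pi\<^sub>M {..<n} (\<lambda>_. lborel))
      = {f. sqrt (\<Sum>i<n. (f i)\<^sup>2) \<le> r} \<inter> space (Pi\<^sub>M {..<n} (\<lambda>_. lborel :: real measure))"
    using assms by (auto simp: cyl_ball_def ip_def emb_def power2_eq_square[symmetric] real_sqrt_le_iff'
        intro!: real_le_lsqrt sum_nonneg dest: sqrt_le_D)
  finally show ?thesis
    using emeasure_cball_aux[of "{..<n}" r] assms by simp
qed

lemma sigma_finite_leb: "sigma_finite_measure (leb n)"
proof
  let ?A = "range (\<lambda>k. cyl_ball n (real (Suc k)))"
  have "\<exists>k. x \<in> cyl_ball n (real (Suc k))" for x
  proof -
    obtain k :: nat where "ip n x x \<le> real k" using real_arch_simple by blast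
    also have "real k \<le> (real (Suc k))\<^sup>2" by (simp add: power2_eq_square algebra_simps)
    finally show ?thesis by (auto simp: cyl_ball_def)
  qed
  then have "\<Union> ?A = space (leb n)" by auto
  moreover have "\<forall>a\<in>?A. emeasure (leb n) a \<noteq> \<infinity>" 
    using emeasure_cyl_ball[of "real (Suc _)" n] by (auto simp del: of_nat_Suc)
  ultimately show "\<exists>A. countable A \<and> A \<subseteq> sets (leb n) \<and> \<Union> A = space (leb n) \<and> (\<forall>a\<in>A. emeasure (leb n) a \<noteq> \<infinity>)"
    by (intro exI[of _ ?A]) auto
qed

section \<open>Inner product and rotation invariance\<close>

lemma ip_commute: "ip n x y = ip n y x"
  by (simp add: ip_def mult.commute)

lemma ip_add_left: "ip n (x + y) z = ip n x z + ip n y z"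
  by (simp add: ip_def algebra_simps sum.distrib)

lemma ip_add_right: "ip n z (x + y) = ip n z x + ip n z y"
  by (simp add: ip_def algebra_simps sum.distrib)

lemma ip_diff_left: "ip n (x - y) z = ip n x z - ip n y z"
  by (simp add: ip_def algebra_simps sum_subtractf)

lemma ip_diff_right: "ip n z (x - y) = ip n z x - ip n z y"
  by (simp add: ip_def algebra_simps sum_subtractf)

lemma ip_minus [simp]: "ip n (- x) y = - ip n x y" "ip n x (- y) = - ip n x y"
  by (simp_all add: ip_def sum_negf)

lemma ip_scl_left [simp]: "ip n (scl c x) y = c * ip n x y"
  by (simp add: ip_def algebra_simps sum_distrib_left)

lemma ip_scl_right [simp]: "ip n x (scl c y) = c * ip n x y"
  by (simp add: ip_def algebra_simps sum_distrib_left)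

lemma ip_zero [simp]: "ip n 0 x = 0" "ip n x 0 = 0"
  by (simp_all add: ip_def)

lemma ip_self_nonneg [simp]: "ip n x x \<ge> 0"
  by (simp add: ip_def sum_nonneg)

lemma ip_self_eq_0: "ip n x x = 0 \<Longrightarrow> x \<in> Rn n \<Longrightarrow> x = 0"
  by (simp add: ip_def Rn_iff sum_nonneg_eq_0_iff fun_eq_iff) (metis lessThan_iff linorder_not_less)

lemma ip_sum_left: "ip n (\<lambda>i. \<Sum>j\<in>J. f j i) y = (\<Sum>j\<in>J. ip n (f j) y)"
  by (simp add: ip_def sum_distrib_right sum.swap[of _ "{..<n}"])

definition nrm :: "nat \<Rightarrow> vec \<Rightarrow> real" where
  "nrm n x = sqrt (ip n x x)"

lemma nrm_L2: "nrm n x = L2_set x {..<n}"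
  by (simp add: nrm_def L2_set_def ip_def power2_eq_square)

lemma nrm_nonneg [simp]: "nrm n x \<ge> 0"
  by (simp add: nrm_def)

lemma nrm_sq: "(nrm n x)\<^sup>2 = ip n x x"
  by (simp add: nrm_def)

lemma nrm_triangle: "nrm n (x + y) \<le> nrm n x + nrm n y"
  unfolding nrm_L2 plus_fun_def by (rule L2_set_triangle_ineq)

lemma nrm_scl: "nrm n (scl c x) = \<bar>c\<bar> * nrm n x"
  by (simp add: nrm_def real_sqrt_mult mult.assoc[symmetric])

lemma ip_le_nrm: "ip n x y \<le> nrm n x * nrm n y"
  unfolding nrm_L2 ip_def
  by (rule order_trans[OF sum_mono L2_set_mult_ineq]) (simp add: abs_mult[symmetric])

lemma nrm_eq_0: "nrm n x = 0 \<Longrightarrow> x \<in> Rn n \<Longrightarrow> x = 0"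
  by (simp add: nrm_def ip_self_eq_0)

lemma lincomb_add: "lincomb m u (x + y) = lincomb m u x + lincomb m u y"
  by (simp add: lincomb_def fun_eq_iff algebra_simps sum.distrib)

lemma lincomb_in_Rn: "orthonormal n m u \<Longrightarrow> lincomb m u x \<in> Rn n"
  by (auto simp: lincomb_def orthonormal_def Rn_iff intro!: sum.neutral)

lemma ip_lincomb_basis:
  assumes "orthonormal n m u" "k < m"
  shows "ip n (lincomb m u x) (u k) = x k"
proof -
  have "ip n (lincomb m u x) (u k) = (\<Sum>j<m. ip n (\<lambda>i. x j * u j i) (u k))"
    unfolding lincomb_def by (rule ip_sum_left)
  also have "\<dots> = (\<Sum>j<m. x j * (if j = k then 1 else 0))"
    using assms by (intro sum.cong) (auto simp: orthonormal_def ip_scl_left[unfolded scl_def])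
  also have "\<dots> = x k" using assms(2) by (simp add: if_distrib[of "(*) _"] cong: if_cong)
  finally show ?thesis .
qed

lemma ip_lincomb:
  assumes "orthonormal n m u"
  shows "ip n (lincomb m u x) (lincomb m u y) = ip m x y"
proof -
  have "ip n (lincomb m u x) (lincomb m u y) = (\<Sum>j<m. ip n (\<lambda>i. x j * u j i) (lincomb m u y))"
    unfolding lincomb_def[of m u x] by (rule ip_sum_left)
  also have "\<dots> = (\<Sum>j<m. x j * y j)"
    using assms ip_lincomb_basis[OF assms]
    by (intro sum.cong) (auto simp: ip_scl_left[unfolded scl_def] ip_commute[of n "u _"])
  finally show ?thesis by (simp add: ip_def)
qed

text \<open>
  The squared distances of the unit vectors from the span of \<open>u\<close> are nonnegative, and their
  sum is \<open>n\<close> minus the sum of the squared norms of the \<open>u j\<close>, that is, zero.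
\<close>
lemma orthonormal_dual:
  assumes u: "orthonormal n n u" and "i < n" "k < n"
  shows "(\<Sum>j<n. u j i * u j k) = (if i = k then 1 else 0)"
proof -
  define e :: "nat \<Rightarrow> vec" where "e = (\<lambda>i k. if k = i then 1 else 0)"
  define p where "p = (\<lambda>i. lincomb n u (\<lambda>j. u j i))"
  have ipe: "ip n (e i) x = x i" if "i < n" for i x
    using that by (simp add: ip_def e_def if_distrib[of "\<lambda>a. a * _"] cong: if_cong)
  have pe: "ip n (p i) (e i) = (\<Sum>j<n. (u j i)\<^sup>2)" if "i < n" for i
    using that by (subst ip_commute, subst ipe) (auto simp: p_def lincomb_def power2_eq_square)
  have pp: "ip n (p i) (p i) = (\<Sum>j<n. (u j i)\<^sup>2)" for i
    unfolding p_def ip_lincomb[OF u] by (simp add: ip_def power2_eq_square)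
  have d: "ip n (e i - p i) (e i - p i) = 1 - (\<Sum>j<n. (u j i)\<^sup>2)" if "i < n" for i
  proof -
    have "ip n (e i) (e i) = 1" using that by (simp add: ipe) (simp add: e_def)
    then show ?thesis
      using pe[OF that] pp[of i] by (simp add: ip_diff_left ip_diff_right ip_commute[of n "e i" "p i"])
  qed
  have "(\<Sum>i<n. ip n (e i - p i) (e i - p i)) = real n - (\<Sum>i<n. \<Sum>j<n. (u j i)\<^sup>2)"
    by (simp add: d sum_subtractf)
  also have "(\<Sum>i<n. \<Sum>j<n. (u j i)\<^sup>2) = (\<Sum>j<n. ip n (u j) (u j))"
    by (subst sum.swap) (simp add: ip_def power2_eq_square)
  also have "\<dots> = real n" using u by (simp add: orthonormal_def)
  finally have "(\<Sum>i<n. ip n (e i - p i) (e i - p i)) = 0" by (simp only: diff_self)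
  then have "ip n (e i - p i) (e i - p i) = 0"
    using \<open>i < n\<close> by (subst (asm) sum_nonneg_eq_0_iff) auto
  moreover have "e i - p i \<in> Rn n"
    using \<open>i < n\<close> lincomb_in_Rn[OF u] by (intro Rn_diff) (auto simp: p_def e_def Rn_iff)
  ultimately have "e i - p i = 0" by (rule ip_self_eq_0)
  then have "p i k = e i k" by (simp add: fun_eq_iff)
  then show ?thesis by (auto simp: p_def e_def lincomb_def)
qed

definition coords :: "nat \<Rightarrow> (nat \<Rightarrow> vec) \<Rightarrow> vec \<Rightarrow> vec" where
  "coords n u x = (\<lambda>j. if j < n then ip n x (u j) else 0)"

lemma coords_in_Rn [simp]: "coords n u x \<in> Rn n"
  by (simp add: coords_def Rn_iff)

lemma lincomb_coords:
  assumes u: "orthonormal n n u"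
  shows "lincomb n u (coords n u x) = emb n x"
proof
  fix k
  show "lincomb n u (coords n u x) k = emb n x k"
  proof (cases "k < n")
    case True
    have "lincomb n u (coords n u x) k = (\<Sum>j<n. \<Sum>i<n. x i * (u j i * u j k))"
      by (simp add: lincomb_def coords_def ip_def sum_distrib_right mult.assoc)
    also have "\<dots> = (\<Sum>i<n. x i * (\<Sum>j<n. u j i * u j k))"
      by (subst sum.swap) (simp add: sum_distrib_left)
    also have "\<dots> = (\<Sum>i<n. x i * (if i = k then 1 else 0))"
      using True by (intro sum.cong) (auto simp: orthonormal_dual[OF u])
    also have "\<dots> = x k" using True by (simp add: if_distrib[of "(*) _"] cong: if_cong)
    finally show ?thesis using True by (simp add: emb_def)
  next
    case False
    then show ?thesis using lincomb_in_Rn[OF u, of "coords n u x"] by (auto simp: Rn_iff emb_def)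
  qed
qed

lemma measurable_lincomb [measurable]: "lincomb m u \<in> borel_measurable borel"
  unfolding lincomb_def by (rule measurable_vecI) auto

lemma measurable_vec_add [measurable]:
  assumes "f \<in> borel_measurable M" "g \<in> borel_measurable M"
  shows "(\<lambda>x. f x + g x :: vec) \<in> borel_measurable M"
  by (rule measurable_vecI)
    (use measurable_compose[OF assms(1) measurable_component]
      measurable_compose[OF assms(2) measurable_component] in simp)

lemma measurable_vec_minus [measurable]:
  assumes "f \<in> borel_measurable M"
  shows "(\<lambda>x. - f x :: vec) \<in> borel_measurable M"
  by (rule measurable_vecI) (use measurable_compose[OF assms(1) measurable_component] in simp)

lemma measurable_vec_diff [measurable]:
  assumes "f \<in> borel_measurable M" "g \<in> borel_measurable M"
  shows "(\<lambda>x. f x - g x :: vec) \<in> borel_measurable M"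
  by (rule measurable_vecI)
    (use measurable_compose[OF assms(1) measurable_component]
      measurable_compose[OF assms(2) measurable_component] in simp)

lemma nn_integral_leb_emb:
  assumes [measurable]: "f \<in> borel_measurable borel"
  shows "(\<integral>\<^sup>+x. f (emb n x) \<partial>leb n) = (\<integral>\<^sup>+x. f x \<partial>leb n)"
proof -
  have "emb n (emb n x) = emb n x" for x by (simp add: emb_id)
  then show ?thesis by (simp add: nn_integral_leb)
qed

lemma nn_integral_leb_shift:
  assumes "f \<in> borel_measurable borel" "z \<in> Rn n"
  shows "(\<integral>\<^sup>+x. f (z + x) \<partial>leb n) = (\<integral>\<^sup>+x. f x \<partial>leb n)"
  using nn_integral_leb_affine[OF assms(1), of 1 z n] assms(2) by (simp add: scl_def)

text \<open>
  Uniqueness of Haar measure, specialised: for \<open>\<nu>\<close> the image of \<open>\<mu> = leb n\<close> and \<open>B\<close> the unit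
  ball, Fubini and translation invariance give \<open>\<nu> A * \<mu> B = \<mu> A * \<nu> B\<close>, and \<open>\<nu> B = \<mu> B\<close>.
\<close>
lemma emeasure_leb_rotation:
  assumes u: "orthonormal n n u" and [measurable]: "A \<in> sets borel"
  shows "emeasure (leb n) (lincomb n u -` A) = emeasure (leb n) A"
proof -
  interpret sigma_finite_measure "leb n" by (rule sigma_finite_leb)
  interpret P: pair_sigma_finite "leb n" "leb n" by standard
  let ?T = "lincomb n u" and ?B = "cyl_ball n 1"
  have TR: "?T x \<in> Rn n" for x by (rule lincomb_in_Rn[OF u])
  have [measurable]: "?T -` A \<in> sets borel"
    using measurable_sets[OF measurable_lincomb[of n u] assms(2)] by simp
  have Tc: "?T (coords n u y + x) = emb n y + ?T x" for x y
    by (simp add: lincomb_add lincomb_coords[OF u])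
  have ipe: "ip n (emb n y) z = ip n y z" "ip n z (emb n y) = ip n z y" for y z
    by (simp_all add: ip_def emb_def)
  \<comment> \<open>\<open>ip n\<close> ignores the entries of \<open>y\<close> beyond
    \<open>n\<close>, so \<open>y\<close> and \<open>emb n y\<close> cancel, and
    \<open>lincomb n u\<close> is an isometry.\<close>
  have B: "y + - (emb n y + ?T x) \<in> ?B \<longleftrightarrow> x \<in> ?B" for x y
  proof -
    have "ip n (y + - (emb n y + ?T x)) (y + - (emb n y + ?T x)) = ip n (?T x) (?T x)"
      by (simp add: ip_add_left ip_add_right ip_diff_left ip_diff_right ipe)
    then show ?thesis by (simp add: cyl_ball_def ip_lincomb[OF u])
  qed
  have "emeasure (leb n) (?T -` A) * emeasure (leb n) ?B
      = (\<integral>\<^sup>+x. indicator A (?T x) * emeasure (leb n) ?B \<partial>leb n)"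
    by (subst nn_integral_multc) (auto simp: indicator_vimage[symmetric])
  also have "\<dots> = (\<integral>\<^sup>+x. (\<integral>\<^sup>+y. indicator A (?T x) * indicator ?B (y + - ?T x) \<partial>leb n) \<partial>leb n)"
  proof (intro nn_integral_cong)
    fix x
    have "(\<integral>\<^sup>+y. indicator ?B (y + - ?T x) \<partial>leb n) = (\<integral>\<^sup>+y. indicator ?B (- ?T x + y) \<partial>leb n)"
      by (simp add: add.commute)
    also have "\<dots> = (\<integral>\<^sup>+y. indicator ?B y \<partial>leb n)"
      by (rule nn_integral_leb_shift) (use TR[of x] in \<open>auto simp: Rn_iff\<close>)
    finally have "(\<integral>\<^sup>+y. indicator ?B (y + - ?T x) \<partial>leb n) = emeasure (leb n) ?B" by simp
    then show "indicator A (?T x) * emeasure (leb n) ?B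
        = (\<integral>\<^sup>+y. indicator A (?T x) * indicator ?B (y + - ?T x) \<partial>leb n)"
      by (subst nn_integral_cmult) (simp_all only:, measurable)
  qed
  also have "\<dots> = (\<integral>\<^sup>+y. (\<integral>\<^sup>+x. indicator A (?T x) * indicator ?B (y + - ?T x) \<partial>leb n) \<partial>leb n)"
    by (rule P.Fubini'[symmetric]) measurable
  \<comment> \<open>Translating \<open>x\<close> by \<open>coords n u y\<close> moves
    \<open>y\<close> from the ball to \<open>A\<close>; only the isometry is then left in the
    ball.\<close>
  also have "\<dots> = (\<integral>\<^sup>+y. (\<integral>\<^sup>+x. indicator A (emb n y + ?T x) * indicator ?B x \<partial>leb n) \<partial>leb n)"
  proof (rule nn_integral_cong)
    fix y
    have "(\<integral>\<^sup>+x. indicator A (?T x) * indicator ?B (y + - ?T x) \<partial>leb n)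
        = (\<integral>\<^sup>+x. indicator A (?T (coords n u y + x)) * indicator ?B (y + - ?T (coords n u y + x)) \<partial>leb n)"
      by (rule nn_integral_leb_shift[symmetric]) auto
    also have "\<dots> = (\<integral>\<^sup>+x. indicator A (emb n y + ?T x) * indicator ?B x \<partial>leb n)"
      using B by (intro nn_integral_cong) (auto simp: Tc indicator_def)
    finally show "(\<integral>\<^sup>+x. indicator A (?T x) * indicator ?B (y + - ?T x) \<partial>leb n)
        = (\<integral>\<^sup>+x. indicator A (emb n y + ?T x) * indicator ?B x \<partial>leb n)" .
  qed
  also have "\<dots> = (\<integral>\<^sup>+x. (\<integral>\<^sup>+y. indicator A (emb n y + ?T x) * indicator ?B x \<partial>leb n) \<partial>leb n)"
    by (rule P.Fubini') measurable
  also have "\<dots> = (\<integral>\<^sup>+x. emeasure (leb n) A * indicator ?B x \<partial>leb n)"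
  proof (intro nn_integral_cong)
    fix x
    have "(\<integral>\<^sup>+y. indicator A (emb n y + ?T x) \<partial>leb n) = (\<integral>\<^sup>+y. indicator A (y + ?T x) \<partial>leb n)"
      by (rule nn_integral_leb_emb) measurable
    also have "\<dots> = (\<integral>\<^sup>+y. indicator A (?T x + y) \<partial>leb n)" by (simp add: add.commute)
    also have "\<dots> = (\<integral>\<^sup>+y. indicator A y \<partial>leb n)"
      by (rule nn_integral_leb_shift) (use TR in auto)
    finally have "(\<integral>\<^sup>+y. indicator A (emb n y + ?T x) \<partial>leb n) = emeasure (leb n) A" by simp
    then show "(\<integral>\<^sup>+y. indicator A (emb n y + ?T x) * indicator ?B x \<partial>leb n) = emeasure (leb n) A * indicator ?B x"
      by (subst nn_integral_multc) auto
  qed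
  also have "\<dots> = emeasure (leb n) A * emeasure (leb n) ?B"
    by (subst nn_integral_cmult) auto
  finally have "ennreal (unit_ball_vol n) * emeasure (leb n) (?T -` A)
      = ennreal (unit_ball_vol n) * emeasure (leb n) A"
    by (simp add: emeasure_cyl_ball mult.commute)
  moreover have "ennreal (unit_ball_vol n) \<noteq> 0"
    using unit_ball_vol_pos[of "real n"] by (simp add: ennreal_eq_0_iff not_le)
  ultimately show ?thesis by (subst (asm) ennreal_mult_cancel_left) auto
qed

section \<open>Compact convex sets and sums with segments\<close>

lemma continuous_on_component:
  fixes f :: "'a::topological_space \<Rightarrow> vec"
  shows "continuous_on S f \<Longrightarrow> continuous_on S (\<lambda>x. f x i)"
  by (rule continuous_on_product_then_coordinatewise)

lemma continuous_on_coordinate: "continuous_on S (\<lambda>x::vec. x i)"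
  by (rule continuous_on_component[OF continuous_on_id])

lemma continuous_on_vec_add:
  fixes f g :: "'a::topological_space \<Rightarrow> vec"
  shows "continuous_on S f \<Longrightarrow> continuous_on S g \<Longrightarrow> continuous_on S (\<lambda>x. f x + g x)"
  by (rule continuous_on_coordinatewise_then_product) (simp, rule continuous_on_add; erule continuous_on_component)

lemma continuous_on_scl:
  fixes f :: "'a::topological_space \<Rightarrow> real"
  shows "continuous_on S f \<Longrightarrow> continuous_on S g \<Longrightarrow> continuous_on S (\<lambda>x. scl (f x) (g x))"
  by (rule continuous_on_coordinatewise_then_product) (simp, rule continuous_on_mult, assumption, erule continuous_on_component)

lemma continuous_on_ip:
  fixes f g :: "'a::topological_space \<Rightarrow> vec"
  shows "continuous_on S f \<Longrightarrow> continuous_on S g \<Longrightarrow> continuous_on S (\<lambda>x. ip n (f x) (g x))"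
  unfolding ip_def by (rule continuous_on_sum, rule continuous_on_mult; erule continuous_on_component)

lemma continuous_on_emb: "continuous_on S (emb n)"
proof (rule continuous_on_coordinatewise_then_product)
  show "continuous_on S (\<lambda>x. emb n x i)" for i
    unfolding emb_def by (cases "i < n") (auto intro!: continuous_on_coordinate)
qed

lemma continuous_on_coords: "continuous_on S (coords n u)"
proof (rule continuous_on_coordinatewise_then_product)
  show "continuous_on S (\<lambda>x. coords n u x i)" for i
    unfolding coords_def by (cases "i < n") (auto intro!: continuous_on_ip)
qed

definition cvx :: "vec set \<Rightarrow> bool" where
  "cvx A \<longleftrightarrow> (\<forall>x\<in>A. \<forall>y\<in>A. \<forall>t\<in>{0..1}. scl (1 - t) x + scl t y \<in> A)"

definition cpt :: "nat \<Rightarrow> vec set \<Rightarrow> bool" where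
  "cpt n A \<longleftrightarrow> compact A \<and> A \<subseteq> Rn n"

definition conv_cpt :: "nat \<Rightarrow> vec set \<Rightarrow> bool" where
  "conv_cpt n A \<longleftrightarrow> cpt n A \<and> cvx A"

text \<open>Centred, so that 0 belongs to every sum of segments and such sums can only enlarge a
  body.\<close>

definition segment :: "vec \<Rightarrow> vec set" where
  "segment v = (\<lambda>t. scl t v) ` {-1/2..1/2}"

lemma scl_add: "scl c (x + y) = scl c x + scl c y"
  by (simp add: fun_eq_iff algebra_simps)

lemma scl_add_left: "scl (a + b) x = scl a x + scl b x"
  by (simp add: fun_eq_iff algebra_simps)

lemma scl_scl [simp]: "scl a (scl b x) = scl (a * b) x"
  by (simp add: fun_eq_iff)

lemma scl_one [simp]: "scl 1 x = x" and scl_zero [simp]: "scl 0 x = 0" "scl c 0 = 0"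
  by (simp_all add: fun_eq_iff)

lemma cvxD: "cvx A \<Longrightarrow> x \<in> A \<Longrightarrow> y \<in> A \<Longrightarrow> 0 \<le> t \<Longrightarrow> t \<le> 1 \<Longrightarrow> scl (1 - t) x + scl t y \<in> A"
  by (auto simp: cvx_def)

lemma cvx_add:
  assumes "cvx A" "cvx B"
  shows "cvx (A + B)"
  unfolding cvx_def
proof (intro ballI)
  fix x y and t :: real
  assume "x \<in> A + B" "y \<in> A + B" and t: "t \<in> {0..1}"
  then obtain a b a' b' where ab: "a \<in> A" "b \<in> B" "x = a + b" "a' \<in> A" "b' \<in> B" "y = a' + b'"
    by (auto elim!: set_plus_elim)
  have "scl (1 - t) x + scl t y = (scl (1 - t) a + scl t a') + (scl (1 - t) b + scl t b')"
    by (simp add: ab scl_add algebra_simps)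
  also have "\<dots> \<in> A + B"
    using ab t assms by (intro set_plus_intro cvxD) auto
  finally show "scl (1 - t) x + scl t y \<in> A + B" .
qed

lemma cvx_linear_image:
  assumes "cvx A" "\<And>x y. f (x + y) = f x + f y" "\<And>c x. f (scl c x) = scl c (f x)"
  shows "cvx (f ` A)"
  unfolding cvx_def using assms by (auto simp flip: assms(2,3) intro!: imageI cvxD)

lemma cvx_segment: "cvx (segment v)"
  unfolding cvx_def
proof (intro ballI)
  fix x y and t :: real
  assume "x \<in> segment v" "y \<in> segment v" and t: "t \<in> {0..1}"
  then obtain a b where ab: "a \<in> {-1/2..1/2}" "b \<in> {-1/2..1/2}" "x = scl a v" "y = scl b v"
    by (auto simp: segment_def)
  then have "scl (1 - t) x + scl t y = scl ((1 - t) * a + t * b) v"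
    by (simp add: scl_add_left)
  moreover have "(1 - t) * a + t * b \<in> {-1/2..1/2}"
    using convexD_alt[of "{-1/2..1/2::real}" a b t] ab t by auto
  ultimately show "scl (1 - t) x + scl t y \<in> segment v" by (auto simp: segment_def)
qed

lemma cpt_add: "cpt n A \<Longrightarrow> cpt n B \<Longrightarrow> cpt n (A + B)"
proof -
  assume A: "cpt n A" and B: "cpt n B"
  have "compact ((\<lambda>p. fst p + snd p) ` (A \<times> B))"
    using A B by (intro compact_continuous_image continuous_on_vec_add compact_Times)
      (auto simp: cpt_def intro!: continuous_on_fst continuous_on_snd continuous_on_id)
  moreover have "(\<lambda>p. fst p + snd p) ` (A \<times> B) = A + B"
    by (simp add: set_plus_image case_prod_beta)
  ultimately show ?thesis using A B by (auto simp: cpt_def elim!: set_plus_elim)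
qed

lemma cpt_segment: "v \<in> Rn n \<Longrightarrow> cpt n (segment v)"
  unfolding cpt_def segment_def
  by (auto intro!: compact_continuous_image continuous_on_scl)

lemma cpt_scl: "cpt n A \<Longrightarrow> cpt n (scl c ` A)"
  unfolding cpt_def
  by (auto intro!: compact_continuous_image continuous_on_scl)

lemma conv_cpt_add: "conv_cpt n A \<Longrightarrow> conv_cpt n B \<Longrightarrow> conv_cpt n (A + B)"
  by (simp add: conv_cpt_def cpt_add cvx_add)

lemma conv_cpt_segment: "v \<in> Rn n \<Longrightarrow> conv_cpt n (segment v)"
  by (simp add: conv_cpt_def cpt_segment cvx_segment)

lemma conv_cpt_scl: "conv_cpt n A \<Longrightarrow> conv_cpt n (scl c ` A)"
  by (simp add: conv_cpt_def cpt_scl cvx_linear_image scl_add mult.commute)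

lemma conv_cpt_singleton: "z \<in> Rn n \<Longrightarrow> conv_cpt n {z}"
  by (auto simp: conv_cpt_def cpt_def cvx_def simp flip: scl_add_left)

lemma zero_in_segment [simp]: "0 \<in> segment v"
  unfolding segment_def by (rule image_eqI[of _ _ 0]) auto

lemma cpt_borel [measurable_dest]: "cpt n A \<Longrightarrow> A \<in> sets borel"
  by (auto simp: cpt_def intro: borel_closed compact_imp_closed)

lemma conv_cpt_cpt: "conv_cpt n A \<Longrightarrow> cpt n A"
  by (simp add: conv_cpt_def)

lemma cpt_bounded:
  assumes "cpt n A"
  obtains r where "r > 0" "\<And>x. x \<in> A \<Longrightarrow> ip n x x \<le> r\<^sup>2"
proof (cases "A = {}")
  case True
  then show ?thesis using that[of 1] by auto
next
  case False
  have "compact A" using assms by (simp add: cpt_def)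
  from continuous_attains_sup[OF this False, of "\<lambda>x. ip n x x"]
  obtain z where z: "z \<in> A" "\<And>x. x \<in> A \<Longrightarrow> ip n x x \<le> ip n z z"
    using continuous_on_ip[OF continuous_on_id continuous_on_id, of A n] by auto
  have "ip n x x \<le> (nrm n z + 1)\<^sup>2" if "x \<in> A" for x
    using z(2)[OF that] by (simp add: power2_sum nrm_sq) (simp add: add_increasing2)
  then show ?thesis by (intro that[of "nrm n z + 1"]) (auto simp: add_nonneg_pos)
qed

lemma cpt_finite_measure: "cpt n A \<Longrightarrow> emeasure (leb n) A < \<infinity>"
proof -
  assume A: "cpt n A"
  obtain r where r: "r > 0" "\<And>x. x \<in> A \<Longrightarrow> ip n x x \<le> r\<^sup>2" using cpt_bounded[OF A] by blast
  have "emeasure (leb n) A \<le> emeasure (leb n) (cyl_ball n r)"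
    using r by (intro emeasure_mono) (auto simp: cyl_ball_def)
  also have "\<dots> < \<infinity>" by (simp add: emeasure_cyl_ball r)
  finally show ?thesis .
qed

lemma vol_nonneg [simp]: "vol n A \<ge> 0"
  by (simp add: vol_def)

lemma emeasure_vol: "cpt n A \<Longrightarrow> emeasure (leb n) A = ennreal (vol n A)"
  using cpt_finite_measure[of n A] cpt_borel[of n A]
  by (simp add: vol_eq emeasure_eq_ennreal_measure)

lemma vol_mono: "cpt n A \<Longrightarrow> cpt n B \<Longrightarrow> A \<subseteq> B \<Longrightarrow> vol n A \<le> vol n B"
  using emeasure_mono[of A B "leb n"] by (simp add: emeasure_vol cpt_borel)

lemma closed_Rn: "closed (Rn n)"
  by (metis closedin_Euclidean_space_iff closedin_topspace)

text \<open>\<open>leb n\<close> is concentrated on \<open>Rn n\<close>, so preimages and cylinders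
  may stand for their traces on \<open>Rn n\<close>.\<close>

lemma emeasure_leb_Rn:
  assumes [measurable]: "S \<in> sets borel"
  shows "emeasure (leb n) (S \<inter> Rn n) = emeasure (leb n) S"
proof -
  have [measurable]: "Rn n \<in> sets borel" by (intro borel_closed closed_Rn)
  have "emeasure (leb n) (S \<inter> Rn n) = (\<integral>\<^sup>+x. indicator (S \<inter> Rn n) x \<partial>leb n)" by simp
  also have "\<dots> = (\<integral>\<^sup>+x. indicator (S \<inter> Rn n) (emb n x) \<partial>leb n)"
    by (rule nn_integral_leb_emb[symmetric]) simp
  also have "\<dots> = (\<integral>\<^sup>+x. indicator S (emb n x) \<partial>leb n)"
    by (intro nn_integral_cong) (simp add: indicator_def)
  also have "\<dots> = (\<integral>\<^sup>+x. indicator S x \<partial>leb n)"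
    by (rule nn_integral_leb_emb) simp
  finally show ?thesis by simp
qed

lemma nn_integral_leb_cong:
  assumes "\<And>x. x \<in> Rn n \<Longrightarrow> f x = g x" "f \<in> borel_measurable borel" "g \<in> borel_measurable borel"
  shows "(\<integral>\<^sup>+x. f x \<partial>leb n) = (\<integral>\<^sup>+x. g x \<partial>leb n)"
proof -
  have "(\<integral>\<^sup>+x. f x \<partial>leb n) = (\<integral>\<^sup>+x. f (emb n x) \<partial>leb n)"
    using assms(2) by (rule nn_integral_leb_emb[symmetric])
  also have "\<dots> = (\<integral>\<^sup>+x. g (emb n x) \<partial>leb n)" by (simp only: assms(1)[OF emb_in_Rn])
  also have "\<dots> = (\<integral>\<^sup>+x. g x \<partial>leb n)" using assms(3) by (rule nn_integral_leb_emb)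
  finally show ?thesis .
qed

lemma emeasure_leb_Suc:
  assumes [measurable]: "A \<in> sets borel"
  shows "emeasure (leb (Suc m)) A = (\<integral>\<^sup>+x. emeasure lborel {t. x(m := t) \<in> A} \<partial>leb m)"
proof -
  have "{t. x(m := t) \<in> A} = (\<lambda>t. x(m := t)) -` A \<inter> space lborel" for x :: vec by auto
  moreover have "(\<lambda>t. x(m := t)) -` A \<inter> space lborel \<in> sets lborel" for x :: vec
    by (rule measurable_sets[of _ _ borel]) auto
  ultimately have [measurable]: "{t. x(m := t) \<in> A} \<in> sets lborel" for x :: vec by simp
  have "emeasure (leb (Suc m)) A = (\<integral>\<^sup>+x. indicator A x \<partial>leb (Suc m))" by simp
  also have "\<dots> = (\<integral>\<^sup>+x. (\<integral>\<^sup>+t. indicator A (x(m := t)) \<partial>lborel) \<partial>leb m)"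
    by (rule nn_integral_leb_Suc) simp
  also have "\<dots> = (\<integral>\<^sup>+x. (\<integral>\<^sup>+t. indicator {t. x(m := t) \<in> A} t \<partial>lborel) \<partial>leb m)"
    by (intro nn_integral_cong) (simp add: indicator_def)
  finally show ?thesis by simp
qed

lemma measurable_section_length:
  assumes [measurable]: "A \<in> sets borel"
  shows "(\<lambda>x :: vec. emeasure lborel {t. x(m := t) \<in> A}) \<in> borel_measurable borel"
proof -
  have *: "{t. x(m := t) \<in> A} = (\<lambda>t. x(m := t)) -` A \<inter> space lborel" for x :: vec by auto
  have "(\<lambda>x :: vec. \<integral>\<^sup>+t. indicator A (x(m := t)) \<partial>lborel) \<in> borel_measurable borel"
    by (rule lborel.borel_measurable_nn_integral) simp
  moreover have "(\<integral>\<^sup>+t. indicator A (x(m := t)) \<partial>lborel) = emeasure lborel {t. x(m := t) \<in> A}" for x :: vec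
  proof -
    have "{t. x(m := t) \<in> A} \<in> sets lborel"
      unfolding * by (rule measurable_sets[of _ _ borel]) auto
    moreover have "(\<integral>\<^sup>+t. indicator A (x(m := t)) \<partial>lborel) = (\<integral>\<^sup>+t. indicator {t. x(m := t) \<in> A} t \<partial>lborel)"
      by (intro nn_integral_cong) (simp add: indicator_def)
    ultimately show ?thesis by simp
  qed
  ultimately show ?thesis by simp
qed

section \<open>Adding a segment parallel to the last axis\<close>

definition basis_vec :: "nat \<Rightarrow> vec" where
  "basis_vec i = (\<lambda>k. if k = i then 1 else 0)"

lemma cpt_emb_image: "cpt k A \<Longrightarrow> cpt n (emb n ` A)"
  by (auto simp: cpt_def intro!: compact_continuous_image continuous_on_emb)

lemma Rn_Suc_decomp: "a \<in> Rn (Suc m) \<Longrightarrow> (emb m a)(m := a m) = a"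
  by (auto simp: fun_eq_iff emb_def Rn_iff less_Suc_eq not_less Suc_le_eq)

text \<open>A nonempty section of a compact convex set by a line parallel to the last axis is a
  compact interval, and the segment lengthens it by \<open>s / 2\<close> at either end. An empty
  section stays empty, which accounts for the indicator of the projection.\<close>

lemma section_add_segment:
  assumes A: "conv_cpt (Suc m) A" and x: "x \<in> Rn m" and s: "s \<ge> 0"
  shows "emeasure lborel {t. x(m := t) \<in> A + segment (scl s (basis_vec m))}
       = emeasure lborel {t. x(m := t) \<in> A} + ennreal s * indicator (emb m ` A) x"
proof -
  let ?S = "{t. x(m := t) \<in> A}"
  have iff: "x(m := t) \<in> A + segment (scl s (basis_vec m)) \<longleftrightarrow> (\<exists>\<tau>\<in>{-1/2..1/2}. t - \<tau> * s \<in> ?S)" for t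
  proof -
    have "x(m := t) \<in> A + segment (scl s (basis_vec m))
        \<longleftrightarrow> (\<exists>\<tau>\<in>{-1/2..1/2}. x(m := t) - scl (\<tau> * s) (basis_vec m) \<in> A)"
      unfolding set_plus_def segment_def by (force simp: algebra_simps)
    moreover have "(\<lambda>\<tau>. x(m := t) - scl (\<tau> * s) (basis_vec m)) = (\<lambda>\<tau>. x(m := t - \<tau> * s))"
      by (auto simp: fun_eq_iff basis_vec_def)
    then have "(\<exists>\<tau>\<in>{-1/2..1/2}. x(m := t) - scl (\<tau> * s) (basis_vec m) \<in> A)
        \<longleftrightarrow> (\<exists>\<tau>\<in>{-1/2..1/2}. x(m := t - \<tau> * s) \<in> A)"
      by (metis (mono_tags))
    ultimately show ?thesis by simp
  qed
  have ne: "?S \<noteq> {} \<longleftrightarrow> x \<in> emb m ` A"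
  proof
    assume "?S \<noteq> {}"
    then obtain t where "x(m := t) \<in> A" by auto
    moreover have "emb m (x(m := t)) = x" using x by (auto simp: fun_eq_iff emb_def Rn_iff)
    ultimately show "x \<in> emb m ` A" by force
  next
    assume "x \<in> emb m ` A"
    then obtain a where "a \<in> A" "x = emb m a" by auto
    then have "x(m := a m) \<in> A"
      using A by (simp add: Rn_Suc_decomp subsetD[of A] conv_cpt_def cpt_def)
    then show "?S \<noteq> {}" by auto
  qed
  show ?thesis
  proof (cases "?S = {}")
    case True
    then have "{t. x(m := t) \<in> A + segment (scl s (basis_vec m))} = {}" using iff by auto
    with True ne show ?thesis by (simp del: fun_upd_apply)
  next
    case False
    have "convex ?S"
    proof (rule convexI)
      fix p q and u v :: real
      assume "p \<in> ?S" "q \<in> ?S" "0 \<le> u" "0 \<le> v" "u + v = 1"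
      then have "scl (1 - v) (x(m := p)) + scl v (x(m := q)) \<in> A"
        using A by (intro cvxD) (auto simp: conv_cpt_def)
      moreover have "scl (1 - v) (x(m := p)) + scl v (x(m := q)) = x(m := u *\<^sub>R p + v *\<^sub>R q)"
      proof -
        have "u = 1 - v" using \<open>u + v = 1\<close> by simp
        show ?thesis unfolding \<open>u = 1 - v\<close> by (simp add: fun_eq_iff algebra_simps)
      qed
      ultimately show "u *\<^sub>R p + v *\<^sub>R q \<in> ?S" by simp
    qed
    moreover have "compact ?S"
    proof -
      have "?S = (\<lambda>a. a m) ` (A \<inter> {a. emb m a = x})"
      proof (rule set_eqI, rule iffI)
        fix t assume "t \<in> ?S"
        moreover have "emb m (x(m := t)) = x" using x by (auto simp: fun_eq_iff emb_def Rn_iff)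
        ultimately show "t \<in> (\<lambda>a. a m) ` (A \<inter> {a. emb m a = x})"
          by (intro image_eqI[of _ _ "x(m := t)"]) auto
      next
        fix t assume "t \<in> (\<lambda>a. a m) ` (A \<inter> {a. emb m a = x})"
        then show "t \<in> ?S" using A Rn_Suc_decomp by (auto simp: conv_cpt_def cpt_def)
      qed
      moreover have "compact (A \<inter> {a. emb m a = x})"
        using A by (intro compact_Int_closed closed_Collect_eq continuous_on_emb)
          (auto simp: conv_cpt_def cpt_def)
      ultimately show ?thesis
        by (auto intro!: compact_continuous_image continuous_on_coordinate)
    qed
    ultimately obtain a b where S: "?S = {a..b}"
      using convex_connected connected_compact_interval_1 by (metis box_real(2))
    with False have "a \<le> b" by auto
    have "{t. x(m := t) \<in> A + segment (scl s (basis_vec m))} = {a - s / 2..b + s / 2}"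
    proof (rule set_eqI, rule iffI)
      fix t assume "t \<in> {t. x(m := t) \<in> A + segment (scl s (basis_vec m))}"
      then obtain \<tau> where \<tau>: "\<tau> \<in> {-1/2..1/2}" "t - \<tau> * s \<in> {a..b}" using iff S by auto
      have "\<bar>\<tau>\<bar> \<le> 1/2" using \<tau>(1) by auto
      then have "\<bar>\<tau> * s\<bar> \<le> 1/2 * s"
        unfolding abs_mult using s by (intro mult_mono) auto
      then show "t \<in> {a - s / 2..b + s / 2}" using \<tau> by auto
    next
      fix t assume t: "t \<in> {a - s / 2..b + s / 2}"
      have "\<exists>\<tau>\<in>{-1/2..1/2}. t - \<tau> * s \<in> {a..b}"
      proof (cases "s = 0 \<or> t \<in> {a..b}")
        case True
        then show ?thesis using t by (intro bexI[of _ 0]) auto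
      next
        case False
        \<comment> \<open>The witness moves \<open>t\<close> onto the nearer endpoint of the
          interval.\<close>
        show ?thesis
        proof (cases "t < a")
          case True
          then show ?thesis using t False s \<open>a \<le> b\<close> by (intro bexI[of _ "(t - a) / s"]) (auto simp: field_simps)
        next
          case F: False
          then show ?thesis using t False s \<open>a \<le> b\<close> by (intro bexI[of _ "(t - b) / s"]) (auto simp: field_simps)
        qed
      qed
      then show "t \<in> {t. x(m := t) \<in> A + segment (scl s (basis_vec m))}" using iff S by auto
    qed
    then show ?thesis
      using S \<open>a \<le> b\<close> s ne False
      by (simp del: fun_upd_apply flip: ennreal_plus)
  qed
qed

lemma vol_add_segment_basis:
  assumes A: "conv_cpt (Suc m) A" and s: "s \<ge> 0"
  shows "vol (Suc m) (A + segment (scl s (basis_vec m))) = vol (Suc m) A + s * vol m (emb m ` A)"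
proof -
  let ?S = "A + segment (scl s (basis_vec m))"
  have b: "scl s (basis_vec m) \<in> Rn (Suc m)" by (simp add: Rn_iff basis_vec_def)
  have cA: "cpt (Suc m) A" using A by (rule conv_cpt_cpt)
  have cS: "cpt (Suc m) ?S" using b cA by (intro cpt_add cpt_segment)
  have cP: "cpt m (emb m ` A)" using cA by (rule cpt_emb_image)
  note [measurable] = cpt_borel[OF cA] cpt_borel[OF cS] cpt_borel[OF cP]
    measurable_section_length[OF cpt_borel[OF cA], of m] measurable_section_length[OF cpt_borel[OF cS], of m]
  have "ennreal (vol (Suc m) ?S) = emeasure (leb (Suc m)) ?S" using cS by (simp add: emeasure_vol)
  also have "\<dots> = (\<integral>\<^sup>+x. emeasure lborel {t. x(m := t) \<in> ?S} \<partial>leb m)"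
    by (rule emeasure_leb_Suc) simp
  also have "\<dots> = (\<integral>\<^sup>+x. emeasure lborel {t. x(m := t) \<in> A} + ennreal s * indicator (emb m ` A) x \<partial>leb m)"
    by (rule nn_integral_leb_cong) (use A s in \<open>auto simp: section_add_segment\<close>)
  also have "\<dots> = (\<integral>\<^sup>+x. emeasure lborel {t. x(m := t) \<in> A} \<partial>leb m) + ennreal s * emeasure (leb m) (emb m ` A)"
    by (simp add: nn_integral_add nn_integral_cmult)
  also have "(\<integral>\<^sup>+x. emeasure lborel {t. x(m := t) \<in> A} \<partial>leb m) = emeasure (leb (Suc m)) A"
    by (rule emeasure_leb_Suc[symmetric]) simp
  also have "emeasure (leb (Suc m)) A + ennreal s * emeasure (leb m) (emb m ` A)
      = ennreal (vol (Suc m) A + s * vol m (emb m ` A))"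
    using s cA cP by (simp add: emeasure_vol ennreal_mult)
  finally show ?thesis using s by (subst (asm) ennreal_inj) auto
qed

section \<open>Projections along a direction and balls\<close>

lemma linear_image_add:
  assumes "\<And>x y. f (x + y) = f x + f y"
  shows "f ` (A + B) = f ` A + (f ` B :: vec set)"
proof (rule set_eqI, rule iffI)
  fix z assume "z \<in> f ` (A + B)"
  then obtain a b where "a \<in> A" "b \<in> B" "z = f (a + b)" by (auto elim!: set_plus_elim)
  then show "z \<in> f ` A + f ` B" unfolding assms by blast
next
  fix z assume "z \<in> f ` A + f ` B"
  then obtain a b where ab: "a \<in> A" "b \<in> B" "z = f a + f b" by (auto elim!: set_plus_elim)
  then have "z = f (a + b)" by (simp only: assms)
  with ab show "z \<in> f ` (A + B)" by blast
qed

lemma abs_le_nrm: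
  assumes "i < n"
  shows "\<bar>x i\<bar> \<le> nrm n x"
proof -
  have "(x i)\<^sup>2 \<le> ip n x x"
    unfolding ip_def power2_eq_square
    by (rule member_le_sum[of i "{..<n}" "\<lambda>i. x i * x i"]) (use assms in auto)
  then show ?thesis unfolding nrm_def by (intro real_le_rsqrt) simp
qed

lemma ip_basis_vec: "i < n \<Longrightarrow> ip n (basis_vec i) x = x i"
  by (simp add: ip_def basis_vec_def if_distrib[of "\<lambda>a. a * _"] cong: if_cong)

lemma basis_vec_in_Rn: "i < n \<Longrightarrow> basis_vec i \<in> Rn n"
  by (auto simp: basis_vec_def Rn_iff)

text \<open>The Householder reflection in the hyperplane orthogonal to \<open>x - y\<close>.\<close>
lemma orthonormal_mapping:
  assumes x: "x \<in> Rn n" "ip n x x = 1" and y: "y \<in> Rn n" "ip n y y = 1"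
  obtains w where "orthonormal n n w" "lincomb n w x = y"
proof -
  define v where "v = x - y"
  define H where "H = (\<lambda>z. z - scl (2 * ip n z v / ip n v v) v)"
  have v: "v \<in> Rn n" using x y by (auto simp: v_def)
  have H: "H z \<in> Rn n" if "z \<in> Rn n" for z using that v by (auto simp: H_def)
  have ipH: "ip n (H a) (H b) = ip n a b" for a b
  proof -
    define p q where "p = 2 * ip n a v / ip n v v" and "q = 2 * ip n b v / ip n v v"
    \<comment> \<open>If \<open>ip n v v = 0\<close> then \<open>v = 0\<close>, and both sides
      vanish; this covers the case \<open>x = y\<close>.\<close>
    have "q * (p * ip n v v) = q * (2 * ip n a v)"
      using ip_self_eq_0[OF _ v] by (cases "ip n v v = 0") (auto simp: p_def)
    moreover have "p * ip n b v = q * ip n a v" by (simp add: p_def q_def)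
    ultimately show ?thesis
      unfolding H_def p_def[symmetric] q_def[symmetric]
      by (simp add: ip_diff_left ip_diff_right ip_commute[of n v b] right_diff_distrib)
  qed
  have Hx: "H x = y"
  proof (cases "ip n v v = 0")
    case True
    then have "v = 0" using v by (intro ip_self_eq_0)
    then show ?thesis by (simp add: H_def v_def)
  next
    case False
    have "ip n v v = 2 * ip n x v"
      using x y by (simp add: v_def ip_diff_left ip_diff_right ip_commute[of n y x])
    then have "2 * ip n x v / ip n v v = 1" using False by simp
    then show ?thesis by (simp add: H_def v_def)
  qed
  define w where "w = (\<lambda>j. H (basis_vec j))"
  have "orthonormal n n w"
    unfolding orthonormal_def w_def
    using H by (auto simp: ipH ip_basis_vec basis_vec_in_Rn) (auto simp: basis_vec_def)
  moreover have "lincomb n w z = H z" if z: "z \<in> Rn n" for z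
  proof
    fix i
    have "lincomb n w z i = (\<Sum>j<n. z j * basis_vec j i - (2 / ip n v v * v i) * (z j * v j))"
      unfolding lincomb_def w_def H_def
      by (intro sum.cong) (auto simp: ip_basis_vec algebra_simps)
    also have "\<dots> = (\<Sum>j<n. z j * basis_vec j i) - 2 / ip n v v * v i * ip n z v"
      by (simp add: sum_subtractf sum_distrib_left ip_def)
    also have "(\<Sum>j<n. z j * basis_vec j i) = z i"
      using z by (auto simp: basis_vec_def Rn_iff if_distrib[of "(*) _"] cong: if_cong)
    finally show "lincomb n w z i = H z i" by (simp add: H_def)
  qed
  ultimately show ?thesis using that Hx x(1) by metis
qed

definition on_sphere :: "nat \<Rightarrow> vec \<Rightarrow> bool" where
  "on_sphere n \<xi> \<longleftrightarrow> \<xi> \<in> Rn n \<and> ip n \<xi> \<xi> = 1"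

lemma lincomb_basis_vec: "i < m \<Longrightarrow> lincomb m u (basis_vec i) = u i"
  by (simp add: lincomb_def basis_vec_def if_distrib[of "\<lambda>a. a * _"] cong: if_cong)

lemma perp_basis:
  assumes "on_sphere (Suc m) \<xi>"
  shows "orthonormal (Suc m) m (perp_basis (Suc m) \<xi>)"
    and "j < m \<Longrightarrow> ip (Suc m) (perp_basis (Suc m) \<xi> j) \<xi> = 0"
proof -
  have "ip (Suc m) (basis_vec m) (basis_vec m) = 1"
    by (subst ip_basis_vec) (auto simp: basis_vec_def)
  then obtain w where w: "orthonormal (Suc m) (Suc m) w" "lincomb (Suc m) w (basis_vec m) = \<xi>"
    using assms orthonormal_mapping[of "basis_vec m" "Suc m" \<xi>]
    by (auto simp: on_sphere_def basis_vec_in_Rn)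
  have "w m = \<xi>" using w(2) by (simp add: lincomb_basis_vec)
  then have "orthonormal (Suc m) (Suc m - 1) w \<and> (\<forall>j<Suc m - 1. ip (Suc m) (w j) \<xi> = 0)"
    using w(1) by (auto simp: orthonormal_def)
  from someI[of "\<lambda>u. orthonormal (Suc m) (Suc m - 1) u \<and> (\<forall>j<Suc m - 1. ip (Suc m) (u j) \<xi> = 0)", OF this]
  show "orthonormal (Suc m) m (perp_basis (Suc m) \<xi>)"
    and "j < m \<Longrightarrow> ip (Suc m) (perp_basis (Suc m) \<xi> j) \<xi> = 0"
    by (auto simp: perp_basis_def)
qed

text \<open>Placing \<xi> at index \<open>m\<close> makes \<open>coords\<close> send \<xi> to the
  last basis vector; projecting along \<xi> becomes erasing the last coordinate.\<close>

definition frame :: "nat \<Rightarrow> vec \<Rightarrow> nat \<Rightarrow> vec" where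
  "frame m \<xi> = (perp_basis (Suc m) \<xi>)(m := \<xi>)"

lemma orthonormal_frame:
  assumes "on_sphere (Suc m) \<xi>"
  shows "orthonormal (Suc m) (Suc m) (frame m \<xi>)"
proof -
  have p: "perp_basis (Suc m) \<xi> j \<in> Rn (Suc m)" if "j < m" for j
    using perp_basis(1)[OF assms] that unfolding orthonormal_def by blast
  have q: "ip (Suc m) (perp_basis (Suc m) \<xi> j) (perp_basis (Suc m) \<xi> k) = (if j = k then 1 else 0)"
    if "j < m" "k < m" for j k
    using perp_basis(1)[OF assms] that unfolding orthonormal_def by blast
  have q': "ip (Suc m) \<xi> (perp_basis (Suc m) \<xi> k) = 0" if "k < m" for k
    using perp_basis(2)[OF assms that] by (simp only: ip_commute[of _ \<xi> "perp_basis (Suc m) \<xi> k"])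
  show ?thesis
    using assms p q perp_basis(2)[OF assms] q'
    unfolding orthonormal_def frame_def on_sphere_def less_Suc_eq by auto
qed

lemma coords_add: "coords n u (x + y) = coords n u x + coords n u y"
  by (auto simp: coords_def fun_eq_iff ip_add_left)

lemma coords_scl: "coords n u (scl c x) = scl c (coords n u x)"
  by (auto simp: coords_def fun_eq_iff)

lemma coords_lincomb: "orthonormal n n u \<Longrightarrow> coords n u (lincomb n u y) = emb n y"
  by (auto simp: coords_def emb_def fun_eq_iff ip_lincomb_basis)

lemma coords_image:
  assumes "orthonormal n n u" "A \<subseteq> Rn n"
  shows "coords n u ` A = lincomb n u -` A \<inter> Rn n"
proof (rule set_eqI, rule iffI)
  fix y assume "y \<in> coords n u ` A"
  then obtain a where "a \<in> A" "y = coords n u a" by auto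
  then show "y \<in> lincomb n u -` A \<inter> Rn n"
    using assms by (auto simp: lincomb_coords emb_id subsetD)
next
  fix y assume "y \<in> lincomb n u -` A \<inter> Rn n"
  then have "lincomb n u y \<in> A" "coords n u (lincomb n u y) = y"
    using assms by (auto simp: coords_lincomb emb_id)
  then show "y \<in> coords n u ` A" by (metis imageI)
qed

lemma cpt_coords: "cpt n A \<Longrightarrow> cpt n (coords n u ` A)"
  by (auto simp: cpt_def intro!: compact_continuous_image continuous_on_coords)

lemma conv_cpt_coords: "conv_cpt n A \<Longrightarrow> conv_cpt n (coords n u ` A)"
  by (simp add: conv_cpt_def cpt_coords cvx_linear_image coords_add coords_scl)

lemma vol_coords:
  assumes u: "orthonormal n n u" and A: "cpt n A"
  shows "vol n (coords n u ` A) = vol n A"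
proof -
  have sub: "A \<subseteq> Rn n" and b: "A \<in> sets borel" using A by (auto simp: cpt_def cpt_borel)
  have "emeasure (leb n) (coords n u ` A) = emeasure (leb n) (lincomb n u -` A)"
    unfolding coords_image[OF u sub]
    using measurable_sets[OF measurable_lincomb[of n u] b] by (intro emeasure_leb_Rn) simp
  also have "\<dots> = emeasure (leb n) A" by (rule emeasure_leb_rotation[OF u b])
  finally show ?thesis
    by (simp add: emeasure_vol[OF A] emeasure_vol[OF cpt_coords[OF A]])
qed

definition shadow :: "nat \<Rightarrow> vec \<Rightarrow> vec set \<Rightarrow> vec set" where
  "shadow m \<xi> A = (\<lambda>a. emb m (coords (Suc m) (frame m \<xi>) a)) ` A"

text \<open>Links the set measured by \<open>perp_surface_area\<close> with \<open>shadow\<close>: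
  expanding a point in the frame, its component along \<xi> is what \<open>proj_perp\<close>
  removes, and coordinates in an orthonormal basis are unique.\<close>

lemma shadow_eq:
  assumes \<xi>: "on_sphere (Suc m) \<xi>" and A: "A \<subseteq> Rn (Suc m)"
  shows "{x \<in> Rn m. lincomb m (perp_basis (Suc m) \<xi>) x \<in> proj_perp (Suc m) \<xi> ` A} = shadow m \<xi> A"
proof -
  let ?u = "perp_basis (Suc m) \<xi>" and ?c = "coords (Suc m) (frame m \<xi>)"
  have proj: "proj_perp (Suc m) \<xi> a = lincomb m ?u (emb m (?c a))" if "a \<in> A" for a
  proof -
    have "a = lincomb (Suc m) (frame m \<xi>) (?c a)"
      using that A by (simp add: lincomb_coords[OF orthonormal_frame[OF \<xi>]] emb_id subsetD)
    also have "\<dots> = (\<lambda>i. lincomb m ?u (emb m (?c a)) i + ip (Suc m) a \<xi> * \<xi> i)"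
      by (auto simp: lincomb_def frame_def emb_def coords_def)
    finally show ?thesis unfolding proj_perp_def fun_eq_iff by (metis add_diff_cancel_right')
  qed
  have inj: "x = y" if "x \<in> Rn m" "y \<in> Rn m" "lincomb m ?u x = lincomb m ?u y" for x y
  proof
    fix i
    show "x i = y i"
      using that ip_lincomb_basis[OF perp_basis(1)[OF \<xi>], of i] by (cases "i < m") (metis, simp add: Rn_iff)
  qed
  show ?thesis
  proof (rule set_eqI, rule iffI)
    fix x assume "x \<in> {x \<in> Rn m. lincomb m ?u x \<in> proj_perp (Suc m) \<xi> ` A}"
    then obtain a where a: "x \<in> Rn m" "a \<in> A" "lincomb m ?u x = lincomb m ?u (emb m (?c a))"
      by (auto simp: proj)
    have "x = emb m (?c a)" by (rule inj[OF a(1) emb_in_Rn a(3)])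
    with a show "x \<in> shadow m \<xi> A" by (auto simp: shadow_def)
  next
    fix x assume "x \<in> shadow m \<xi> A"
    then obtain a where "a \<in> A" "x = emb m (?c a)" by (auto simp: shadow_def)
    then show "x \<in> {x \<in> Rn m. lincomb m ?u x \<in> proj_perp (Suc m) \<xi> ` A}"
      using proj by (auto intro!: image_eqI[of _ _ a] simp del: topspace_Euclidean_space)
  qed
qed

definition shadow_vol :: "nat \<Rightarrow> vec \<Rightarrow> vec set \<Rightarrow> real" where
  "shadow_vol m \<xi> A = vol m (shadow m \<xi> A)"

lemma cpt_shadow: "cpt (Suc m) A \<Longrightarrow> cpt m (shadow m \<xi> A)"
  unfolding shadow_def using cpt_emb_image[OF cpt_coords] by (simp add: image_image)

lemma shadow_vol_nonneg [simp]: "shadow_vol m \<xi> A \<ge> 0"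
  by (simp add: shadow_vol_def)

lemma shadow_vol_mono: "cpt (Suc m) A \<Longrightarrow> cpt (Suc m) B \<Longrightarrow> A \<subseteq> B \<Longrightarrow> shadow_vol m \<xi> A \<le> shadow_vol m \<xi> B"
  unfolding shadow_vol_def by (intro vol_mono cpt_shadow) (auto simp: shadow_def)

lemma shadow_add: "shadow m \<xi> (A + B) = shadow m \<xi> A + shadow m \<xi> B"
  unfolding shadow_def by (rule linear_image_add) (auto simp: coords_add emb_def fun_eq_iff)

text \<open>Rotation invariance of the volume reduces an arbitrary direction to the last
  axis.\<close>

lemma vol_add_segment:
  assumes \<xi>: "on_sphere (Suc m) \<xi>" and A: "conv_cpt (Suc m) A" and s: "s \<ge> 0"
  shows "vol (Suc m) (A + segment (scl s \<xi>)) = vol (Suc m) A + s * shadow_vol m \<xi> A"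
proof -
  let ?c = "coords (Suc m) (frame m \<xi>)"
  note u = orthonormal_frame[OF \<xi>]
  have R: "\<xi> \<in> Rn (Suc m)" using \<xi> by (simp add: on_sphere_def)
  have cA: "cpt (Suc m) A" using A by (rule conv_cpt_cpt)
  have "?c (lincomb (Suc m) (frame m \<xi>) (basis_vec m)) = basis_vec m"
    by (simp only: coords_lincomb[OF u]) (simp add: emb_id basis_vec_in_Rn)
  then have c: "?c \<xi> = basis_vec m" by (simp add: lincomb_basis_vec frame_def)
  have "?c ` segment (scl s \<xi>) = segment (scl s (basis_vec m))"
    by (simp add: segment_def image_image coords_scl c)
  then have "?c ` (A + segment (scl s \<xi>)) = ?c ` A + segment (scl s (basis_vec m))"
    using linear_image_add[of ?c A "segment (scl s \<xi>)"] by (simp add: coords_add)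
  then have "vol (Suc m) (A + segment (scl s \<xi>)) = vol (Suc m) (?c ` A + segment (scl s (basis_vec m)))"
    using vol_coords[OF u, of "A + segment (scl s \<xi>)"] cA R by (simp add: cpt_add cpt_segment Rn_scl)
  also have "\<dots> = vol (Suc m) (?c ` A) + s * vol m (emb m ` ?c ` A)"
    by (rule vol_add_segment_basis[OF conv_cpt_coords[OF A] s])
  also have "\<dots> = vol (Suc m) A + s * shadow_vol m \<xi> A"
    by (simp add: vol_coords[OF u cA] shadow_vol_def shadow_def image_image)
  finally show ?thesis .
qed

section \<open>Euclidean balls, parallel bodies and their projections\<close>

definition ball_Rn :: "nat \<Rightarrow> real \<Rightarrow> vec set" where
  "ball_Rn n r = {x \<in> Rn n. nrm n x \<le> r}"

lemma scl_unit_ball: "r \<ge> 0 \<Longrightarrow> scl r ` unit_ball n = ball_Rn n r"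
proof (rule set_eqI, rule iffI)
  fix x assume r: "r \<ge> 0" and "x \<in> scl r ` unit_ball n"
  then obtain y where y: "x = scl r y" "y \<in> Rn n" "nrm n y \<le> 1"
    by (auto simp: unit_ball_def nrm_def simp del: topspace_Euclidean_space)
  then have "nrm n x \<le> r" using r mult_left_le[of "nrm n y" r] by (simp add: nrm_scl)
  then show "x \<in> ball_Rn n r" using y by (simp add: ball_Rn_def Rn_scl del: topspace_Euclidean_space)
next
  fix x assume r: "r \<ge> 0" and x: "x \<in> ball_Rn n r"
  show "x \<in> scl r ` unit_ball n"
  proof (cases "r = 0")
    case True
    then have "nrm n x = 0" "x \<in> Rn n" using x nrm_nonneg[of n x] by (auto simp: ball_Rn_def)
    then have "x = 0" by (rule nrm_eq_0)
    then show ?thesis using True by (intro image_eqI[of _ _ 0]) (auto simp: unit_ball_def)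
  next
    case False
    then have "nrm n (scl (1 / r) x) \<le> 1" using x r by (simp add: nrm_scl ball_Rn_def)
    then have "ip n (scl (1 / r) x) (scl (1 / r) x) \<le> 1" by (simp only: nrm_def real_sqrt_le_1_iff)
    then have "scl (1 / r) x \<in> unit_ball n" using x by (auto simp: unit_ball_def ball_Rn_def intro: Rn_scl)
    then show ?thesis using False by (intro image_eqI[of _ _ "scl (1 / r) x"]) auto
  qed
qed

lemma parallel_body_eq: "\<epsilon> \<ge> 0 \<Longrightarrow> parallel_body n A \<epsilon> = A + ball_Rn n \<epsilon>"
  unfolding parallel_body_def set_plus_image scl_unit_ball[symmetric]
  by (auto simp: image_iff fun_eq_iff) (metis plus_fun_apply scl_apply)+

lemma ball_Rn_add:
  assumes "r \<ge> 0" "s \<ge> 0"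
  shows "ball_Rn n r + ball_Rn n s = ball_Rn n (r + s)"
proof (rule set_eqI, rule iffI)
  fix x assume "x \<in> ball_Rn n r + ball_Rn n s"
  then obtain a b where "a \<in> ball_Rn n r" "b \<in> ball_Rn n s" "x = a + b" by (auto elim: set_plus_elim)
  then show "x \<in> ball_Rn n (r + s)" using nrm_triangle[of n a b] by (auto simp: ball_Rn_def intro: Rn_add)
next
  fix x assume x: "x \<in> ball_Rn n (r + s)"
  show "x \<in> ball_Rn n r + ball_Rn n s"
  proof (cases "r + s = 0")
    case True
    then have "r = 0" "s = 0" using assms by auto
    moreover have "0 \<in> ball_Rn n 0" by (simp add: ball_Rn_def nrm_def)
    ultimately show ?thesis using x set_plus_intro[of x "ball_Rn n r" 0 "ball_Rn n s"] by simp
  next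
    case False
    then have p: "r + s > 0" using assms by simp
    have "x = scl (r / (r + s)) x + scl (s / (r + s)) x"
      using False by (simp add: fun_eq_iff flip: add_divide_distrib distrib_right)
    moreover have "scl (t / (r + s)) x \<in> ball_Rn n t" if "t \<ge> 0" for t
    proof -
      have "t / (r + s) * nrm n x \<le> t / (r + s) * (r + s)"
        using x p that by (intro mult_left_mono) (auto simp: ball_Rn_def)
      then show ?thesis using x p that by (auto simp: ball_Rn_def nrm_scl intro: Rn_scl)
    qed
    ultimately show ?thesis using assms by (metis set_plus_intro)
  qed
qed

lemma ball_Rn_eq_cyl: "r \<ge> 0 \<Longrightarrow> ball_Rn n r = cyl_ball n r \<inter> Rn n"
  unfolding ball_Rn_def cyl_ball_def nrm_def by (blast intro: real_le_lsqrt sqrt_le_D)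

text \<open>By Tychonoff: the ball is a closed subset of a product of intervals
  \<open>{-r..r}\<close>.\<close>

lemma cpt_ball_Rn: "cpt n (ball_Rn n r)"
proof (cases "r \<ge> 0")
  case True
  have "compactin (product_topology (\<lambda>_. euclideanreal) UNIV) (Pi\<^sub>E UNIV (\<lambda>_::nat. {-r..r}))"
    by (simp add: compactin_PiE)
  then have "compact (Pi\<^sub>E UNIV (\<lambda>_::nat. {-r..r}))"
    by (simp add: euclidean_product_topology)
  moreover have "ball_Rn n r \<subseteq> Pi\<^sub>E UNIV (\<lambda>_::nat. {-r..r})"
  proof
    fix x assume x: "x \<in> ball_Rn n r"
    have "\<bar>x i\<bar> \<le> r" for i
    proof (cases "i < n")
      case True
      then show ?thesis using x abs_le_nrm[of i n x] by (simp add: ball_Rn_def)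
    qed (use x True in \<open>simp add: ball_Rn_def Rn_iff\<close>)
    then show "x \<in> Pi\<^sub>E UNIV (\<lambda>_::nat. {-r..r})" by (auto simp: abs_le_iff minus_le_iff)
  qed
  moreover have "closed (ball_Rn n r)"
    unfolding ball_Rn_eq_cyl[OF True] cyl_ball_def
    by (intro closed_Int closed_Rn closed_Collect_le continuous_on_ip continuous_on_id continuous_on_const)
  ultimately have "compact (ball_Rn n r)" by (metis compact_Int_closed inf.absorb2)
  then show ?thesis by (auto simp: cpt_def ball_Rn_def)
next
  case False
  then have "\<not> nrm n x \<le> r" for x using nrm_nonneg[of n x] by linarith
  then have "ball_Rn n r = {}" by (simp add: ball_Rn_def)
  then show ?thesis by (simp add: cpt_def)
qed

lemma conv_cpt_ball_Rn: "conv_cpt n (ball_Rn n r)"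
  unfolding conv_cpt_def cvx_def
proof (intro conjI ballI cpt_ball_Rn)
  fix x y and t :: real
  assume xy: "x \<in> ball_Rn n r" "y \<in> ball_Rn n r" and t: "t \<in> {0..1}"
  have "nrm n (scl (1 - t) x + scl t y) \<le> (1 - t) * nrm n x + t * nrm n y"
    using nrm_triangle[of n "scl (1 - t) x" "scl t y"] t by (simp add: nrm_scl)
  also have "\<dots> \<le> (1 - t) * r + t * r"
    using xy t by (intro add_mono mult_left_mono) (auto simp: ball_Rn_def)
  finally show "scl (1 - t) x + scl t y \<in> ball_Rn n r"
    using xy by (auto simp: ball_Rn_def algebra_simps intro!: Rn_add Rn_scl)
qed

lemma vol_ball_Rn_aux: "r > 0 \<Longrightarrow> vol n (ball_Rn n r) = unit_ball_vol n * r ^ n"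
  using emeasure_leb_Rn[of "cyl_ball n r" n] emeasure_vol[OF cpt_ball_Rn[of n r]]
  by (simp add: ball_Rn_eq_cyl[symmetric] emeasure_cyl_ball)

lemma unit_ball_ball_Rn: "unit_ball n = ball_Rn n 1"
  by (auto simp: unit_ball_def ball_Rn_def nrm_def)

lemma \<omega>_eq: "\<omega> n = unit_ball_vol n"
  by (simp add: \<omega>_def unit_ball_ball_Rn vol_ball_Rn_aux)

lemma \<omega>_pos: "\<omega> n > 0"
  by (simp add: \<omega>_eq)

lemma vol_ball_Rn: "r > 0 \<Longrightarrow> vol n (ball_Rn n r) = \<omega> n * r ^ n"
  by (simp add: vol_ball_Rn_aux \<omega>_eq)

lemma shadow_ball_Rn:
  assumes \<xi>: "on_sphere (Suc m) \<xi>"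
  shows "shadow m \<xi> (ball_Rn (Suc m) r) = ball_Rn m r"
proof -
  let ?c = "coords (Suc m) (frame m \<xi>)" and ?L = "lincomb (Suc m) (frame m \<xi>)"
  note u = orthonormal_frame[OF \<xi>]
  have ipc: "ip (Suc m) (?c a) (?c a) = ip (Suc m) a a" if "a \<in> Rn (Suc m)" for a
    using ip_lincomb[OF u, of "?c a" "?c a"] that by (simp add: lincomb_coords[OF u] emb_id)
  have le: "ip m (emb m a) (emb m a) \<le> ip (Suc m) a a" for a
    by (simp add: ip_def emb_def)
  show ?thesis
  proof (rule set_eqI, rule iffI)
    fix x assume "x \<in> shadow m \<xi> (ball_Rn (Suc m) r)"
    then obtain a where a: "a \<in> ball_Rn (Suc m) r" "x = emb m (?c a)" by (auto simp: shadow_def)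
    have "nrm m x \<le> nrm (Suc m) a"
      using le[of "?c a"] ipc[of a] a by (simp add: nrm_def ball_Rn_def)
    then show "x \<in> ball_Rn m r" using a by (auto simp: ball_Rn_def simp del: topspace_Euclidean_space)
  next
    fix x assume x: "x \<in> ball_Rn m r"
    then have xm: "x m = 0" "x \<in> Rn m" "x \<in> Rn (Suc m)" by (auto simp: ball_Rn_def Rn_iff)
    have "ip (Suc m) (?L x) (?L x) = ip m x x"
      using xm by (simp add: ip_lincomb[OF u]) (simp add: ip_def)
    then have "?L x \<in> ball_Rn (Suc m) r"
      using x lincomb_in_Rn[OF u] by (simp add: ball_Rn_def nrm_def)
    moreover have "emb m (?c (?L x)) = x"
      by (simp only: coords_lincomb[OF u]) (simp add: emb_id xm)
    ultimately show "x \<in> shadow m \<xi> (ball_Rn (Suc m) r)" by (force simp: shadow_def)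
  qed
qed

lemma shadow_vol_ball_Rn: "on_sphere (Suc m) \<xi> \<Longrightarrow> r > 0 \<Longrightarrow> shadow_vol m \<xi> (ball_Rn (Suc m) r) = \<omega> m * r ^ m"
  by (simp add: shadow_vol_def shadow_ball_Rn vol_ball_Rn)

section \<open>Convex bodies as compact convex sets of positive volume\<close>

lemma tendsto_vecI:
  fixes f :: "'a \<Rightarrow> vec"
  assumes "\<And>i. ((\<lambda>x. f x i) \<longlongrightarrow> l i) F"
  shows "(f \<longlongrightarrow> l) F"
proof -
  have "limitin (product_topology (\<lambda>_. euclidean) UNIV) f l F"
    unfolding limitin_componentwise using assms by simp
  then show ?thesis by (simp add: euclidean_product_topology)
qed

lemma convex_body_conv_cpt: "convex_body n K \<Longrightarrow> conv_cpt n K"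
  unfolding convex_body_def conv_cpt_def cpt_def cvx_def
  by (auto simp: Euclidean_space_def compactin_subtopology euclidean_product_topology plus_fun_def)

text \<open>The interior refers to the product topology, whereas the volume is known for Euclidean
  balls. If no ball around an interior point \<open>x\<close> fitted into \<open>K\<close>, points
  outside \<open>K\<close> would converge to \<open>x\<close> in every coordinate, which the open
  set \<open>V\<close> excludes.\<close>

lemma convex_body_vol_pos:
  assumes "convex_body n K"
  shows "vol n K > 0"
proof -
  have K: "cpt n K" using convex_body_conv_cpt[OF assms] by (rule conv_cpt_cpt)
  obtain x U where U: "openin (Euclidean_space n) U" "x \<in> U" "U \<subseteq> K"
    using assms by (auto simp: convex_body_def interior_of_def)
  then obtain V where V: "open V" "U = V \<inter> Rn n"
    by (auto simp: Euclidean_space_def openin_subtopology euclidean_product_topology)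
  have x: "x \<in> V" "x \<in> Rn n" using U V by auto
  have "\<exists>k. {x} + ball_Rn n (1 / real (Suc k)) \<subseteq> K"
  proof (rule ccontr)
    assume "\<nexists>k. {x} + ball_Rn n (1 / real (Suc k)) \<subseteq> K"
    then have "\<forall>k. \<exists>y. y \<in> ball_Rn n (1 / real (Suc k)) \<and> x + y \<notin> K"
      by (force simp: set_plus_def)
    then obtain y where y: "\<And>k. y k \<in> ball_Rn n (1 / real (Suc k))" "\<And>k. x + y k \<notin> K" by metis
    have "(\<lambda>k. (x + y k) i) \<longlonglongrightarrow> x i" for i
    proof -
      have "\<bar>y k i\<bar> \<le> 1 / real (Suc k)" for k
      proof (cases "i < n")
        case True
        then show ?thesis using y(1)[of k] abs_le_nrm[of i n "y k"] by (simp add: ball_Rn_def)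
      qed (use y(1)[of k] in \<open>simp add: ball_Rn_def Rn_iff\<close>)
      then have "(\<lambda>k. y k i) \<longlonglongrightarrow> 0"
        by (intro Lim_null_comparison[OF _ LIMSEQ_inverse_real_of_nat]) (simp add: inverse_eq_divide)
      from tendsto_add[OF tendsto_const[of "x i"] this] show ?thesis by simp
    qed
    then have "(\<lambda>k. x + y k) \<longlonglongrightarrow> x" by (rule tendsto_vecI)
    then have "eventually (\<lambda>k. x + y k \<in> V) sequentially"
      using V x by (intro topological_tendstoD)
    then obtain k where "x + y k \<in> V" by (auto simp: eventually_sequentially)
    moreover have "x + y k \<in> Rn n" using x y(1)[of k] by (auto simp: ball_Rn_def)
    ultimately show False using y(2) U V by auto
  qed
  then obtain k where k: "{x} + ball_Rn n (1 / real (Suc k)) \<subseteq> K" by blast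
  let ?r = "1 / real (Suc k)"
  have b: "{x} + ball_Rn n ?r \<in> sets borel" and c: "cpt n ({x} + ball_Rn n ?r)"
    using x by (auto intro!: cpt_borel[of n] cpt_add cpt_ball_Rn conv_cpt_cpt[OF conv_cpt_singleton])
  have "vol n ({x} + ball_Rn n ?r) = vol n (ball_Rn n ?r)"
  proof -
    have "{z. x + scl 1 z \<in> {x} + ball_Rn n ?r} = ball_Rn n ?r"
      by (auto simp: set_plus_def)
    then have "emeasure (leb n) ({x} + ball_Rn n ?r) = emeasure (leb n) (ball_Rn n ?r)"
      using emeasure_leb_affine[OF b, of 1 x n] x by simp
    then show ?thesis unfolding emeasure_vol[OF c] emeasure_vol[OF cpt_ball_Rn] by simp
  qed
  also have "vol n (ball_Rn n ?r) > 0" by (subst vol_ball_Rn) (auto simp: \<omega>_pos)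
  finally show ?thesis using vol_mono[OF c K k] by simp
qed

section \<open>The Brunn--Minkowski inequality\<close>

text \<open>
  Translates of \<open>A\<close> by an almost minimal point of \<open>B\<close> and of \<open>B\<close> by an almost maximal point of
  \<open>A\<close> both lie in \<open>A + B\<close> and overlap in an interval of length at most \<open>\<epsilon>\<close>.
\<close>
lemma Brunn_Minkowski_1D:
  fixes A B C :: "real set"
  assumes [measurable]: "A \<in> sets borel" "B \<in> sets borel" "C \<in> sets borel"
    and ne: "A \<noteq> {}" "B \<noteq> {}" and bd: "bdd_above A" "bdd_below B"
    and sum: "\<And>x y. x \<in> A \<Longrightarrow> y \<in> B \<Longrightarrow> x + y \<in> C"
  shows "emeasure lborel A + emeasure lborel B \<le> emeasure lborel C"
proof (rule ennreal_le_epsilon)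
  fix e :: real assume e: "0 < e"
  obtain a where a: "a \<in> A" "Sup A - e / 2 < a"
    using less_cSup_iff[OF ne(1) bd(1), of "Sup A - e / 2"] e by auto
  obtain b where b: "b \<in> B" "b < Inf B + e / 2"
    using cInf_less_iff[OF ne(2) bd(2), of "Inf B + e / 2"] e by auto
  define S1 where "S1 = {z. z - b \<in> A}"
  define S2 where "S2 = {z. z - a \<in> B}"
  have S1: "S1 = (\<lambda>z. - b + z) -` A \<inter> space lborel" and S2: "S2 = (\<lambda>z. - a + z) -` B \<inter> space lborel"
    by (auto simp: S1_def S2_def)
  have mS [measurable]: "S1 \<in> sets lborel" "S2 \<in> sets lborel"
    using measurable_sets[of "(+) (- b)" lborel borel A] measurable_sets[of "(+) (- a)" lborel borel B]
    unfolding S1 S2 by (auto simp del: diff_conv_add_uminus)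
  have tr: "emeasure lborel ((\<lambda>z. c + z) -` D \<inter> space lborel) = emeasure lborel D"
    if "D \<in> sets borel" for c :: real and D
    using that by (subst lborel_distr_plus[of c, symmetric]) (simp add: emeasure_distr)
  have "emeasure lborel A + emeasure lborel B = emeasure lborel S1 + emeasure lborel S2"
    unfolding S1 S2 by (simp only: tr[OF assms(1)] tr[OF assms(2)])
  also have "\<dots> = emeasure lborel (S1 \<union> S2) + emeasure lborel (S1 \<inter> S2)"
    by (rule emeasure_Un_Int[OF mS])
  also have "\<dots> \<le> emeasure lborel C + ennreal e"
  proof (intro add_mono)
    have "S1 \<union> S2 \<subseteq> C"
    proof
      fix z assume "z \<in> S1 \<union> S2"
      then show "z \<in> C" using sum[of "z - b" b] sum[of a "z - a"] a b by (auto simp: S1_def S2_def)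
    qed
    then show "emeasure lborel (S1 \<union> S2) \<le> emeasure lborel C" by (intro emeasure_mono) auto
    have "S1 \<inter> S2 \<subseteq> {a + Inf B..Sup A + b}"
      using cSup_upper[OF _ bd(1)] cInf_lower[OF _ bd(2)]
      by (force simp: S1_def S2_def algebra_simps)
    then have "emeasure lborel (S1 \<inter> S2) \<le> emeasure lborel {a + Inf B..Sup A + b}"
      by (intro emeasure_mono) auto
    also have "\<dots> \<le> ennreal e"
      using a b by (auto simp: emeasure_lborel_Icc_eq intro!: ennreal_leI)
    finally show "emeasure lborel (S1 \<inter> S2) \<le> ennreal e" .
  qed
  finally show "emeasure lborel A + emeasure lborel B \<le> emeasure lborel C + ennreal e" .
qed

section \<open>The Prekopa--Leindler inequality\<close>

lemma nn_integral_layer_cake: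
  fixes f :: "real \<Rightarrow> real"
  assumes [measurable]: "f \<in> borel_measurable borel"
  shows "(\<integral>\<^sup>+x. ennreal (f x) \<partial>lborel) = (\<integral>\<^sup>+r. indicator {0<..} r * emeasure lborel {x. r < f x} \<partial>lborel)"
proof -
  have "(\<integral>\<^sup>+x. ennreal (f x) \<partial>lborel) = (\<integral>\<^sup>+x. (\<integral>\<^sup>+r. indicator {0<..} r * indicator {x. r < f x} x \<partial>lborel) \<partial>lborel)"
  proof (rule nn_integral_cong)
    fix x
    have "(\<integral>\<^sup>+r. indicator {0<..} r * indicator {x. r < f x} x \<partial>lborel) = (\<integral>\<^sup>+r. indicator {0<..<f x} r \<partial>lborel)"
      by (intro nn_integral_cong) (auto simp: indicator_def)
    then show "ennreal (f x) = (\<integral>\<^sup>+r. indicator {0<..} r * indicator {x. r < f x} x \<partial>lborel)"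
      by (cases "0 \<le> f x") (auto simp: ennreal_neg)
  qed
  also have "\<dots> = (\<integral>\<^sup>+r. (\<integral>\<^sup>+x. indicator {0<..} r * indicator {x. r < f x} x \<partial>lborel) \<partial>lborel)"
    by (rule lborel_pair.Fubini'[symmetric]) (simp add: indicator_def)
  also have "\<dots> = (\<integral>\<^sup>+r. indicator {0<..} r * emeasure lborel {x. r < f x} \<partial>lborel)"
    by (intro nn_integral_cong, subst nn_integral_cmult) (auto simp: indicator_def[abs_def] nn_integral_indicator[symmetric] simp del: nn_integral_indicator)
  finally show ?thesis .
qed

text \<open>At each height below 1 both superlevel sets are nonempty, which is what the
  one-dimensional Brunn--Minkowski inequality asks for; from height 1 on both are empty. Integrating
  over the heights gives the claim.\<close>

lemma Prekopa_Leindler_1D_sup_1: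
  fixes f g h :: "real \<Rightarrow> real"
  assumes [measurable]: "f \<in> borel_measurable borel" "g \<in> borel_measurable borel" "h \<in> borel_measurable borel"
    and le: "\<And>x. f x \<le> 1" "\<And>x. g x \<le> 1"
    and supp: "\<And>x. f x > 0 \<Longrightarrow> \<bar>x\<bar> \<le> R" "\<And>x. g x > 0 \<Longrightarrow> \<bar>x\<bar> \<le> R"
    and ex: "\<And>r. r < 1 \<Longrightarrow> \<exists>x. r < f x" "\<And>r. r < 1 \<Longrightarrow> \<exists>x. r < g x"
    and fgh: "\<And>r x y. 0 < r \<Longrightarrow> r < 1 \<Longrightarrow> r < f x \<Longrightarrow> r < g y \<Longrightarrow> r < h (x + y)"
  shows "(\<integral>\<^sup>+x. ennreal (f x) \<partial>lborel) + (\<integral>\<^sup>+x. ennreal (g x) \<partial>lborel) \<le> (\<integral>\<^sup>+x. ennreal (h x) \<partial>lborel)"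
proof -
  have lev: "emeasure lborel {x. r < f x} + emeasure lborel {x. r < g x} \<le> emeasure lborel {x. r < h x}"
    if "0 < r" for r
  proof (cases "r < 1")
    case True
    have bdd: "bdd_above {x. r < f x}" "bdd_below {x. r < g x}"
      using order.strict_trans[OF that] supp
      by (auto intro!: bdd_aboveI[of _ R] bdd_belowI[of _ "- R"] dest!: abs_le_D1 abs_le_D2 simp: abs_le_iff minus_le_iff)
    show ?thesis
      by (rule Brunn_Minkowski_1D) (use bdd ex[OF True] fgh[OF that True] in auto)
  next
    case False
    then have "\<not> r < f x" "\<not> r < g x" for x using le[of x] by linarith+
    then have e: "{x. r < f x} = {}" "{x. r < g x} = {}" by simp_all
    show ?thesis unfolding e by simp
  qed
  have [measurable]: "(\<lambda>r. emeasure lborel {x. r < f x}) \<in> borel_measurable borel"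
    "(\<lambda>r. emeasure lborel {x. r < g x}) \<in> borel_measurable borel"
    using lborel.measurable_emeasure_Pair[of "{p. fst p < f (snd p)}" borel]
      lborel.measurable_emeasure_Pair[of "{p. fst p < g (snd p)}" borel]
    by (auto simp: vimage_def)
  have "(\<integral>\<^sup>+x. ennreal (f x) \<partial>lborel) + (\<integral>\<^sup>+x. ennreal (g x) \<partial>lborel)
      = (\<integral>\<^sup>+r. indicator {0<..} r * (emeasure lborel {x. r < f x} + emeasure lborel {x. r < g x}) \<partial>lborel)"
    by (simp add: nn_integral_layer_cake distrib_left nn_integral_add)
  also have "\<dots> \<le> (\<integral>\<^sup>+r. indicator {0<..} r * emeasure lborel {x. r < h x} \<partial>lborel)"
    by (intro nn_integral_mono) (use lev in \<open>auto simp: indicator_def\<close>)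
  also have "\<dots> = (\<integral>\<^sup>+x. ennreal (h x) \<partial>lborel)"
    by (rule nn_integral_layer_cake[symmetric]) simp
  finally show ?thesis .
qed

lemma powr_weighted_mult_le:
  fixes u v a b :: real
  assumes "a > 0" "b > 0" "a + b = 1" "u \<ge> 0" "v \<ge> 0"
  shows "(u / a) powr a * (v / b) powr b \<le> u + v"
proof (cases "u = 0 \<or> v = 0")
  case True
  then show ?thesis using assms by auto
next
  case False
  then have "(u / a) powr a * (v / b) powr b \<le> a * (u / a) + b * (v / b)"
    using assms by (intro Youngs_inequality_0) auto
  then show ?thesis using assms by simp
qed

text \<open>Dividing \<open>f\<close> and \<open>g\<close> by their suprema and \<open>h\<close> by
  \<open>N\<close> gives the additive inequality for functions of supremum 1, and the weighted
  inequality of the means turns the sum into a product. The divisors \<open>a\<close> and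
  \<open>b\<close> in the conclusion come from writing \<open>x + y\<close> where the usual form has
  \<open>a * x + b * y\<close>.\<close>

lemma Prekopa_Leindler_1D:
  fixes f g h :: "real \<Rightarrow> real"
  assumes [measurable]: "f \<in> borel_measurable borel" "g \<in> borel_measurable borel"
    and h: "integrable lborel h" "\<And>x. h x \<ge> 0"
    and nn: "\<And>x. f x \<ge> 0" "\<And>x. g x \<ge> 0"
    and le: "\<And>x. f x \<le> M" "\<And>x. g x \<le> M"
    and supp: "\<And>x. f x \<noteq> 0 \<Longrightarrow> \<bar>x\<bar> \<le> R" "\<And>x. g x \<noteq> 0 \<Longrightarrow> \<bar>x\<bar> \<le> R"
    and ab: "a > 0" "b > 0" "a + b = 1"
    and fgh: "\<And>x y. f x powr a * g y powr b \<le> h (x + y)"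
  shows "((\<integral>x. f x \<partial>lborel) / a) powr a * ((\<integral>x. g x \<partial>lborel) / b) powr b \<le> (\<integral>x. h x \<partial>lborel)"
proof (cases "(\<forall>x. f x = 0) \<or> (\<forall>x. g x = 0)")
  case True
  then have "(\<integral>x. f x \<partial>lborel) = 0 \<or> (\<integral>x. g x \<partial>lborel) = 0" by auto
  then show ?thesis using h by (auto intro!: Bochner_Integration.integral_nonneg)
next
  case False
  define p where "p = Sup (range f)"
  define q where "q = Sup (range g)"
  have bdd: "bdd_above (range f)" "bdd_above (range g)" using le by (auto intro!: bdd_aboveI2)
  have fp: "f x \<le> p" and gq: "g x \<le> q" for x
    unfolding p_def q_def using bdd by (auto intro!: cSup_upper)
  obtain x0 y0 where "f x0 \<noteq> 0" "g y0 \<noteq> 0" using False by blast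
  then have p: "p > 0" and q: "q > 0"
    using nn(1)[of x0] nn(2)[of y0] fp[of x0] gq[of y0] by linarith+
  define N where "N = p powr a * q powr b"
  have N: "N > 0" using p q by (simp add: N_def)
  have int: "integrable lborel f" "integrable lborel g"
  proof -
    have fin: "emeasure lborel {-R..R} < \<infinity>" by (simp add: emeasure_lborel_Icc_eq)
    show "integrable lborel f"
      by (rule integrableI_bounded_set[of "{-R..R}" _ _ M])
        (use fin supp(1) nn(1) le(1) in \<open>auto simp: abs_le_iff minus_le_iff\<close>)
    show "integrable lborel g"
      by (rule integrableI_bounded_set[of "{-R..R}" _ _ M])
        (use fin supp(2) nn(2) le(2) in \<open>auto simp: abs_le_iff minus_le_iff\<close>)
  qed
  have [measurable]: "h \<in> borel_measurable borel" using h(1) by (simp add: borel_measurable_integrable)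
  have "(\<integral>\<^sup>+x. ennreal (f x / p) \<partial>lborel) + (\<integral>\<^sup>+x. ennreal (g x / q) \<partial>lborel) \<le> (\<integral>\<^sup>+x. ennreal (h x / N) \<partial>lborel)"
  proof (rule Prekopa_Leindler_1D_sup_1[where R = R])
    show "\<exists>x. r < f x / p" if "r < 1" for r
    proof -
      have "r * p < p" using that p by simp
      then obtain x where "r * p < f x" using less_cSup_iff[of "range f" "r * p"] bdd(1) by (auto simp: p_def)
      then show ?thesis using p by (auto simp: field_simps)
    qed
    show "\<exists>x. r < g x / q" if "r < 1" for r
    proof -
      have "r * q < q" using that q by simp
      then obtain x where "r * q < g x" using less_cSup_iff[of "range g" "r * q"] bdd(2) by (auto simp: q_def)
      then show ?thesis using q by (auto simp: field_simps)
    qed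
    fix r x y assume r: "0 < r" "r < (1::real)" and fx: "r < f x / p" and gy: "r < g y / q"
    have "N * r = (r * p) powr a * (r * q) powr b"
      using r p q ab by (simp add: N_def powr_mult mult.assoc mult.left_commute flip: powr_add)
    also have "\<dots> < f x powr a * g y powr b"
    proof -
      have "r * p < f x" "r * q < g y" using fx gy p q by (simp_all add: field_simps)
      moreover have "0 < r * p" "0 < r * q" using r p q by simp_all
      ultimately show ?thesis
        using ab nn[of x] nn(2)[of y] by (intro mult_strict_mono powr_less_mono2) auto
    qed
    also have "\<dots> \<le> h (x + y)" by (rule fgh)
    finally show "r < h (x + y) / N" using N by (simp add: field_simps)
  qed (use fp gq p q supp in \<open>auto simp: field_simps zero_less_divide_iff\<close>)
  then have *: "(\<integral>x. f x \<partial>lborel) / p + (\<integral>x. g x \<partial>lborel) / q \<le> (\<integral>x. h x \<partial>lborel) / N"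
    using int h nn p q N
    by (subst (asm) (1 2 3) nn_integral_eq_integral) (auto simp flip: ennreal_plus simp: integral_nonneg)
  let ?F = "\<integral>x. f x \<partial>lborel" and ?G = "\<integral>x. g x \<partial>lborel"
  have F: "?F \<ge> 0" "?G \<ge> 0" using nn by (auto intro!: Bochner_Integration.integral_nonneg)
  have "(?F / a) powr a * (?G / b) powr b = N * ((?F / p / a) powr a * (?G / q / b) powr b)"
    using p q ab F by (simp add: N_def powr_divide powr_mult field_simps)
  also have "\<dots> \<le> N * (?F / p + ?G / q)"
    using N p q ab F by (intro mult_left_mono powr_weighted_mult_le) auto
  also have "\<dots> \<le> (\<integral>x. h x \<partial>lborel)" using * N by (simp add: field_simps)
  finally show ?thesis .
qed

text \<open>A class that is closed under slicing and guarantees integrability, so that the induction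
  on the dimension can stay inside it.\<close>

definition bdd_supp :: "nat \<Rightarrow> (vec \<Rightarrow> real) \<Rightarrow> bool" where
  "bdd_supp n f \<longleftrightarrow> f \<in> borel_measurable borel \<and> (\<forall>x. 0 \<le> f x) \<and> (\<exists>M. \<forall>x. f x \<le> M) \<and>
     (\<exists>R>0. \<forall>x. f x \<noteq> 0 \<longrightarrow> ip n x x \<le> R\<^sup>2)"

lemma bdd_supp_integrable:
  assumes "bdd_supp n f"
  shows "integrable (leb n) f"
proof -
  obtain M R where *: "f \<in> borel_measurable borel" "\<And>x. 0 \<le> f x" "\<And>x. f x \<le> M" "R > 0"
    "\<And>x. f x \<noteq> 0 \<Longrightarrow> ip n x x \<le> R\<^sup>2"
    using assms unfolding bdd_supp_def by blast
  have "emeasure (leb n) (cyl_ball n R) < \<infinity>" using \<open>R > 0\<close> by (simp add: emeasure_cyl_ball)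
  moreover have "f x = 0" if "x \<notin> cyl_ball n R" for x using that *(5) by (auto simp: cyl_ball_def)
  ultimately show ?thesis
    using * by (intro integrableI_bounded_set[of "cyl_ball n R" _ _ M]) auto
qed

lemma ip_Suc_upd: "ip (Suc n) (x(n := t)) (x(n := t)) = ip n x x + t\<^sup>2"
  by (simp add: ip_def power2_eq_square)

lemma bdd_supp_slice:
  assumes "bdd_supp (Suc n) f"
  shows "bdd_supp n (\<lambda>x. f (x(n := t)))"
proof -
  obtain M R where *: "f \<in> borel_measurable borel" "\<And>x. 0 \<le> f x" "\<And>x. f x \<le> M" "R > 0"
    "\<And>x. f x \<noteq> 0 \<Longrightarrow> ip (Suc n) x x \<le> R\<^sup>2"
    using assms unfolding bdd_supp_def by blast
  note [measurable] = *(1)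
  have "ip n x x \<le> R\<^sup>2" if "f (x(n := t)) \<noteq> 0" for x
    using *(5)[OF that] unfolding ip_Suc_upd by (meson add_increasing2 order_refl order_trans zero_le_power2 add_le_cancel_left le_add_same_cancel1)
  then show ?thesis unfolding bdd_supp_def using * by (intro conjI exI[of _ M] exI[of _ R]) auto
qed

lemma bdd_supp_marginal:
  assumes f: "bdd_supp (Suc n) f"
  defines "F \<equiv> \<lambda>t. \<integral>x. f (x(n := t)) \<partial>leb n"
  shows "F \<in> borel_measurable borel" and "\<exists>M. \<forall>t. F t \<le> M" and "\<exists>R. \<forall>t. F t \<noteq> 0 \<longrightarrow> \<bar>t\<bar> \<le> R"
    and "\<And>t. F t \<ge> 0" and "integrable lborel F"
    and "(\<integral>t. F t \<partial>lborel) = (\<integral>x. f x \<partial>leb (Suc n))"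
proof -
  interpret sigma_finite_measure "leb n" by (rule sigma_finite_leb)
  interpret P: pair_sigma_finite "leb n" lborel by standard
  obtain M R where *: "f \<in> borel_measurable borel" "\<And>x. 0 \<le> f x" "\<And>x. f x \<le> M" "R > 0"
    "\<And>x. f x \<noteq> 0 \<Longrightarrow> ip (Suc n) x x \<le> R\<^sup>2"
    using f unfolding bdd_supp_def by blast
  note [measurable] = *(1)
  show m: "F \<in> borel_measurable borel"
    unfolding F_def by (rule borel_measurable_lebesgue_integral) simp
  show nn: "F t \<ge> 0" for t
    unfolding F_def using *(2) by (intro Bochner_Integration.integral_nonneg) auto
  have M: "M \<ge> 0" using *(2,3) order_trans by blast
  have int: "integrable (leb n) (\<lambda>x. f (x(n := t)))" for t
    by (rule bdd_supp_integrable[OF bdd_supp_slice[OF f]])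
  have zero: "f (x(n := t)) = 0" if "ip n x x + t\<^sup>2 > R\<^sup>2" for x t
    using *(5)[of "x(n := t)"] that unfolding ip_Suc_upd by auto
  have "F t \<le> M * measure (leb n) (cyl_ball n R)" for t
  proof -
    have "F t \<le> (\<integral>x. M * indicator (cyl_ball n R) x \<partial>leb n)"
      unfolding F_def
    proof (rule integral_mono[OF int])
      show "integrable (leb n) (\<lambda>x. M * indicator (cyl_ball n R) x)"
        using emeasure_cyl_ball[OF \<open>R > 0\<close>, of n] by auto
      fix x
      show "f (x(n := t)) \<le> M * indicator (cyl_ball n R) x"
      proof (cases "x \<in> cyl_ball n R")
        case False
        then have "R\<^sup>2 < ip n x x + t\<^sup>2" using zero_le_power2[of t] unfolding cyl_ball_def by (simp, linarith)
        then show ?thesis using zero[of x t] M by simp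
      qed (use *(3) in simp)
    qed
    then show ?thesis by simp
  qed
  then show "\<exists>M. \<forall>t. F t \<le> M" by blast
  have supp: "\<bar>t\<bar> \<le> R" if "F t \<noteq> 0" for t
  proof (rule ccontr)
    assume "\<not> \<bar>t\<bar> \<le> R"
    then have "R\<^sup>2 < t\<^sup>2" using \<open>R > 0\<close> by (metis abs_of_pos not_le abs_le_square_iff)
    then have "f (x(n := t)) = 0" for x by (intro zero) (simp add: add_strict_increasing2)
    then show False using that by (simp add: F_def)
  qed
  then show "\<exists>R. \<forall>t. F t \<noteq> 0 \<longrightarrow> \<bar>t\<bar> \<le> R" by blast
  have nnF: "(\<integral>\<^sup>+x. ennreal (f (x(n := t))) \<partial>leb n) = ennreal (F t)" for t
    unfolding F_def using int *(2) by (intro nn_integral_eq_integral) auto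
  have "(\<integral>\<^sup>+x. ennreal (f x) \<partial>leb (Suc n)) = (\<integral>\<^sup>+x. (\<integral>\<^sup>+t. ennreal (f (x(n := t))) \<partial>lborel) \<partial>leb n)"
    by (rule nn_integral_leb_Suc) simp
  also have "\<dots> = (\<integral>\<^sup>+t. (\<integral>\<^sup>+x. ennreal (f (x(n := t))) \<partial>leb n) \<partial>lborel)"
    by (rule P.Fubini'[symmetric]) measurable
  also have "\<dots> = (\<integral>\<^sup>+t. ennreal (F t) \<partial>lborel)"
    by (simp only: nnF)
  finally have eq: "(\<integral>\<^sup>+x. ennreal (f x) \<partial>leb (Suc n)) = (\<integral>\<^sup>+t. ennreal (F t) \<partial>lborel)" .
  have "(\<integral>\<^sup>+x. ennreal (f x) \<partial>leb (Suc n)) = ennreal (\<integral>x. f x \<partial>leb (Suc n))"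
    using bdd_supp_integrable[OF f] *(2) by (intro nn_integral_eq_integral) auto
  with eq have eq': "(\<integral>\<^sup>+t. ennreal (F t) \<partial>lborel) = ennreal (\<integral>x. f x \<partial>leb (Suc n))" by simp
  show "integrable lborel F"
    by (rule integrableI_nonneg) (use m nn eq' in auto)
  then show "(\<integral>t. F t \<partial>lborel) = (\<integral>x. f x \<partial>leb (Suc n))"
    using eq' nn *(2) nn_integral_eq_integral[of lborel F]
    by (simp add: Bochner_Integration.integral_nonneg)
qed

text \<open>Slices with fixed last coordinates satisfy the hypothesis in dimension \<open>n\<close>;
  the resulting bound for the marginals is the hypothesis of the one-dimensional inequality, which
  adds one more factor \<open>a\<close> and \<open>b\<close> to the divisors.\<close>

theorem Prekopa_Leindler:
  assumes "bdd_supp n f" "bdd_supp n g" "bdd_supp n h" and ab: "a > 0" "b > 0" "a + b = 1"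
    and "\<And>x y. f x powr a * g y powr b \<le> h (x + y)"
  shows "((\<integral>x. f x \<partial>leb n) / a ^ n) powr a * ((\<integral>x. g x \<partial>leb n) / b ^ n) powr b \<le> (\<integral>x. h x \<partial>leb n)"
  using assms
proof (induction n arbitrary: f g h)
  case 0
  have "(\<integral>x. \<phi> x \<partial>leb 0) = \<phi> 0" if "bdd_supp 0 \<phi>" for \<phi>
    using that by (subst integral_eq_nn_integral) (auto simp: bdd_supp_def nn_integral_leb_0)
  moreover have "f 0 powr a * g 0 powr b \<le> h 0" using 0(7)[of 0 0] by (simp only: add_0_left)
  ultimately show ?case using 0(1-3) by simp
next
  case (Suc n)
  define F where "F = (\<lambda>t. \<integral>x. f (x(n := t)) \<partial>leb n)"
  define G where "G = (\<lambda>t. \<integral>x. g (x(n := t)) \<partial>leb n)"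
  define H where "H = (\<lambda>t. \<integral>x. h (x(n := t)) \<partial>leb n)"
  have mF: "F \<in> borel_measurable borel" "\<exists>M. \<forall>t. F t \<le> M" "\<exists>R. \<forall>t. F t \<noteq> 0 \<longrightarrow> \<bar>t\<bar> \<le> R"
    "\<And>t. F t \<ge> 0" "(\<integral>t. F t \<partial>lborel) = (\<integral>x. f x \<partial>leb (Suc n))"
    unfolding F_def by (fact bdd_supp_marginal[OF Suc.prems(1)])+
  have mG: "G \<in> borel_measurable borel" "\<exists>M. \<forall>t. G t \<le> M" "\<exists>R. \<forall>t. G t \<noteq> 0 \<longrightarrow> \<bar>t\<bar> \<le> R"
    "\<And>t. G t \<ge> 0" "(\<integral>t. G t \<partial>lborel) = (\<integral>x. g x \<partial>leb (Suc n))"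
    unfolding G_def by (fact bdd_supp_marginal[OF Suc.prems(2)])+
  have mH: "integrable lborel H" "\<And>t. H t \<ge> 0" "(\<integral>t. H t \<partial>lborel) = (\<integral>x. h x \<partial>leb (Suc n))"
    unfolding H_def by (fact bdd_supp_marginal[OF Suc.prems(3)])+
  have *: "(F s / a ^ n) powr a * (G t / b ^ n) powr b \<le> H (s + t)" for s t
    unfolding F_def G_def H_def
  proof (rule Suc.IH)
    show "f (x(n := s)) powr a * g (y(n := t)) powr b \<le> h ((x + y)(n := s + t))" for x y
    proof -
      have "(x + y)(n := s + t) = x(n := s) + y(n := t)" by (auto simp: fun_eq_iff)
      then show ?thesis using Suc.prems(7)[of "x(n := s)" "y(n := t)"] by (simp only:)
    qed
  qed (rule bdd_supp_slice[OF Suc.prems(1)] bdd_supp_slice[OF Suc.prems(2)]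
      bdd_supp_slice[OF Suc.prems(3)] Suc.prems)+
  obtain M1 M2 where M: "\<And>t. F t \<le> M1" "\<And>t. G t \<le> M2" using mF(2) mG(2) by blast
  obtain R1 R2 where R: "\<And>t. F t \<noteq> 0 \<Longrightarrow> \<bar>t\<bar> \<le> R1" "\<And>t. G t \<noteq> 0 \<Longrightarrow> \<bar>t\<bar> \<le> R2"
    using mF(3) mG(3) by blast
  have "((\<integral>t. F t / a ^ n \<partial>lborel) / a) powr a * ((\<integral>t. G t / b ^ n \<partial>lborel) / b) powr b \<le> (\<integral>t. H t \<partial>lborel)"
  proof (rule Prekopa_Leindler_1D)
    show "F t / a ^ n \<le> max (M1 / a ^ n) (M2 / b ^ n)" "G t / b ^ n \<le> max (M1 / a ^ n) (M2 / b ^ n)" for t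
      using M ab by (auto simp: le_max_iff_disj divide_right_mono)
    show "\<bar>t\<bar> \<le> max R1 R2" if "F t / a ^ n \<noteq> 0" for t
      using R(1)[of t] that by auto
    show "\<bar>t\<bar> \<le> max R1 R2" if "G t / b ^ n \<noteq> 0" for t
      using R(2)[of t] that by auto
  qed (use mF mG mH ab * in auto)
  then show ?case
    by (simp add: mF(5) mG(5) mH(3) mult.commute)
qed

lemma bdd_supp_indicator: "cpt n A \<Longrightarrow> bdd_supp n (indicator A)"
proof -
  assume A: "cpt n A"
  obtain r where "r > 0" "\<And>x. x \<in> A \<Longrightarrow> ip n x x \<le> r\<^sup>2" using cpt_bounded[OF A] by blast
  then show ?thesis
    using cpt_borel[OF A] unfolding bdd_supp_def
    by (intro conjI exI[of _ 1] exI[of _ r]) (auto simp: indicator_def)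
qed

text \<open>Weights proportional to the two roots make both factors of the Prekopa--Leindler bound
  for indicators powers of the same number \<open>(\<alpha> + \<beta>) ^ n\<close>, so the geometric
  mean loses nothing.\<close>

theorem Brunn_Minkowski:
  assumes A: "cpt n A" "vol n A > 0" and B: "cpt n B" "vol n B > 0" and n: "n > 0"
  shows "root n (vol n A) + root n (vol n B) \<le> root n (vol n (A + B))"
proof -
  define \<alpha> \<beta> a b where "\<alpha> = root n (vol n A)" and "\<beta> = root n (vol n B)"
    and "a = \<alpha> / (\<alpha> + \<beta>)" and "b = \<beta> / (\<alpha> + \<beta>)"
  have pos: "\<alpha> > 0" "\<beta> > 0" using A B n by (auto simp: \<alpha>_def \<beta>_def)
  have ab: "a > 0" "b > 0" "a + b = 1"
    using pos by (auto simp: a_def b_def add_pos_pos simp flip: add_divide_distrib)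
  have pw: "vol n A = \<alpha> ^ n" "vol n B = \<beta> ^ n" using A B n by (auto simp: \<alpha>_def \<beta>_def)
  have S: "cpt n (A + B)" using A B by (intro cpt_add)
  have i: "(\<integral>x. indicator D x \<partial>leb n) = vol n D" if "cpt n D" for D
    using cpt_borel[OF that] by (simp add: vol_eq)
  have "((\<integral>x. indicator A x \<partial>leb n) / a ^ n) powr a * ((\<integral>x. indicator B x \<partial>leb n) / b ^ n) powr b
      \<le> (\<integral>x. indicator (A + B) x \<partial>leb n)"
    using A B S ab by (intro Prekopa_Leindler bdd_supp_indicator) (auto simp: indicator_def)
  then have "(\<alpha> ^ n / a ^ n) powr a * (\<beta> ^ n / b ^ n) powr b \<le> vol n (A + B)"
    unfolding i[OF A(1)] i[OF B(1)] i[OF S] pw .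
  moreover have "\<alpha> ^ n / a ^ n = (\<alpha> + \<beta>) ^ n" "\<beta> ^ n / b ^ n = (\<alpha> + \<beta>) ^ n"
    using pos by (auto simp: a_def b_def field_simps)
  ultimately have "((\<alpha> + \<beta>) ^ n) powr a * ((\<alpha> + \<beta>) ^ n) powr b \<le> vol n (A + B)" by simp
  then have "(\<alpha> + \<beta>) ^ n \<le> vol n (A + B)"
    using ab pos by (simp flip: powr_add)
  then have "root n ((\<alpha> + \<beta>) ^ n) \<le> root n (vol n (A + B))"
    using n by simp
  then show ?thesis using pos n by (simp add: real_root_power_cancel \<alpha>_def \<beta>_def)
qed

lemma vol_scl:
  assumes A: "cpt n A" and c: "c > 0"
  shows "vol n (scl c ` A) = c ^ n * vol n A"
proof -
  have "{x. 0 + scl c x \<in> scl c ` A} = A"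
  proof -
    have "x = y" if "scl c x = scl c y" for x y
      using that c by (simp add: fun_eq_iff)
    then show ?thesis by (auto simp: image_iff)
  qed
  then have "emeasure (leb n) (scl c ` A) = ennreal (c ^ n) * emeasure (leb n) A"
    using emeasure_leb_affine[OF cpt_borel[OF cpt_scl[OF A]], of c 0 n c] c by simp
  then show ?thesis
    unfolding emeasure_vol[OF A] emeasure_vol[OF cpt_scl[OF A]] using c by (simp flip: ennreal_mult)
qed

text \<open>Convexity of \<open>K\<close> puts the combination of \<open>K\<close> and
  \<open>K + C\<close> with weights \<open>1 - \<theta>\<close> and \<open>\<theta>\<close> into
  \<open>K\<close> plus the dilate of \<open>C\<close>; Brunn--Minkowski and homogeneity of the
  volume do the rest. The endpoints are separate because a factor 0 has no positive volume.\<close>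

lemma root_vol_concave:
  assumes K: "conv_cpt n K" "vol n K > 0" and C: "conv_cpt n C" "0 \<in> C" and n: "n > 0" and \<theta>: "0 \<le> \<theta>" "\<theta> \<le> 1"
  shows "(1 - \<theta>) * root n (vol n K) + \<theta> * root n (vol n (K + C)) \<le> root n (vol n (K + scl \<theta> ` C))"
proof -
  note cK = conv_cpt_cpt[OF K(1)] and cC = conv_cpt_cpt[OF C(1)]
  have ne: "K \<noteq> {}" using K(2) by (auto simp: vol_def)
  have "C \<noteq> {}" using C by auto
  consider "\<theta> = 0" | "\<theta> = 1" | "0 < \<theta>" "\<theta> < 1" using \<theta> by linarith
  then show ?thesis
  proof cases
    case 1
    then have "scl \<theta> ` C = {0}" using \<open>C \<noteq> {}\<close> by auto
    then show ?thesis using 1 by (simp flip: set_zero)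
  next
    case 2
    then have "scl \<theta> ` C = C" by simp
    then show ?thesis using 2 by simp
  next
    case 3
    have cKC: "cpt n (K + C)" by (intro cpt_add cK cC)
    have "K \<subseteq> K + C" using C(2) by (metis add.right_neutral set_plus_intro subsetI)
    then have "vol n K \<le> vol n (K + C)" by (intro vol_mono cK cKC)
    then have pKC: "vol n (K + C) > 0" using K by simp
    let ?A = "scl (1 - \<theta>) ` K" and ?B = "scl \<theta> ` (K + C)"
    have vA: "vol n ?A = (1 - \<theta>) ^ n * vol n K" and vB: "vol n ?B = \<theta> ^ n * vol n (K + C)"
      using 3 by (auto intro!: vol_scl cK cKC)
    have "(1 - \<theta>) * root n (vol n K) + \<theta> * root n (vol n (K + C)) = root n (vol n ?A) + root n (vol n ?B)"
      unfolding vA vB real_root_mult using 3 n by (simp add: real_root_power_cancel)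
    also have "\<dots> \<le> root n (vol n (?A + ?B))"
      using 3 n K pKC by (intro Brunn_Minkowski cpt_scl cK cKC) (auto simp: vA vB)
    also have "\<dots> \<le> root n (vol n (K + scl \<theta> ` C))"
    proof -
      have "?A + ?B \<subseteq> K + scl \<theta> ` C"
      proof
        fix x assume "x \<in> ?A + ?B"
        then obtain k k' c where k: "k \<in> K" "k' \<in> K" "c \<in> C" "x = scl (1 - \<theta>) k + scl \<theta> (k' + c)"
          by (auto elim!: set_plus_elim)
        then have "x = (scl (1 - \<theta>) k + scl \<theta> k') + scl \<theta> c" by (simp add: scl_add add.assoc)
        moreover have "scl (1 - \<theta>) k + scl \<theta> k' \<in> K" using K k \<theta> by (intro cvxD) (auto simp: conv_cpt_def)
        ultimately show "x \<in> K + scl \<theta> ` C" using k(3) by (simp only: set_plus_intro imageI)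
      qed
      then show ?thesis using n by (simp, intro vol_mono cpt_add cpt_scl cK cKC cC)
    qed
    finally show ?thesis .
  qed
qed

section \<open>Zonotopes\<close>

fun zonotope :: "(real \<times> vec) list \<Rightarrow> vec set" where
  "zonotope [] = {0}"
| "zonotope ((s, \<xi>) # l) = segment (scl s \<xi>) + zonotope l"

definition generators :: "nat \<Rightarrow> (real \<times> vec) list \<Rightarrow> bool" where
  "generators m l \<longleftrightarrow> (\<forall>(s, \<xi>)\<in>set l. s \<ge> 0 \<and> on_sphere (Suc m) \<xi>)"

lemma generators_simps [simp]:
  "generators m []" "generators m ((s, \<xi>) # l) \<longleftrightarrow> s \<ge> 0 \<and> on_sphere (Suc m) \<xi> \<and> generators m l"
  by (auto simp: generators_def)

lemma subset_add_zero:
  fixes A B :: "vec set"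
  shows "0 \<in> B \<Longrightarrow> A \<subseteq> A + B"
  by (metis add.right_neutral set_plus_intro subsetI)

lemma zero_in_zonotope: "0 \<in> zonotope l"
proof (induction l rule: zonotope.induct)
  case (2 s \<xi> l)
  have "0 + 0 \<in> segment (scl s \<xi>) + zonotope l" by (intro set_plus_intro 2 zero_in_segment)
  then show ?case by (metis add.left_neutral zonotope.simps(2))
qed (simp add: zero_fun_def)

lemma on_sphere_in_Rn: "on_sphere n \<xi> \<Longrightarrow> \<xi> \<in> Rn n"
  by (simp add: on_sphere_def)

lemma conv_cpt_zonotope: "generators m l \<Longrightarrow> conv_cpt (Suc m) (zonotope l)"
proof (induction l rule: zonotope.induct)
  case 1
  show ?case unfolding zonotope.simps by (rule conv_cpt_singleton) simp
next
  case (2 s \<xi> l)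
  then show ?case unfolding zonotope.simps
    by (intro conv_cpt_add conv_cpt_segment Rn_scl on_sphere_in_Rn) auto
qed

lemma scl_zonotope: "scl t ` zonotope l = zonotope (map (\<lambda>(s, \<xi>). (t * s, \<xi>)) l)"
proof (induction l rule: zonotope.induct)
  case 1
  show ?case by (simp add: zero_fun_def)
next
  case (2 s \<xi> l)
  have "scl t ` segment (scl s \<xi>) = segment (scl (t * s) \<xi>)"
    unfolding segment_def image_image by (simp add: mult.left_commute)
  then show ?case using 2 linear_image_add[of "scl t" "segment (scl s \<xi>)" "zonotope l", OF scl_add]
    by (simp only: zonotope.simps list.map prod.case)
qed

lemma generators_scale: "generators m l \<Longrightarrow> t \<ge> 0 \<Longrightarrow> generators m (map (\<lambda>(s, \<xi>). (t * s, \<xi>)) l)"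
  by (auto simp: generators_def)

lemma zonotope_Cons_add: "A + zonotope ((s, \<xi>) # l) = (A + segment (scl s \<xi>)) + zonotope l"
  by (simp add: add.assoc)

text \<open>Each segment contributes its length times a shadow, and shadows grow with the body. The
  inclusion survives the addition of a segment, so the contributions can be summed.\<close>

lemma vol_add_zonotope_supermodular:
  assumes "generators m l" "conv_cpt (Suc m) A" "conv_cpt (Suc m) A'" "A \<subseteq> A'"
  shows "vol (Suc m) (A + zonotope l) - vol (Suc m) A \<le> vol (Suc m) (A' + zonotope l) - vol (Suc m) A'"
  using assms
proof (induction l arbitrary: A A' rule: zonotope.induct)
  case 1
  then show ?case by (simp flip: set_zero)
next
  case (2 s \<xi> l)
  then have s: "s \<ge> 0" "on_sphere (Suc m) \<xi>" "generators m l" by auto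
  have c: "conv_cpt (Suc m) (segment (scl s \<xi>))" using s by (intro conv_cpt_segment Rn_scl on_sphere_in_Rn)
  have sub: "A + segment (scl s \<xi>) \<subseteq> A' + segment (scl s \<xi>)" by (rule set_plus_mono2[OF 2(5) order_refl])
  have "vol (Suc m) ((A + segment (scl s \<xi>)) + zonotope l) - vol (Suc m) (A + segment (scl s \<xi>))
      \<le> vol (Suc m) ((A' + segment (scl s \<xi>)) + zonotope l) - vol (Suc m) (A' + segment (scl s \<xi>))"
    by (rule 2(1)[OF s(3) _ _ sub]) (intro conv_cpt_add c 2)+
  moreover have "s * shadow_vol m \<xi> A \<le> s * shadow_vol m \<xi> A'"
    using 2 s by (intro mult_left_mono shadow_vol_mono) (auto simp: conv_cpt_cpt)
  ultimately show ?case
    unfolding zonotope_Cons_add using vol_add_segment[OF s(2) _ s(1), of A] vol_add_segment[OF s(2) _ s(1), of A'] 2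
    by simp
qed

text \<open>The first-order growth of the volume of \<open>A\<close> when the zonotope is added; for
  a quadrature rule it is the discrete mean of the projected volumes.\<close>

definition zonotope_sum :: "nat \<Rightarrow> (real \<times> vec) list \<Rightarrow> vec set \<Rightarrow> real" where
  "zonotope_sum m l A = (\<Sum>(s, \<xi>)\<leftarrow>l. s * shadow_vol m \<xi> A)"

lemma zonotope_sum_simps [simp]:
  "zonotope_sum m [] A = 0" "zonotope_sum m ((s, \<xi>) # l) A = s * shadow_vol m \<xi> A + zonotope_sum m l A"
  by (simp_all add: zonotope_sum_def)

lemma zonotope_sum_mono:
  assumes "generators m l" "cpt (Suc m) A" "cpt (Suc m) B" "A \<subseteq> B"
  shows "zonotope_sum m l A \<le> zonotope_sum m l B"
  using assms by (induction l rule: zonotope.induct) (auto intro!: add_mono mult_left_mono shadow_vol_mono)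

lemma zonotope_sum_scale: "zonotope_sum m (map (\<lambda>(s, \<xi>). (t * s, \<xi>)) l) A = t * zonotope_sum m l A"
  by (induction l rule: zonotope.induct) (auto simp: algebra_simps)

text \<open>Every shadow met on the way contains that of the initial body.\<close>

lemma vol_add_zonotope_lower:
  assumes "generators m l" "conv_cpt (Suc m) A"
  shows "vol (Suc m) A + zonotope_sum m l A \<le> vol (Suc m) (A + zonotope l)"
  using assms
proof (induction l arbitrary: A rule: zonotope.induct)
  case 1
  then show ?case by (simp flip: set_zero)
next
  case (2 s \<xi> l)
  then have s: "s \<ge> 0" "on_sphere (Suc m) \<xi>" "generators m l" by auto
  have c: "conv_cpt (Suc m) (A + segment (scl s \<xi>))"
    using s 2 by (intro conv_cpt_add conv_cpt_segment Rn_scl on_sphere_in_Rn)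
  have "zonotope_sum m l A \<le> zonotope_sum m l (A + segment (scl s \<xi>))"
    using s c 2 by (intro zonotope_sum_mono subset_add_zero) (auto simp: conv_cpt_cpt)
  then show ?case
    unfolding zonotope_Cons_add using 2(1)[OF s(3) c] vol_add_segment[OF s(2) _ s(1), of A] 2 by simp
qed

text \<open>Every shadow met on the way lies in that of the final body. It is this direction that
  bounds \<kappa> from above.\<close>

lemma vol_add_zonotope_upper:
  assumes "generators m l" "conv_cpt (Suc m) A"
  shows "vol (Suc m) (A + zonotope l) \<le> vol (Suc m) A + zonotope_sum m l (A + zonotope l)"
  using assms
proof (induction l arbitrary: A rule: zonotope.induct)
  case 1
  then show ?case by (simp flip: set_zero)
next
  case (2 s \<xi> l)
  then have s: "s \<ge> 0" "on_sphere (Suc m) \<xi>" "generators m l" by auto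
  have c: "conv_cpt (Suc m) (A + segment (scl s \<xi>))"
    using s 2 by (intro conv_cpt_add conv_cpt_segment Rn_scl on_sphere_in_Rn)
  have "A \<subseteq> A + zonotope ((s, \<xi>) # l)" by (intro subset_add_zero zero_in_zonotope)
  then have "s * shadow_vol m \<xi> A \<le> s * shadow_vol m \<xi> (A + zonotope ((s, \<xi>) # l))"
    using s 2 by (intro mult_left_mono shadow_vol_mono cpt_add conv_cpt_cpt[OF conv_cpt_zonotope] conv_cpt_cpt) auto
  then show ?case
    unfolding zonotope_Cons_add using 2(1)[OF s(3) c] vol_add_segment[OF s(2) _ s(1), of A] 2
    by (simp add: add.assoc)
qed

text \<open>The nontrivial inclusion is convexity: a sum of two dilated points is the dilate of
  their weighted mean.\<close>

lemma scl_cvx_add: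
  assumes "cvx Z" "a \<ge> 0" "b \<ge> 0"
  shows "scl (a + b) ` Z = scl a ` Z + scl b ` Z"
proof (rule set_eqI, rule iffI)
  fix x assume "x \<in> scl (a + b) ` Z"
  then obtain z where "z \<in> Z" "x = scl a z + scl b z" by (auto simp: scl_add_left)
  then show "x \<in> scl a ` Z + scl b ` Z" by (simp only: set_plus_intro imageI)
next
  fix x assume "x \<in> scl a ` Z + scl b ` Z"
  then obtain y z where z: "y \<in> Z" "z \<in> Z" "x = scl a y + scl b z" by (auto elim!: set_plus_elim)
  show "x \<in> scl (a + b) ` Z"
  proof (cases "a + b = 0")
    case True
    then have "a = 0" "b = 0" using assms by auto
    then show ?thesis using z by force
  next
    case False
    then have p: "a + b > 0" using assms by simp
    have "scl (1 - b / (a + b)) y + scl (b / (a + b)) z \<in> Z"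
      using z assms p by (intro cvxD) auto
    moreover have "(a + b) * (1 - b / (a + b)) = a" "(a + b) * (b / (a + b)) = b"
      using p by (simp_all add: right_diff_distrib)
    then have "x = scl (a + b) (scl (1 - b / (a + b)) y + scl (b / (a + b)) z)"
      by (simp only: scl_add scl_scl z(3))
    ultimately show ?thesis by blast
  qed
qed

text \<open>The \<open>N\<close>-fold dilate is a sum of \<open>N\<close> copies, and by
  supermodularity each later copy adds at least as much volume as the first. This is a discrete form
  of growth above the tangent.\<close>

lemma vol_add_zonotope_multiple:
  assumes l: "generators m l" and K: "conv_cpt (Suc m) K"
  shows "real N * (vol (Suc m) (K + zonotope l) - vol (Suc m) K) \<le> vol (Suc m) (K + scl (real N) ` zonotope l) - vol (Suc m) K"
proof (induction N)
  case 0
  have "scl 0 ` zonotope l = {0}" using zero_in_zonotope[of l] by force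
  then show ?case by (simp only: of_nat_0 set_add_0_right mult_zero_left diff_self order_refl)
next
  case (Suc N)
  let ?A = "K + scl (real N) ` zonotope l"
  have "scl (real (Suc N)) ` zonotope l = scl (real N) ` zonotope l + zonotope l"
    using scl_cvx_add[of "zonotope l" "real N" 1] conv_cpt_zonotope[OF l] by (simp add: conv_cpt_def add.commute)
  then have eq: "K + scl (real (Suc N)) ` zonotope l = ?A + zonotope l" by (simp only: add.assoc)
  have "scl (real N) 0 \<in> scl (real N) ` zonotope l" by (intro imageI zero_in_zonotope)
  then have "K \<subseteq> ?A" by (intro subset_add_zero) simp
  then have "vol (Suc m) (K + zonotope l) - vol (Suc m) K \<le> vol (Suc m) (?A + zonotope l) - vol (Suc m) ?A"
    using l K by (intro vol_add_zonotope_supermodular conv_cpt_add conv_cpt_scl conv_cpt_zonotope)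
  moreover have "real (Suc N) * (vol (Suc m) (K + zonotope l) - vol (Suc m) K)
      = real N * (vol (Suc m) (K + zonotope l) - vol (Suc m) K) + (vol (Suc m) (K + zonotope l) - vol (Suc m) K)"
    by (simp only: of_nat_Suc distrib_right mult_1_left add.commute)
  ultimately show ?case unfolding eq using Suc.IH by linarith
qed

text \<open>The support function of the zonotope; the factor 1/2 is the half-length of a centred
  unit segment.\<close>

definition zonotope_supp :: "nat \<Rightarrow> (real \<times> vec) list \<Rightarrow> vec \<Rightarrow> real" where
  "zonotope_supp n l x = (\<Sum>(s, \<xi>)\<leftarrow>l. s * \<bar>ip n \<xi> x\<bar>) / 2"

lemma zonotope_supp_simps [simp]:
  "zonotope_supp n [] x = 0" "zonotope_supp n ((s, \<xi>) # l) x = s * \<bar>ip n \<xi> x\<bar> / 2 + zonotope_supp n l x"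
  by (simp_all add: zonotope_supp_def add_divide_distrib)

lemma ip_le_zonotope_supp: "generators m l \<Longrightarrow> z \<in> zonotope l \<Longrightarrow> ip n z x \<le> zonotope_supp n l x"
proof (induction l arbitrary: z rule: zonotope.induct)
  case (2 s \<xi> l)
  then obtain t y where ty: "t \<in> {-1/2..1/2}" "y \<in> zonotope l" "z = scl (t * s) \<xi> + y"
    by (auto simp: segment_def elim!: set_plus_elim)
  have "\<bar>t\<bar> \<le> 1 / 2" using ty(1) by auto
  then have "\<bar>t * (s * ip n \<xi> x)\<bar> \<le> 1 / 2 * (s * \<bar>ip n \<xi> x\<bar>)"
    using 2(2) unfolding abs_mult by (intro mult_mono) auto
  then have "t * (s * ip n \<xi> x) \<le> s * \<bar>ip n \<xi> x\<bar> / 2" by linarith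
  moreover have "ip n y x \<le> zonotope_supp n l x" using 2 ty by auto
  moreover have "ip n z x = t * (s * ip n \<xi> x) + ip n y x"
    unfolding ty(3) ip_add_left ip_scl_left by (simp only: mult.assoc)
  ultimately show ?case unfolding zonotope_supp_simps by linarith
qed (simp add: zero_fun_def ip_zero(1)[unfolded zero_fun_def])

lemma zonotope_supp_attained: "\<exists>z\<in>zonotope l. ip n z x = zonotope_supp n l x"
proof (induction l rule: zonotope.induct)
  case (2 s \<xi> l)
  then obtain y where y: "y \<in> zonotope l" "ip n y x = zonotope_supp n l x" by auto
  let ?t = "if ip n \<xi> x \<ge> 0 then 1 / 2 else - 1 / 2 :: real"
  have "scl ?t (scl s \<xi>) + y \<in> zonotope ((s, \<xi>) # l)"
    unfolding zonotope.simps segment_def by (intro set_plus_intro imageI y) auto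
  moreover have "ip n (scl ?t (scl s \<xi>) + y) x = zonotope_supp n ((s, \<xi>) # l) x"
    unfolding ip_add_left ip_scl_left y zonotope_supp_simps by simp
  ultimately show ?case by blast
qed (simp add: zero_fun_def ip_zero(1)[unfolded zero_fun_def])

text \<open>
  If \<open>z\<close> is the point of \<open>Z\<close> nearest to \<open>b\<close>, then \<open>u = b - z\<close> separates \<open>b\<close> from \<open>Z\<close>
  unless \<open>u = 0\<close>.
\<close>
lemma in_convex_if_ip_le:
  assumes Z: "conv_cpt n Z" "Z \<noteq> {}" and b: "b \<in> Rn n"
    and supp: "\<And>u. u \<in> Rn n \<Longrightarrow> \<exists>z\<in>Z. ip n b u \<le> ip n z u"
  shows "b \<in> Z"
proof -
  have ZR: "Z \<subseteq> Rn n" and cZ: "compact Z" using Z by (auto simp: conv_cpt_def cpt_def)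
  have "continuous_on Z (\<lambda>z. b + scl (- 1) z)"
    by (intro continuous_on_vec_add continuous_on_scl continuous_on_const continuous_on_id)
  then have "continuous_on Z (\<lambda>z. ip n (b + scl (- 1) z) (b + scl (- 1) z))"
    by (intro continuous_on_ip)
  moreover have "b + scl (- 1) z = b - z" for z by (simp add: fun_eq_iff)
  ultimately have "continuous_on Z (\<lambda>z. ip n (b - z) (b - z))" by (simp only:)
  from continuous_attains_inf[OF cZ Z(2) this] obtain z where
    z: "z \<in> Z" "\<And>y. y \<in> Z \<Longrightarrow> ip n (b - z) (b - z) \<le> ip n (b - y) (b - y)" by auto
  define u where "u = b - z"
  have u: "u \<in> Rn n" using b z ZR by (auto simp: u_def)
  obtain z' where z': "z' \<in> Z" "ip n b u \<le> ip n z' u" using supp[OF u] by blast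
  define w where "w = z' - z"
  have uu: "ip n u u \<le> ip n u w"
    using z'(2) unfolding u_def w_def by (simp add: ip_diff_left ip_diff_right ip_commute)
  \<comment> \<open>Moving from the nearest point \<open>z\<close> towards \<open>z'\<close> cannot
    decrease the distance to \<open>b\<close>. Letting \<open>t\<close> tend to 0 gives
    \<open>ip n u w \<le> 0\<close>, which with \<open>uu\<close> forces
    \<open>u = 0\<close>.\<close>
  have "2 * ip n u w \<le> t * ip n w w" if t: "0 < t" "t \<le> 1" for t
  proof -
    have "scl (1 - t) z + scl t z' \<in> Z" using Z z z' t by (intro cvxD) (auto simp: conv_cpt_def)
    then have "ip n u u \<le> ip n (b - (scl (1 - t) z + scl t z')) (b - (scl (1 - t) z + scl t z'))"
      unfolding u_def by (rule z(2))
    also have "b - (scl (1 - t) z + scl t z') = u - scl t w"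
      by (auto simp: u_def w_def fun_eq_iff algebra_simps)
    also have "ip n (u - scl t w) (u - scl t w) = ip n u u - t * (2 * ip n u w) + t * (t * ip n w w)"
      by (simp add: ip_diff_left ip_diff_right ip_commute[of n w u] algebra_simps)
    finally have "t * (2 * ip n u w) \<le> t * (t * ip n w w)" by simp
    then show ?thesis using t by (simp only: mult_le_cancel_left_pos)
  qed
  then have ev: "eventually (\<lambda>t. 2 * ip n u w \<le> t * ip n w w) (at_right 0)"
    unfolding eventually_at_right_field by (intro exI[of _ 1]) auto
  have "((\<lambda>t. t * ip n w w) \<longlongrightarrow> 0 * ip n w w) (at_right 0)"
    by (intro tendsto_intros)
  then have "2 * ip n u w \<le> 0 * ip n w w"
    using ev by (intro tendsto_lowerbound) auto
  then have "ip n u u \<le> 0" using uu by simp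
  then have "ip n u u = 0" using ip_self_nonneg[of n u] by linarith
  then have "u = 0" using u by (rule ip_self_eq_0)
  then show ?thesis using z(1) by (simp add: u_def)
qed

text \<open>By Cauchy--Schwarz the hypothesis compares support functions, and a compact convex set
  contains every point dominated by its support function.\<close>

lemma ball_Rn_subset_zonotope:
  assumes l: "generators m l" and c: "\<And>x. x \<in> Rn (Suc m) \<Longrightarrow> c * nrm (Suc m) x \<le> zonotope_supp (Suc m) l x"
  shows "ball_Rn (Suc m) c \<subseteq> zonotope l"
proof
  fix b assume b: "b \<in> ball_Rn (Suc m) c"
  show "b \<in> zonotope l"
  proof (rule in_convex_if_ip_le[OF conv_cpt_zonotope[OF l]])
    show "zonotope l \<noteq> {}" using zero_in_zonotope by blast
    show "b \<in> Rn (Suc m)" using b by (simp add: ball_Rn_def)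
    fix u assume u: "u \<in> Rn (Suc m)"
    obtain z where z: "z \<in> zonotope l" "ip (Suc m) z u = zonotope_supp (Suc m) l u"
      using zonotope_supp_attained by blast
    have "ip (Suc m) b u \<le> nrm (Suc m) b * nrm (Suc m) u" by (rule ip_le_nrm)
    also have "\<dots> \<le> c * nrm (Suc m) u" using b by (intro mult_right_mono) (auto simp: ball_Rn_def)
    also have "\<dots> \<le> ip (Suc m) z u" using c[OF u] z by simp
    finally show "\<exists>z\<in>zonotope l. ip (Suc m) b u \<le> ip (Suc m) z u" using z by blast
  qed
qed

text \<open>The bound is tested in the direction of the point itself, and one factor of its norm
  cancels.\<close>

lemma zonotope_subset_ball_Rn:
  assumes l: "generators m l" and c: "\<And>x. x \<in> Rn (Suc m) \<Longrightarrow> zonotope_supp (Suc m) l x \<le> c * nrm (Suc m) x"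
    and "c \<ge> 0"
  shows "zonotope l \<subseteq> ball_Rn (Suc m) c"
proof
  fix z assume z: "z \<in> zonotope l"
  have zR: "z \<in> Rn (Suc m)" using z conv_cpt_zonotope[OF l] by (auto simp: conv_cpt_def cpt_def)
  have "(nrm (Suc m) z)\<^sup>2 \<le> c * nrm (Suc m) z"
    using ip_le_zonotope_supp[OF l z, of "Suc m" z] c[OF zR] by (simp add: nrm_sq)
  then have "nrm (Suc m) z \<le> c"
    using \<open>c \<ge> 0\<close> nrm_nonneg[of "Suc m" z] by (cases "nrm (Suc m) z = 0") (auto simp: power2_eq_square)
  then show "z \<in> ball_Rn (Suc m) c" using zR by (simp add: ball_Rn_def)
qed

section \<open>Quadrature on the sphere\<close>

lemma unit_sphere_eq: "unit_sphere (Suc m) = {\<xi>. on_sphere (Suc m) \<xi>}"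
proof -
  have "unit_sphere (Suc m) = {\<xi>. (\<Sum>i\<le>m. (\<xi> i)\<^sup>2) = 1 \<and> (\<forall>i>m. \<xi> i = 0)}"
    by (simp add: nsphere)
  then show ?thesis
    unfolding on_sphere_def Rn_iff Suc_le_eq ip_def lessThan_Suc_atMost power2_eq_square by blast
qed

lemma nrm_minus: "nrm n (- x) = nrm n x"
  unfolding nrm_def ip_minus by simp

lemma ip_basis_vec': "i < n \<Longrightarrow> ip n x (basis_vec i) = x i"
  by (subst ip_commute) (rule ip_basis_vec)

lemma ip_abs_le: "\<bar>ip n x y\<bar> \<le> nrm n x * nrm n y"
  using ip_le_nrm[of n x y] ip_le_nrm[of n "- x" y] unfolding nrm_minus ip_minus by linarith

locale sphere_measure =
  fixes m :: nat and \<sigma> :: "vec measure"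
  assumes rot: "rotation_invariant_prob (Suc m) \<sigma>"
begin

sublocale prob_space \<sigma>
  using rot by (simp add: rotation_invariant_prob_def)

lemma space_\<sigma>: "space \<sigma> = {\<xi>. on_sphere (Suc m) \<xi>}"
  using rot unfolding rotation_invariant_prob_def unit_sphere_eq by blast

lemma sets_\<sigma>: "sets \<sigma> = sets (restrict_space borel {\<xi>. on_sphere (Suc m) \<xi>})"
  using rot unfolding rotation_invariant_prob_def unit_sphere_eq by blast

lemma measurable_\<sigma>I: "f \<in> measurable borel N \<Longrightarrow> f \<in> measurable \<sigma> N"
  using measurable_restrict_space1[of f borel N] measurable_cong_sets[OF sets_\<sigma> refl] by blast

lemma nrm_sphere: "\<xi> \<in> space \<sigma> \<Longrightarrow> nrm (Suc m) \<xi> = 1"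
  by (simp add: space_\<sigma> on_sphere_def nrm_def)

lemma measurable_ip_\<sigma> [measurable]: "(\<lambda>\<xi>. \<bar>ip n \<xi> x\<bar>) \<in> borel_measurable \<sigma>"
  by (rule measurable_\<sigma>I) measurable

lemma integrable_ip: "integrable \<sigma> (\<lambda>\<xi>. \<bar>ip (Suc m) \<xi> x\<bar>)"
proof (rule integrable_const_bound[of _ "nrm (Suc m) x"])
  have "\<bar>ip (Suc m) \<xi> x\<bar> \<le> nrm (Suc m) x" if "\<xi> \<in> space \<sigma>" for \<xi>
    using ip_abs_le[of "Suc m" \<xi> x] nrm_sphere[OF that] by simp
  then show "AE \<xi> in \<sigma>. norm \<bar>ip (Suc m) \<xi> x\<bar> \<le> nrm (Suc m) x" by auto
qed simp

text \<open>By rotation invariance every unit vector may replace \<open>basis_vec 0\<close>, so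
  \<open>\<kappa> / 2\<close> is the radius of the ball that the zonotopes approximate.\<close>

definition \<kappa> :: real where
  "\<kappa> = (\<integral>\<xi>. \<bar>ip (Suc m) \<xi> (basis_vec 0)\<bar> \<partial>\<sigma>)"

text \<open>An orthogonal map that takes \<open>basis_vec 0\<close> to \<open>x\<close> preserves
  both \<sigma> and the inner product.\<close>

lemma integral_ip_sphere:
  assumes x: "on_sphere (Suc m) x"
  shows "(\<integral>\<xi>. \<bar>ip (Suc m) \<xi> x\<bar> \<partial>\<sigma>) = \<kappa>"
proof -
  have b: "basis_vec 0 \<in> Rn (Suc m)" "ip (Suc m) (basis_vec 0) (basis_vec 0) = 1"
    by (simp_all only: basis_vec_in_Rn ip_basis_vec zero_less_Suc) (simp add: basis_vec_def)
  obtain w where w: "orthonormal (Suc m) (Suc m) w" "lincomb (Suc m) w (basis_vec 0) = x"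
    using orthonormal_mapping[OF b] x by (auto simp: on_sphere_def)
  have T: "lincomb (Suc m) w \<in> measurable \<sigma> \<sigma>"
  proof -
    have "lincomb (Suc m) w \<in> measurable \<sigma> (restrict_space borel {\<xi>. on_sphere (Suc m) \<xi>})"
      by (rule measurable_restrict_space2)
        (auto simp: space_\<sigma> on_sphere_def ip_lincomb[OF w(1)] lincomb_in_Rn[OF w(1)]
          simp del: topspace_Euclidean_space intro: measurable_\<sigma>I)
    then show ?thesis using measurable_cong_sets[OF refl sets_\<sigma>] by blast
  qed
  have "(\<integral>\<xi>. \<bar>ip (Suc m) \<xi> x\<bar> \<partial>\<sigma>) = (\<integral>\<xi>. \<bar>ip (Suc m) \<xi> x\<bar> \<partial>distr \<sigma> \<sigma> (lincomb (Suc m) w))"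
    using rot w(1) by (simp add: rotation_invariant_prob_def)
  also have "\<dots> = (\<integral>\<xi>. \<bar>ip (Suc m) (lincomb (Suc m) w \<xi>) x\<bar> \<partial>\<sigma>)"
    by (rule integral_distr[OF T]) simp
  also have "\<dots> = \<kappa>"
    unfolding \<kappa>_def w(2)[symmetric] ip_lincomb[OF w(1)] ..
  finally show ?thesis .
qed

lemma integral_ip:
  assumes x: "x \<in> Rn (Suc m)"
  shows "(\<integral>\<xi>. \<bar>ip (Suc m) \<xi> x\<bar> \<partial>\<sigma>) = \<kappa> * nrm (Suc m) x"
proof (cases "nrm (Suc m) x = 0")
  case True
  then have "x = 0" using x by (rule nrm_eq_0)
  then show ?thesis unfolding \<open>x = 0\<close> ip_zero by (simp add: nrm_def ip_zero)
next
  case False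
  then have p: "nrm (Suc m) x > 0" using nrm_nonneg[of "Suc m" x] by linarith
  define y where "y = scl (1 / nrm (Suc m) x) x"
  have "ip (Suc m) y y = 1"
    unfolding y_def ip_scl_left ip_scl_right using p nrm_sq[of "Suc m" x]
    by (simp add: power2_eq_square flip: nrm_sq[of "Suc m" x])
  then have y: "on_sphere (Suc m) y" using x unfolding on_sphere_def y_def by (auto intro: Rn_scl)
  have "ip (Suc m) \<xi> x = nrm (Suc m) x * ip (Suc m) \<xi> y" for \<xi>
    unfolding y_def ip_scl_right using p by simp
  then have "(\<integral>\<xi>. \<bar>ip (Suc m) \<xi> x\<bar> \<partial>\<sigma>) = (\<integral>\<xi>. nrm (Suc m) x * \<bar>ip (Suc m) \<xi> y\<bar> \<partial>\<sigma>)"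
    using p by (simp add: abs_mult)
  also have "\<dots> = nrm (Suc m) x * \<kappa>" using integral_ip_sphere[OF y] by simp
  finally show ?thesis by simp
qed

text \<open>On the sphere the sum of the absolute values of the coordinates is at least 1, and each
  of them has mean \<kappa>.\<close>

lemma \<kappa>_pos: "\<kappa> > 0"
proof -
  have "(1::real) = (\<integral>\<xi>. 1 \<partial>\<sigma>)" by (simp add: prob_space)
  also have "\<dots> \<le> (\<integral>\<xi>. (\<Sum>i<Suc m. \<bar>ip (Suc m) \<xi> (basis_vec i)\<bar>) \<partial>\<sigma>)"
  proof (rule integral_mono)
    fix \<xi> assume "\<xi> \<in> space \<sigma>"
    then have "1 = L2_set \<xi> {..<Suc m}" using nrm_sphere nrm_L2 by metis
    also have "\<dots> \<le> (\<Sum>i<Suc m. \<bar>\<xi> i\<bar>)" by (rule L2_set_le_sum_abs)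
    also have "\<dots> = (\<Sum>i<Suc m. \<bar>ip (Suc m) \<xi> (basis_vec i)\<bar>)"
      by (intro sum.cong) (simp_all add: ip_basis_vec')
    finally show "1 \<le> (\<Sum>i<Suc m. \<bar>ip (Suc m) \<xi> (basis_vec i)\<bar>)" .
  qed (use integrable_ip in \<open>auto intro!: Bochner_Integration.integrable_sum\<close>)
  also have "\<dots> = (\<Sum>i<Suc m. (\<integral>\<xi>. \<bar>ip (Suc m) \<xi> (basis_vec i)\<bar> \<partial>\<sigma>))"
    using integrable_ip by (intro Bochner_Integration.integral_sum)
  also have "\<dots> = (\<Sum>i<Suc m. \<kappa>)"
  proof (intro sum.cong refl integral_ip_sphere)
    fix i assume "i \<in> {..<Suc m}"
    then show "on_sphere (Suc m) (basis_vec i)"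
      by (simp add: on_sphere_def basis_vec_in_Rn ip_basis_vec) (simp add: basis_vec_def)
  qed
  finally have "1 \<le> real (Suc m) * \<kappa>" by simp
  then have "0 < real (Suc m) * \<kappa>" by linarith
  then show ?thesis by (simp only: zero_less_mult_iff) simp
qed

text \<open>Otherwise \<open>\<phi>\<close> would stay strictly below its mean over \<open>E\<close>
  at every point of \<open>E\<close>. A null set \<open>E\<close> is treated apart: there both sides
  would be 0.\<close>

lemma mean_value_point:
  fixes \<phi> :: "vec \<Rightarrow> real"
  assumes \<phi>: "integrable \<sigma> \<phi>" and E: "E \<in> sets \<sigma>" "E \<noteq> {}"
  shows "\<exists>\<xi>\<in>E. (\<integral>\<eta>. indicator E \<eta> * \<phi> \<eta> \<partial>\<sigma>) \<le> prob E * \<phi> \<xi>"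
proof (rule ccontr)
  assume "\<not> ?thesis"
  then have less: "prob E * \<phi> \<xi> < (\<integral>\<eta>. indicator E \<eta> * \<phi> \<eta> \<partial>\<sigma>)" if "\<xi> \<in> E" for \<xi>
    using that by (auto simp: not_le)
  let ?I = "\<integral>\<eta>. indicator E \<eta> * \<phi> \<eta> \<partial>\<sigma>"
  have int: "integrable \<sigma> (\<lambda>\<eta>. indicator E \<eta> * \<phi> \<eta>)"
    using \<phi> E(1) integrable_mult_indicator[OF E(1) \<phi>] by simp
  show False
  proof (cases "prob E = 0")
    case True
    then have "AE \<eta> in \<sigma>. \<eta> \<notin> E"
      using E(1) by (simp add: AE_iff_null_sets[symmetric] null_sets_def emeasure_eq_measure)
    then have "AE \<eta> in \<sigma>. indicator E \<eta> * \<phi> \<eta> = 0" by (auto simp: indicator_def)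
    then have "?I = 0" by (rule integral_eq_zero_AE)
    then show False using less E(2) True by auto
  next
    case False
    then have p: "prob E > 0" by (simp add: zero_less_measure_iff)
    have "?I < (\<integral>\<eta>. indicator E \<eta> * (?I / prob E) \<partial>\<sigma>)"
    proof (rule integral_less_AE[where A = E])
      show "integrable \<sigma> (\<lambda>\<eta>. indicator E \<eta> * \<phi> \<eta>)" by (rule int)
      show "integrable \<sigma> (\<lambda>\<eta>. indicator E \<eta> * (?I / prob E))" using E(1) by (auto intro!: integrable_mult_left simp: integrable_real_indicator emeasure_eq_measure)
      show "emeasure \<sigma> E \<noteq> 0" using p by (simp add: emeasure_eq_measure)
      show "E \<in> sets \<sigma>" by (rule E(1))
      show "AE \<eta> in \<sigma>. \<eta> \<in> E \<longrightarrow> indicator E \<eta> * \<phi> \<eta> \<noteq> indicator E \<eta> * (?I / prob E)"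
      proof (intro AE_I2 impI)
        fix \<eta> assume "\<eta> \<in> E"
        then show "indicator E \<eta> * \<phi> \<eta> \<noteq> indicator E \<eta> * (?I / prob E)"
          using less[of \<eta>] p by (auto simp: eq_divide_eq mult.commute)
      qed
      show "AE \<eta> in \<sigma>. indicator E \<eta> * \<phi> \<eta> \<le> indicator E \<eta> * (?I / prob E)"
      proof (intro AE_I2)
        fix \<eta>
        show "indicator E \<eta> * \<phi> \<eta> \<le> indicator E \<eta> * (?I / prob E)"
          using less[of \<eta>] p by (cases "\<eta> \<in> E") (auto simp: pos_le_divide_eq mult.commute)
      qed
    qed
    also have "\<dots> = ?I" using p E(1) by simp
    finally show False by simp
  qed
qed

text \<open>The corner of the grid cube of side \<open>1 / k\<close> that contains the point; the
  value 0 beyond index \<open>m\<close> keeps the set of indices finite.\<close>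

definition cell_index :: "nat \<Rightarrow> vec \<Rightarrow> nat \<Rightarrow> int" where
  "cell_index k \<xi> = (\<lambda>i. if i < Suc m then \<lfloor>real k * \<xi> i\<rfloor> else 0)"

definition cell :: "nat \<Rightarrow> (nat \<Rightarrow> int) \<Rightarrow> vec set" where
  "cell k \<gamma> = {\<xi> \<in> space \<sigma>. cell_index k \<xi> = \<gamma>}"

lemma sets_cell: "cell k \<gamma> \<in> sets \<sigma>"
proof -
  have [measurable]: "(\<lambda>\<xi>::vec. \<xi> i) \<in> borel_measurable \<sigma>" for i
    by (rule measurable_\<sigma>I) measurable
  have "cell k \<gamma> = (if \<forall>i\<ge>Suc m. \<gamma> i = 0 then {\<xi> \<in> space \<sigma>. \<forall>i<Suc m. \<lfloor>real k * \<xi> i\<rfloor> = \<gamma> i} else {})"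
  proof (cases "\<forall>i\<ge>Suc m. \<gamma> i = 0")
    case True
    then have "cell_index k \<xi> = \<gamma> \<longleftrightarrow> (\<forall>i<Suc m. \<lfloor>real k * \<xi> i\<rfloor> = \<gamma> i)" for \<xi>
      unfolding cell_index_def fun_eq_iff by (metis not_le)
    with True show ?thesis by (simp add: cell_def)
  next
    case False
    then have "cell_index k \<xi> \<noteq> \<gamma>" for \<xi>
      unfolding cell_index_def fun_eq_iff by (metis not_le)
    then have "cell k \<gamma> = {}" by (simp only: cell_def) simp
    with False show ?thesis by (simp only: if_False)
  qed
  also have "\<dots> \<in> sets \<sigma>"
  proof -
    have "{\<xi> \<in> space \<sigma>. \<forall>i\<in>{..<Suc m}. of_int (\<gamma> i) \<le> real k * \<xi> i \<and> real k * \<xi> i < of_int (\<gamma> i) + 1} \<in> sets \<sigma>"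
    proof (rule sets.sets_Collect_finite_All')
      fix i
      show "{\<xi> \<in> space \<sigma>. of_int (\<gamma> i) \<le> real k * \<xi> i \<and> real k * \<xi> i < of_int (\<gamma> i) + 1} \<in> sets \<sigma>"
        by measurable
    qed (simp_all add: lessThan_empty_iff)
    then show ?thesis by (simp add: floor_eq_iff Ball_def)
  qed
  finally show ?thesis .
qed

lemma finite_cells: "finite (cell_index k ` space \<sigma>)"
proof (rule finite_subset)
  show "cell_index k ` space \<sigma> \<subseteq> {f. \<forall>i. (i \<in> {..<Suc m} \<longrightarrow> f i \<in> {- int k..int k}) \<and> (i \<notin> {..<Suc m} \<longrightarrow> f i = 0)}"
  proof (safe, goal_cases)
    case (1 \<xi>' \<xi> i)
    then have "\<bar>\<xi> i\<bar> \<le> 1" using abs_le_nrm[of i "Suc m" \<xi>] nrm_sphere[of \<xi>] by simp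
    then have "real k * \<xi> i \<le> real k * 1" "real k * (- 1) \<le> real k * \<xi> i"
      by (intro mult_left_mono; simp add: abs_le_iff)+
    then show ?case using 1 by (auto simp: cell_index_def le_floor_iff floor_le_iff)
  qed (auto simp: cell_index_def split: if_splits)
  show "finite {f. \<forall>i. (i \<in> {..<Suc m} \<longrightarrow> f i \<in> {- int k..int k}) \<and> (i \<notin> {..<Suc m} \<longrightarrow> f i = 0)}"
    by (rule finite_set_of_finite_funs) auto
qed

lemma nrm_diff_cell:
  assumes "\<xi> \<in> cell k \<gamma>" "\<eta> \<in> cell k \<gamma>" "k > 0"
  shows "nrm (Suc m) (\<xi> - \<eta>) \<le> real (Suc m) / real k"
proof -
  have "\<bar>\<xi> i - \<eta> i\<bar> \<le> 1 / real k" if "i < Suc m" for i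
  proof -
    have "\<lfloor>real k * \<xi> i\<rfloor> = \<lfloor>real k * \<eta> i\<rfloor>"
      using assms that unfolding cell_def cell_index_def by (auto dest!: fun_cong[of _ _ i] split: if_splits)
    then have "\<bar>real k * \<xi> i - real k * \<eta> i\<bar> \<le> 1" by linarith
    then have "real k * \<bar>\<xi> i - \<eta> i\<bar> \<le> 1" by (simp add: abs_mult flip: right_diff_distrib)
    then show ?thesis using \<open>k > 0\<close> by (simp add: pos_le_divide_eq mult.commute)
  qed
  then have "(\<Sum>i<Suc m. \<bar>(\<xi> - \<eta>) i\<bar>) \<le> (\<Sum>i<Suc m. 1 / real k)"
    by (intro sum_mono) auto
  then show ?thesis
    using L2_set_le_sum_abs[of "\<xi> - \<eta>" "{..<Suc m}"] unfolding nrm_L2 by simp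
qed

text \<open>The weights are the measures of the cells. The node of each cell is taken from
  \<open>mean_value_point\<close> for \<open>\<phi>\<close>, hence the one-sided bound; for the
  functions \<open>\<bar>ip n \<xi> x\<bar>\<close>, which are Lipschitz in \<xi>, any node of a
  small cell works.\<close>

lemma quadrature:
  fixes \<phi> :: "vec \<Rightarrow> real"
  assumes \<phi>: "integrable \<sigma> \<phi>" and \<delta>: "\<delta> > 0"
  obtains l where "generators m l" "(\<integral>\<xi>. \<phi> \<xi> \<partial>\<sigma>) \<le> (\<Sum>(s, \<xi>)\<leftarrow>l. s * \<phi> \<xi>)" "(\<Sum>(s, \<xi>)\<leftarrow>l. s) = 1"
    "\<And>x. x \<in> Rn (Suc m) \<Longrightarrow> \<bar>zonotope_supp (Suc m) l x - \<kappa> / 2 * nrm (Suc m) x\<bar> \<le> \<delta> * nrm (Suc m) x"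
proof -
  \<comment> \<open>So fine a grid that every cell has diameter at most \<delta>.\<close>
  obtain k :: nat where "real (Suc m) / \<delta> < real k" using reals_Archimedean2 by blast
  then have k: "k > 0" "real (Suc m) / real k \<le> \<delta>"
  proof -
    have "0 < real (Suc m) / \<delta>" using \<delta> by simp
    then show "k > 0" using \<open>real (Suc m) / \<delta> < real k\<close> by (cases k) auto
    then show "real (Suc m) / real k \<le> \<delta>"
      using \<open>real (Suc m) / \<delta> < real k\<close> \<delta> by (simp add: field_simps)
  qed
  define C where "C = cell_index k ` space \<sigma>"
  have fC: "finite C" unfolding C_def by (rule finite_cells)
  have "\<exists>\<xi>\<in>cell k \<gamma>. (\<integral>\<eta>. indicator (cell k \<gamma>) \<eta> * \<phi> \<eta> \<partial>\<sigma>) \<le> prob (cell k \<gamma>) * \<phi> \<xi>" if "\<gamma> \<in> C" for \<gamma>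
    using that by (intro mean_value_point[OF \<phi> sets_cell]) (auto simp: C_def cell_def)
  then obtain c where c: "\<And>\<gamma>. \<gamma> \<in> C \<Longrightarrow> c \<gamma> \<in> cell k \<gamma>"
    "\<And>\<gamma>. \<gamma> \<in> C \<Longrightarrow> (\<integral>\<eta>. indicator (cell k \<gamma>) \<eta> * \<phi> \<eta> \<partial>\<sigma>) \<le> prob (cell k \<gamma>) * \<phi> (c \<gamma>)"
    by metis
  obtain gs where gs: "set gs = C" "distinct gs" using finite_distinct_list[OF fC] by blast
  define l where "l = map (\<lambda>\<gamma>. (prob (cell k \<gamma>), c \<gamma>)) gs"
  have sum_l: "(\<Sum>(s, \<xi>)\<leftarrow>l. f s \<xi>) = (\<Sum>\<gamma>\<in>C. f (prob (cell k \<gamma>)) (c \<gamma>))" for f :: "real \<Rightarrow> vec \<Rightarrow> real"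
    unfolding l_def using gs by (simp add: comp_def sum_list_distinct_conv_sum_set)
  have part: "f \<eta> = (\<Sum>\<gamma>\<in>C. indicator (cell k \<gamma>) \<eta> * f \<eta>)" if "\<eta> \<in> space \<sigma>" for f :: "vec \<Rightarrow> real" and \<eta>
  proof -
    have "(\<Sum>\<gamma>\<in>C. indicator (cell k \<gamma>) \<eta> * f \<eta>) = (\<Sum>\<gamma>\<in>C. if \<gamma> = cell_index k \<eta> then f \<eta> else 0)"
      using that by (intro sum.cong) (auto simp: cell_def indicator_def)
    also have "\<dots> = f \<eta>" using that fC by (simp add: C_def)
    finally show ?thesis by simp
  qed
  have split: "(\<integral>\<eta>. f \<eta> \<partial>\<sigma>) = (\<Sum>\<gamma>\<in>C. \<integral>\<eta>. indicator (cell k \<gamma>) \<eta> * f \<eta> \<partial>\<sigma>)"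
    if f: "integrable \<sigma> f" for f :: "vec \<Rightarrow> real"
  proof -
    have "(\<integral>\<eta>. f \<eta> \<partial>\<sigma>) = (\<integral>\<eta>. (\<Sum>\<gamma>\<in>C. indicator (cell k \<gamma>) \<eta> * f \<eta>) \<partial>\<sigma>)"
      by (intro Bochner_Integration.integral_cong refl part)
    also have "\<dots> = (\<Sum>\<gamma>\<in>C. \<integral>\<eta>. indicator (cell k \<gamma>) \<eta> * f \<eta> \<partial>\<sigma>)"
      using integrable_mult_indicator[OF sets_cell f] by (intro Bochner_Integration.integral_sum) simp
    finally show ?thesis .
  qed
  show ?thesis
  proof (rule that[of l])
    show "generators m l" using c(1) gs(1) by (auto simp: generators_def l_def cell_def space_\<sigma>)
    show "(\<integral>\<xi>. \<phi> \<xi> \<partial>\<sigma>) \<le> (\<Sum>(s, \<xi>)\<leftarrow>l. s * \<phi> \<xi>)"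
      unfolding sum_l split[OF \<phi>] using c(2) by (intro sum_mono)
    show "(\<Sum>(s, \<xi>)\<leftarrow>l. s) = 1"
      unfolding sum_l using split[of "\<lambda>_. 1"] sets_cell by (simp add: prob_space)
    fix x assume x: "x \<in> Rn (Suc m)"
    let ?f = "\<lambda>\<xi>. \<bar>ip (Suc m) \<xi> x\<bar>" and ?n = "nrm (Suc m) x"
    have ind: "integrable \<sigma> (indicator (cell k \<gamma>) :: vec \<Rightarrow> real)" for \<gamma>
      using sets_cell by (simp add: integrable_real_indicator emeasure_eq_measure)
    have indf: "integrable \<sigma> (\<lambda>\<eta>. indicator (cell k \<gamma>) \<eta> * ?f \<eta>)" for \<gamma>
      using integrable_mult_indicator[OF sets_cell integrable_ip] by simp
    have cellwise: "\<bar>prob (cell k \<gamma>) * ?f (c \<gamma>) - (\<integral>\<eta>. indicator (cell k \<gamma>) \<eta> * ?f \<eta> \<partial>\<sigma>)\<bar>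
        \<le> prob (cell k \<gamma>) * (\<delta> * ?n)" if "\<gamma> \<in> C" for \<gamma>
    proof -
      have eq: "prob (cell k \<gamma>) * ?f (c \<gamma>) - (\<integral>\<eta>. indicator (cell k \<gamma>) \<eta> * ?f \<eta> \<partial>\<sigma>)
          = (\<integral>\<eta>. indicator (cell k \<gamma>) \<eta> * ?f (c \<gamma>) - indicator (cell k \<gamma>) \<eta> * ?f \<eta> \<partial>\<sigma>)"
        using ind indf sets_cell by (subst Bochner_Integration.integral_diff) auto
      have "\<bar>prob (cell k \<gamma>) * ?f (c \<gamma>) - (\<integral>\<eta>. indicator (cell k \<gamma>) \<eta> * ?f \<eta> \<partial>\<sigma>)\<bar> \<le> (\<integral>\<eta>. \<bar>indicator (cell k \<gamma>) \<eta> * ?f (c \<gamma>) - indicator (cell k \<gamma>) \<eta> * ?f \<eta>\<bar> \<partial>\<sigma>)"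
        unfolding eq by (rule integral_abs_bound)
      also have "\<dots> \<le> (\<integral>\<eta>. indicator (cell k \<gamma>) \<eta> * (\<delta> * ?n) \<partial>\<sigma>)"
      proof (rule integral_mono)
        fix \<eta> :: vec
        show "\<bar>indicator (cell k \<gamma>) \<eta> * ?f (c \<gamma>) - indicator (cell k \<gamma>) \<eta> * ?f \<eta>\<bar>
            \<le> indicator (cell k \<gamma>) \<eta> * (\<delta> * ?n)"
        proof (cases "\<eta> \<in> cell k \<gamma>")
          case True
          have "\<bar>?f (c \<gamma>) - ?f \<eta>\<bar> \<le> \<bar>ip (Suc m) (c \<gamma> - \<eta>) x\<bar>"
            unfolding ip_diff_left by (rule abs_triangle_ineq3)
          also have "\<dots> \<le> nrm (Suc m) (c \<gamma> - \<eta>) * ?n" by (rule ip_abs_le)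
          also have "\<dots> \<le> \<delta> * ?n"
            using nrm_diff_cell[OF c(1)[OF that] True k(1)] k(2) by (intro mult_right_mono) auto
          finally show ?thesis using True by simp
        qed simp
        show "integrable \<sigma> (\<lambda>\<eta>. \<bar>indicator (cell k \<gamma>) \<eta> * ?f (c \<gamma>) - indicator (cell k \<gamma>) \<eta> * ?f \<eta>\<bar>)"
          by (intro integrable_abs Bochner_Integration.integrable_diff integrable_mult_left ind indf)
        show "integrable \<sigma> (\<lambda>\<eta>. indicator (cell k \<gamma>) \<eta> * (\<delta> * ?n))"
          by (intro integrable_mult_left ind)
      qed
      also have "\<dots> = prob (cell k \<gamma>) * (\<delta> * ?n)" using sets_cell by simp
      finally show ?thesis .
    qed
    have "\<bar>(\<Sum>\<gamma>\<in>C. prob (cell k \<gamma>) * ?f (c \<gamma>)) - (\<integral>\<eta>. ?f \<eta> \<partial>\<sigma>)\<bar>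
        = \<bar>\<Sum>\<gamma>\<in>C. prob (cell k \<gamma>) * ?f (c \<gamma>) - (\<integral>\<eta>. indicator (cell k \<gamma>) \<eta> * ?f \<eta> \<partial>\<sigma>)\<bar>"
      by (simp add: split[OF integrable_ip] sum_subtractf)
    also have "\<dots> \<le> (\<Sum>\<gamma>\<in>C. prob (cell k \<gamma>) * (\<delta> * ?n))"
      using cellwise by (intro order_trans[OF sum_abs] sum_mono)
    also have "\<dots> = (\<Sum>\<gamma>\<in>C. prob (cell k \<gamma>)) * (\<delta> * ?n)" by (simp only: sum_distrib_right)
    also have "(\<Sum>\<gamma>\<in>C. prob (cell k \<gamma>)) = 1"
      using split[of "\<lambda>_. 1"] sets_cell by (simp add: prob_space)
    finally have *: "\<bar>(\<Sum>\<gamma>\<in>C. prob (cell k \<gamma>) * ?f (c \<gamma>)) - \<kappa> * ?n\<bar> \<le> \<delta> * ?n"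
      unfolding integral_ip[OF x] by simp
    have "zonotope_supp (Suc m) l x = (\<Sum>\<gamma>\<in>C. prob (cell k \<gamma>) * ?f (c \<gamma>)) / 2"
      unfolding zonotope_supp_def sum_l ..
    \<comment> \<open>The support function carries a factor 1/2, so the error is in fact only half
      of what is claimed.\<close>
    moreover have "0 \<le> \<delta> * ?n" using \<delta> by simp
    ultimately show "\<bar>zonotope_supp (Suc m) l x - \<kappa> / 2 * ?n\<bar> \<le> \<delta> * ?n"
      using * unfolding abs_le_iff by (simp add: field_simps)
  qed
qed

end

section \<open>Surface area\<close>

lemma ball_Rn_zero: "ball_Rn n 0 = {0}"
proof (rule set_eqI, rule iffI)
  fix x assume "x \<in> ball_Rn n 0"
  then have "nrm n x = 0" "x \<in> Rn n" using nrm_nonneg[of n x] by (auto simp: ball_Rn_def simp del: topspace_Euclidean_space)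
  then have "x = 0" by (rule nrm_eq_0)
  then show "x \<in> {0}" by simp
next
  fix x :: vec assume "x \<in> {0}"
  then have "x = 0" by simp
  then show "x \<in> ball_Rn n 0" unfolding ball_Rn_def nrm_def by (simp only: mem_Collect_eq ip_zero Rn_zero) simp
qed

lemma add_ball_Rn_zero: "A + ball_Rn n 0 = A"
  unfolding ball_Rn_zero by (rule set_add_0_right)

lemma scl_ball_Rn:
  assumes "t \<ge> 0" "r \<ge> 0"
  shows "scl t ` ball_Rn n r = ball_Rn n (t * r)"
proof -
  have "scl t ` ball_Rn n r = scl (t * r) ` unit_ball n"
    unfolding scl_unit_ball[OF assms(2), symmetric] image_image scl_scl ..
  then show ?thesis using assms by (simp only: scl_unit_ball mult_nonneg_nonneg)
qed

lemma zero_in_ball_Rn: "r \<ge> 0 \<Longrightarrow> 0 \<in> ball_Rn n r"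
  unfolding ball_Rn_def nrm_def by (simp only: mem_Collect_eq ip_zero Rn_zero) simp

lemma ball_Rn_mono: "r \<le> s \<Longrightarrow> ball_Rn n r \<subseteq> ball_Rn n s"
  by (auto simp: ball_Rn_def)

lemma tendsto_at_right_Sup:
  fixes q :: "real \<Rightarrow> real"
  assumes anti: "\<And>s t. 0 < s \<Longrightarrow> s \<le> t \<Longrightarrow> q t \<le> q s" and bdd: "\<And>t. 0 < t \<Longrightarrow> q t \<le> C"
  shows "\<exists>S. (q \<longlongrightarrow> S) (at_right 0)"
proof
  let ?S = "Sup (q ` {0<..})"
  have b: "bdd_above (q ` {0<..})" using bdd by (auto intro!: bdd_aboveI)
  show "(q \<longlongrightarrow> ?S) (at_right 0)"
  proof (rule order_tendstoI)
    fix a assume "a < ?S"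
    then obtain t where t: "0 < t" "a < q t" using less_cSup_iff[OF _ b, of a] by auto
    then show "eventually (\<lambda>x. a < q x) (at_right 0)"
      unfolding eventually_at_right_field
      by (intro exI[of _ t]) (auto intro!: less_le_trans[OF t(2) anti])
  next
    fix a assume "?S < a"
    then have "q t < a" if "0 < t" for t
      using cSup_upper[OF _ b, of "q t"] that by auto
    then show "eventually (\<lambda>x. q x < a) (at_right 0)"
      unfolding eventually_at_right_field by (intro exI[of _ 1]) auto
  qed
qed

lemma has_right_derivative_iff:
  fixes f :: "real \<Rightarrow> real"
  shows "(f has_field_derivative D) (at_right 0) \<longleftrightarrow> ((\<lambda>t. (f t - f 0) / t) \<longlongrightarrow> D) (at_right 0)"
  by (simp add: has_field_derivative_iff)

text \<open>With a remainder of order three, division by the square leaves only the coefficient of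
  the quadratic term in the limit.\<close>

lemma one_plus_power_le:
  "\<exists>C. \<forall>x\<in>{0..1::real}. (1 + x) ^ n \<le> 1 + real n * x + real n * (real n - 1) / 2 * x\<^sup>2 + C * x ^ 3"
proof (induction n)
  case 0
  show ?case by (intro exI[of _ 0]) simp
next
  case (Suc n)
  then obtain C where C: "\<forall>x\<in>{0..1}. (1 + x) ^ n \<le> 1 + real n * x + real n * (real n - 1) / 2 * x\<^sup>2 + C * x ^ 3"
    by blast
  show ?case
  proof (intro exI[of _ "2 * \<bar>C\<bar> + \<bar>real n * (real n - 1) / 2\<bar>"] ballI)
    fix x :: real assume x: "x \<in> {0..1}"
    define c where "c = real n * (real n - 1) / 2"
    have "(1 + x) ^ Suc n \<le> (1 + x) * (1 + real n * x + c * x\<^sup>2 + C * x ^ 3)"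
      unfolding power_Suc c_def using bspec[OF C x] x by (intro mult_left_mono) auto
    also have "\<dots> = 1 + real (Suc n) * x + (c + real n) * x\<^sup>2 + (C + c + C * x) * x ^ 3"
      by (simp add: algebra_simps power2_eq_square power3_eq_cube)
    also have "\<dots> \<le> 1 + real (Suc n) * x + (c + real n) * x\<^sup>2 + (2 * \<bar>C\<bar> + \<bar>c\<bar>) * x ^ 3"
    proof (intro add_left_mono mult_right_mono)
      have "C * x \<le> \<bar>C\<bar> * 1" using x by (intro mult_mono) auto
      then show "C + c + C * x \<le> 2 * \<bar>C\<bar> + \<bar>c\<bar>" by linarith
    qed (use x in auto)
    also have "c + real n = real (Suc n) * (real (Suc n) - 1) / 2"
      by (simp add: c_def field_simps)
    finally show "(1 + x) ^ Suc n \<le> 1 + real (Suc n) * x + real (Suc n) * (real (Suc n) - 1) / 2 * x\<^sup>2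
        + (2 * \<bar>C\<bar> + \<bar>real n * (real n - 1) / 2\<bar>) * x ^ 3"
      unfolding c_def .
  qed
qed

text \<open>The best choice is \<open>\<tau> = a / b\<close>. When \<open>a\<close> or
  \<open>b\<close> is 0 the infimum is only approached, for small or for large
  \<open>\<tau>\<close>, and \<open>x \<le> 0\<close> is shown by contradiction.\<close>

lemma le_4_mult_if_quadratic:
  fixes a b c x :: real
  assumes "\<And>\<tau>. \<tau> > 0 \<Longrightarrow> \<tau> * x \<le> c * (a + \<tau> * b)\<^sup>2" "a \<ge> 0" "b \<ge> 0" "c \<ge> 0"
  shows "x \<le> 4 * c * a * b"
proof -
  consider "a = 0" | "b = 0" | "a > 0" "b > 0" using assms by linarith
  then show ?thesis
  proof cases
    case 1
    have "x \<le> 0"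
    proof (rule ccontr)
      assume x: "\<not> x \<le> 0"
      \<comment> \<open>Small enough to push the quadratic bound down to \<open>x / 2\<close>; the
        summand 1 keeps the denominator positive.\<close>
      define l where "l = x / (2 * (c * b\<^sup>2 + 1))"
      have p: "c * b\<^sup>2 + 1 > 0" using assms by (simp add: add_nonneg_pos)
      then have l: "l > 0" using x by (simp add: l_def)
      have "l * x \<le> l * (l * (c * b\<^sup>2))" using assms(1)[OF l] 1 by (simp add: power2_eq_square algebra_simps)
      then have "x \<le> l * (c * b\<^sup>2)" using l by (simp only: mult_le_cancel_left_pos)
      also have "\<dots> \<le> l * (c * b\<^sup>2 + 1)" using l by simp
      also have "\<dots> = x / 2"
      proof -
        have "x / (2 * q) * q = x / 2" if "q > 0" for q :: real using that by simp
        from this[OF p] show ?thesis by (simp only: l_def)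
      qed
      finally show False using x by simp
    qed
    then show ?thesis using 1 by simp
  next
    case 2
    have "x \<le> 0"
    proof (rule ccontr)
      assume x: "\<not> x \<le> 0"
      \<comment> \<open>This value makes the left-hand side exceed the constant right-hand side by
        1.\<close>
      have "(c * a\<^sup>2 + 1) / x > 0" using x assms by (simp add: add_nonneg_pos)
      from assms(1)[OF this] have "c * a\<^sup>2 + 1 \<le> c * a\<^sup>2" using 2 x by simp
      then show False by simp
    qed
    then show ?thesis using 2 by simp
  next
    case 3
    then have "a / b > 0" by simp
    from assms(1)[OF this] have "a / b * x \<le> c * (2 * a)\<^sup>2" using 3 by simp
    then have "a * x \<le> a * (4 * c * a * b)" using 3 by (simp add: field_simps power2_eq_square)
    then show ?thesis using 3 by (simp only: mult_le_cancel_left_pos)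
  qed
qed

text \<open>Concavity along the body dilated by \<open>t\<close>, with weight \<open>s / t\<close>:
  slopes of secants through 0 decrease.\<close>

lemma root_vol_concave_scaled:
  assumes K: "conv_cpt n K" "vol n K > 0" and C: "conv_cpt n C" "0 \<in> C" and n: "n > 0" and st: "0 < s" "s \<le> t"
  shows "(root n (vol n (K + scl t ` C)) - root n (vol n K)) / t \<le> (root n (vol n (K + scl s ` C)) - root n (vol n K)) / s"
proof -
  have "0 \<in> scl t ` C" using C(2) by (rule rev_image_eqI) (simp add: fun_eq_iff)
  moreover have "scl (s / t) ` scl t ` C = scl s ` C" using st by (simp add: image_image)
  ultimately have "(1 - s / t) * root n (vol n K) + s / t * root n (vol n (K + scl t ` C)) \<le> root n (vol n (K + scl s ` C))"
    using root_vol_concave[OF K conv_cpt_scl[OF C(1), of t] _ n, of "s / t"] st by simp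
  then show ?thesis using st by (simp add: field_simps)
qed

text \<open>The root of the volume is concave along the dilates of \<open>C\<close>, so it lies
  below its tangent at 0, whose slope comes from \<open>D\<close> by the chain rule; then the
  \<open>n\<close>-th power is taken.\<close>

lemma vol_le_tangent_power:
  assumes K: "conv_cpt n K" "vol n K > 0" and C: "conv_cpt n C" "0 \<in> C" and n: "n > 0" and t: "t > 0"
    and D: "((\<lambda>t. (vol n (K + scl t ` C) - vol n K) / t) \<longlongrightarrow> D) (at_right 0)"
  shows "vol n (K + scl t ` C) \<le> vol n K * (1 + t * D / (n * vol n K)) ^ n"
proof -
  define F where "F = (\<lambda>t. vol n (K + scl t ` C))"
  define h where "h = root n (vol n K)"
  have h: "h > 0" "h ^ n = vol n K" using K n by (auto simp: h_def)
  have "scl 0 ` C = {0}" using C(2) by (auto simp: image_iff fun_eq_iff)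
  then have F0: "F 0 = vol n K" by (simp add: F_def)
  have "(F has_field_derivative D) (at_right 0)"
    unfolding has_right_derivative_iff F0 using D by (simp add: F_def)
  then have "((\<lambda>t. root n (F t)) has_field_derivative inverse (real n * h ^ (n - Suc 0)) * D) (at_right 0)"
    using DERIV_real_root[of n "F 0"] K n unfolding h_def F0[symmetric] by (intro DERIV_chain2) auto
  then have lim: "((\<lambda>s. (root n (F s) - h) / s) \<longlongrightarrow> inverse (real n * h ^ (n - Suc 0)) * D) (at_right 0)"
    unfolding has_right_derivative_iff F0 h_def .
  have "eventually (\<lambda>s. (root n (F t) - h) / t \<le> (root n (F s) - h) / s) (at_right 0)"
    unfolding eventually_at_right_field F_def h_def
    using t root_vol_concave_scaled[OF K C n] by (intro exI[of _ t]) auto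
  then have "(root n (F t) - h) / t \<le> inverse (real n * h ^ (n - Suc 0)) * D"
    by (rule tendsto_lowerbound[OF lim]) simp
  then have "root n (F t) \<le> h + t * (inverse (real n * h ^ (n - Suc 0)) * D)"
    using t by (simp add: field_simps)
  also have "inverse (real n * h ^ (n - Suc 0)) = h / (real n * vol n K)"
  proof -
    define P where "P = h ^ (n - Suc 0)"
    have vK: "vol n K = h * P" unfolding h(2)[symmetric] P_def using n by (cases n) auto
    show ?thesis unfolding vK P_def[symmetric] using h(1) n by (simp add: inverse_eq_divide)
  qed
  also have "h + t * (h / (real n * vol n K) * D) = h * (1 + t * D / (n * vol n K))"
    by (simp add: algebra_simps)
  finally have "root n (F t) ^ n \<le> (h * (1 + t * D / (n * vol n K))) ^ n"
    using n by (intro power_mono) (auto simp: F_def)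
  then show ?thesis using n h by (simp add: F_def power_mult_distrib)
qed

context sphere_measure
begin

abbreviation "n \<equiv> Suc m"

lemma zonotope_approx:
  assumes \<delta>: "0 < \<delta>" "\<delta> < \<kappa> / 2" and \<phi>: "integrable \<sigma> \<phi>"
  obtains l where "generators m l" "(\<integral>\<xi>. \<phi> \<xi> \<partial>\<sigma>) \<le> (\<Sum>(s, \<xi>)\<leftarrow>l. s * \<phi> \<xi>)" "(\<Sum>(s, \<xi>)\<leftarrow>l. s) = 1"
    "ball_Rn n (\<kappa> / 2 - \<delta>) \<subseteq> zonotope l" "zonotope l \<subseteq> ball_Rn n (\<kappa> / 2 + \<delta>)"
proof -
  obtain l where l: "generators m l" "(\<integral>\<xi>. \<phi> \<xi> \<partial>\<sigma>) \<le> (\<Sum>(s, \<xi>)\<leftarrow>l. s * \<phi> \<xi>)" "(\<Sum>(s, \<xi>)\<leftarrow>l. s) = 1"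
    "\<And>x. x \<in> Rn n \<Longrightarrow> \<bar>zonotope_supp n l x - \<kappa> / 2 * nrm n x\<bar> \<le> \<delta> * nrm n x"
    using quadrature[OF \<phi> \<delta>(1)] by blast
  have "(\<kappa> / 2 - \<delta>) * nrm n x \<le> zonotope_supp n l x" "zonotope_supp n l x \<le> (\<kappa> / 2 + \<delta>) * nrm n x"
    if "x \<in> Rn n" for x
    using l(4)[OF that] unfolding abs_le_iff left_diff_distrib distrib_right by linarith+
  then show ?thesis
    using \<delta> by (intro that[of l] l ball_Rn_subset_zonotope zonotope_subset_ball_Rn) auto
qed

lemma zonotope_approx_unit_ball:
  assumes r: "0 < r" "r < 1"
  obtains l where "generators m l" "ball_Rn n r \<subseteq> zonotope l" "zonotope l \<subseteq> ball_Rn n 1"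
proof -
  \<comment> \<open>The solution of
    \<open>(\<kappa> / 2 - \<delta>) / (\<kappa> / 2 + \<delta>) = r\<close>: after dilation by
    \<open>c\<close> the outer radius is 1 and the inner one \<open>r\<close>.\<close>
  define \<delta> where "\<delta> = \<kappa> / 2 * ((1 - r) / (1 + r))"
  have "(1 - r) / (1 + r) < 1" using r by simp
  then have \<delta>: "0 < \<delta>" "\<delta> < \<kappa> / 2"
    using r \<kappa>_pos mult_strict_left_mono[of "(1 - r) / (1 + r)" 1 "\<kappa> / 2"] by (auto simp: \<delta>_def)
  obtain l where l: "generators m l" "ball_Rn n (\<kappa> / 2 - \<delta>) \<subseteq> zonotope l" "zonotope l \<subseteq> ball_Rn n (\<kappa> / 2 + \<delta>)"
    using zonotope_approx[OF \<delta> integrable_zero] by metis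
  define c where "c = 1 / (\<kappa> / 2 + \<delta>)"
  have c: "c > 0" using \<delta> \<kappa>_pos by (simp add: c_def)
  have "\<kappa> / 2 + \<delta> = \<kappa> / (1 + r)" "\<kappa> / 2 - \<delta> = \<kappa> * r / (1 + r)"
    using r by (simp_all add: \<delta>_def field_simps)
  then have cr: "c * (\<kappa> / 2 - \<delta>) = r" "c * (\<kappa> / 2 + \<delta>) = 1"
    using r \<kappa>_pos by (simp_all add: c_def)
  have "scl c ` ball_Rn n (\<kappa> / 2 - \<delta>) \<subseteq> scl c ` zonotope l" "scl c ` zonotope l \<subseteq> scl c ` ball_Rn n (\<kappa> / 2 + \<delta>)"
    using l by (simp_all add: image_mono)
  then have "ball_Rn n r \<subseteq> scl c ` zonotope l" "scl c ` zonotope l \<subseteq> ball_Rn n 1"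
    using c \<delta> by (simp_all add: scl_ball_Rn cr)
  then show ?thesis
    unfolding scl_zonotope using generators_scale[OF l(1), of c] c by (intro that) simp_all
qed

section \<open>The volume of parallel bodies near 0\<close>

abbreviation parvol :: "vec set \<Rightarrow> real \<Rightarrow> real" where
  "parvol K t \<equiv> vol n (K + ball_Rn n t)"

lemma parvol_zero: "parvol K 0 = vol n K"
  by (simp only: add_ball_Rn_zero)

lemma parvol_mono: "conv_cpt n K \<Longrightarrow> s \<le> t \<Longrightarrow> parvol K s \<le> parvol K t"
  by (intro vol_mono cpt_add cpt_ball_Rn conv_cpt_cpt set_plus_mono2 order_refl ball_Rn_mono)

text \<open>A zonotope between the balls of radii \<open>r\<close> and 1 replaces the ball: its
  \<open>N\<close>-fold growth is controlled by \<open>vol_add_zonotope_multiple\<close>, and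
  \<open>r\<close> is the price of the inner inclusion.\<close>

lemma parvol_superlinear:
  assumes K: "conv_cpt n K" and r: "0 < r" "r < 1" and t: "t \<ge> 0" and N: "N > 0"
  shows "real N * (parvol K (r * (t / N)) - vol n K) \<le> parvol K t - vol n K"
proof -
  obtain l where l: "generators m l" "ball_Rn n r \<subseteq> zonotope l" "zonotope l \<subseteq> ball_Rn n 1"
    using zonotope_approx_unit_ball[OF r] by blast
  define l' where "l' = map (\<lambda>(s, \<xi>). (t / N * s, \<xi>)) l"
  have l': "generators m l'" "zonotope l' = scl (t / N) ` zonotope l"
    unfolding l'_def scl_zonotope using generators_scale[OF l(1), of "t / N"] t by simp_all
  have tN: "t / N \<ge> 0" using t by simp
  have "ball_Rn n (r * (t / N)) = scl (t / N) ` ball_Rn n r"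
    using scl_ball_Rn[OF tN, of r n] r by (simp add: mult.commute)
  also have "\<dots> \<subseteq> zonotope l'" unfolding l' using l(2) by (rule image_mono)
  finally have 1: "parvol K (r * (t / N)) \<le> vol n (K + zonotope l')"
    using K conv_cpt_zonotope[OF l'(1)] by (intro vol_mono cpt_add cpt_ball_Rn conv_cpt_cpt set_plus_mono2 order_refl)
  have "scl (real N) ` zonotope l' = scl t ` zonotope l" unfolding l' using N by (simp add: image_image)
  also have "\<dots> \<subseteq> scl t ` ball_Rn n 1" using l(3) by (rule image_mono)
  also have "\<dots> = ball_Rn n t" using scl_ball_Rn[OF t, of 1 n] by simp
  finally have 2: "vol n (K + scl (real N) ` zonotope l') \<le> parvol K t"
    using K conv_cpt_zonotope[OF l'(1)]
    by (intro vol_mono cpt_add cpt_ball_Rn conv_cpt_cpt conv_cpt_scl set_plus_mono2 order_refl)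
  have "real N * (parvol K (r * (t / N)) - vol n K) \<le> real N * (vol n (K + zonotope l') - vol n K)"
    using 1 by (intro mult_left_mono) auto
  also have "\<dots> \<le> vol n (K + scl (real N) ` zonotope l') - vol n K"
    by (rule vol_add_zonotope_multiple[OF l'(1) K])
  finally show ?thesis using 2 by linarith
qed

text \<open>Bounds the difference quotients near 0 uniformly, from one comparison with radius
  1.\<close>

lemma parvol_linear_bound:
  assumes K: "conv_cpt n K" and t: "0 < t" "t \<le> 1 / 2"
  shows "parvol K t - vol n K \<le> 4 * t * (parvol K 1 - vol n K)"
proof -
  \<comment> \<open>The largest \<open>N\<close> for which \<open>t\<close> is at most
    \<open>1 / 2 * (1 / N)\<close>, so that \<open>parvol_superlinear\<close> applies with
    \<open>r = 1 / 2\<close>; rounding down costs at most a factor 2.\<close>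
  define N where "N = nat \<lfloor>1 / (2 * t)\<rfloor>"
  have ge1: "1 \<le> 1 / (2 * t)" using t by (simp add: field_simps)
  then have f1: "\<lfloor>1 / (2 * t)\<rfloor> \<ge> 1" by (simp add: le_floor_iff)
  then have N: "N > 0" "real N = of_int \<lfloor>1 / (2 * t)\<rfloor>"
    unfolding N_def by (linarith, intro of_nat_nat, linarith)
  have N1: "real N \<le> 1 / (2 * t)" "1 / (2 * t) \<le> 2 * real N"
    using f1 unfolding N(2) by linarith+
  have "t \<le> 1 / 2 * (1 / real N)" using N1(1) N(1) t by (simp add: field_simps)
  then have "parvol K t \<le> parvol K (1 / 2 * (1 / real N))" by (rule parvol_mono[OF K])
  moreover have "real N * (parvol K (1 / 2 * (1 / real N)) - vol n K) \<le> parvol K 1 - vol n K"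
    by (rule parvol_superlinear[OF K]) (use N in auto)
  ultimately have *: "real N * (parvol K t - vol n K) \<le> parvol K 1 - vol n K"
    using N(1) by (smt (verit) mult_left_mono of_nat_0_le_iff)
  have "parvol K t \<ge> vol n K" using parvol_mono[OF K, of 0 t] t by (simp only: parvol_zero)
  then have "1 / (2 * t) * (parvol K t - vol n K) \<le> 2 * real N * (parvol K t - vol n K)"
    using N1(2) by (intro mult_right_mono) auto
  also have "\<dots> \<le> 2 * (parvol K 1 - vol n K)" using * by simp
  finally show ?thesis using t by (simp add: field_simps)
qed

lemma scl_unit_ball_Rn: "t \<ge> 0 \<Longrightarrow> scl t ` ball_Rn n 1 = ball_Rn n t"
  using scl_ball_Rn[of t 1 n] by simp

text \<open>The quotients of the root \<open>H\<close> increase as \<open>t\<close> decreases to 0,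
  and the linear bound for the volume bounds them; so \<open>H\<close> has a right derivative, and
  then so does its \<open>n\<close>-th power.\<close>

lemma parvol_right_derivative:
  assumes K: "conv_cpt n K" "vol n K > 0"
  shows "\<exists>D. ((\<lambda>t. (parvol K t - vol n K) / t) \<longlongrightarrow> D) (at_right 0)"
proof -
  define H where "H = (\<lambda>t. root n (parvol K t))"
  define C where "C = 4 * (parvol K 1 - vol n K) / H 0 ^ m"
  have Hn: "H t ^ n = parvol K t" for t
    unfolding H_def by (rule real_root_pow_pos2) auto
  have H0: "H 0 > 0" "H 0 ^ n = vol n K"
    using Hn[of 0] K by (auto simp only: H_def parvol_zero real_root_gt_0_iff zero_less_Suc)
  have Hmono: "H 0 \<le> H t" if "t \<ge> 0" for t
    unfolding H_def using parvol_mono[OF K(1) that] by simp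
  have anti: "(H t - H 0) / t \<le> (H s - H 0) / s" if "0 < s" "s \<le> t" for s t
    using root_vol_concave_scaled[OF K conv_cpt_ball_Rn[of n 1] zero_in_ball_Rn, of s t] that
    unfolding H_def parvol_zero by (simp add: scl_unit_ball_Rn)
  have bnd: "(H t - H 0) / t \<le> C" if t: "0 < t" "t \<le> 1 / 2" for t
  proof -
    \<comment> \<open>Transfers the bound from the volume to its root, by
      \<open>H 0 \<le> H t\<close>.\<close>
    have "H 0 ^ m * (H t - H 0) \<le> H t ^ n - H 0 ^ n"
    proof -
      have "H 0 ^ m * H t \<le> H t ^ m * H t"
        using Hmono[of t] H0 t by (intro mult_right_mono power_mono) auto
      then show ?thesis by (simp add: algebra_simps)
    qed
    also have "\<dots> \<le> 4 * t * (parvol K 1 - vol n K)"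
      unfolding Hn H0(2) using parvol_linear_bound[OF K(1) t] by (simp add: parvol_zero)
    finally show ?thesis using t H0 by (simp add: C_def field_simps)
  qed
  \<comment> \<open>Quotients at larger \<open>t\<close> are at most the one at 1/2, by
    monotonicity.\<close>
  have bnd': "(H t - H 0) / t \<le> C" if "0 < t" for t
  proof (cases "t \<le> 1 / 2")
    case False
    then have "(H t - H 0) / t \<le> (H (1 / 2) - H 0) / (1 / 2)" by (intro anti) auto
    also have "\<dots> \<le> C" by (rule bnd) auto
    finally show ?thesis .
  qed (use bnd that in simp)
  obtain S where "((\<lambda>t. (H t - H 0) / t) \<longlongrightarrow> S) (at_right 0)"
    using tendsto_at_right_Sup[of "\<lambda>t. (H t - H 0) / t" C, OF anti bnd'] by blast
  then have "(H has_field_derivative S) (at_right 0)" unfolding has_right_derivative_iff .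
  from DERIV_power[OF this, of n]
  have "((\<lambda>t. parvol K t) has_field_derivative real n * (S * H 0 ^ (n - Suc 0))) (at_right 0)"
    by (simp only: Hn)
  then show ?thesis unfolding has_right_derivative_iff parvol_zero by blast
qed

definition surface :: "vec set \<Rightarrow> real" where
  "surface K = Lim (at_right 0) (\<lambda>t. (parvol K t - vol n K) / t)"

lemma surface_tendsto:
  assumes "conv_cpt n K" "vol n K > 0"
  shows "((\<lambda>t. (parvol K t - vol n K) / t) \<longlongrightarrow> surface K) (at_right 0)"
proof -
  obtain D where D: "((\<lambda>t. (parvol K t - vol n K) / t) \<longlongrightarrow> D) (at_right 0)"
    using parvol_right_derivative[OF assms] by blast
  then have "surface K = D" unfolding surface_def by (rule tendsto_Lim[OF trivial_limit_at_right_real])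
  with D show ?thesis by (simp only:)
qed

text \<open>Existence of the limit is not presupposed: functions that agree near 0 have the same
  limits, so \<open>Lim\<close> makes the same choice.\<close>

lemma Lim_at_right_cong:
  fixes f g :: "real \<Rightarrow> real"
  assumes "\<And>t. t > 0 \<Longrightarrow> f t = g t"
  shows "Lim (at_right 0) f = Lim (at_right 0) g"
proof -
  have "eventually (\<lambda>t. f t = g t) (at_right 0)"
    using assms unfolding eventually_at_right_field by (intro exI[of _ 1]) auto
  then have "(f \<longlongrightarrow> l) (at_right 0) \<longleftrightarrow> (g \<longlongrightarrow> l) (at_right 0)" for l by (rule tendsto_cong)
  then show ?thesis by (simp add: Topological_Spaces.Lim_def)
qed

lemma surface_area_eq: "surface_area n K = surface K"
  unfolding surface_area_def surface_def by (rule Lim_at_right_cong) (simp add: parallel_body_eq)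

lemma surface_nonneg:
  assumes "conv_cpt n K" "vol n K > 0"
  shows "surface K \<ge> 0"
proof (rule tendsto_lowerbound[OF surface_tendsto[OF assms]])
  have "vol n K \<le> parvol K t" if "t > 0" for t
    using parvol_mono[OF assms(1), of 0 t] that by (simp only: parvol_zero)
  then show "eventually (\<lambda>t. 0 \<le> (parvol K t - vol n K) / t) (at_right 0)"
    unfolding eventually_at_right_field by (intro exI[of _ 1]) auto
qed simp

text \<open>In \<open>parvol_superlinear\<close> with \<open>r\<close> fixed, the left-hand side
  tends to \<open>r * t * surface K\<close> as \<open>N\<close> grows; then \<open>r\<close> tends
  to 1.\<close>

lemma parvol_ge_tangent:
  assumes K: "conv_cpt n K" "vol n K > 0" and t: "t > 0"
  shows "vol n K + t * surface K \<le> parvol K t"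
proof -
  have *: "r * (t * surface K) \<le> parvol K t - vol n K" if r: "0 < r" "r < 1" for r
  proof -
    have lim: "filterlim (\<lambda>N. r * (t / real N)) (at_right 0) sequentially"
    proof (rule tendsto_imp_filterlim_at_right)
      have "(\<lambda>N. r * t * (1 / real N)) \<longlonglongrightarrow> r * t * 0"
        by (intro tendsto_mult tendsto_const lim_1_over_n)
      then show "(\<lambda>N. r * (t / real N)) \<longlonglongrightarrow> 0" by simp
      show "eventually (\<lambda>N. 0 < r * (t / real N)) sequentially"
        using eventually_gt_at_top[of "0::nat"] by eventually_elim (use r t in simp)
    qed
    have "(\<lambda>N. (parvol K (r * (t / real N)) - vol n K) / (r * (t / real N))) \<longlonglongrightarrow> surface K"
      using filterlim_compose[OF surface_tendsto[OF K] lim] .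
    then have "(\<lambda>N. r * t * ((parvol K (r * (t / real N)) - vol n K) / (r * (t / real N)))) \<longlonglongrightarrow> r * t * surface K"
      by (intro tendsto_mult tendsto_const)
    moreover have "eventually (\<lambda>N. r * t * ((parvol K (r * (t / real N)) - vol n K) / (r * (t / real N)))
        \<le> parvol K t - vol n K) sequentially"
      using eventually_gt_at_top[of "0::nat"]
    proof eventually_elim
      case (elim N)
      have "r * t * ((parvol K (r * (t / real N)) - vol n K) / (r * (t / real N)))
          = real N * (parvol K (r * (t / N)) - vol n K)"
        using r t elim by (simp add: field_simps)
      then show ?case using parvol_superlinear[OF K(1) r _ elim, of t] t by simp
    qed
    ultimately have "r * t * surface K \<le> parvol K t - vol n K"
      by (rule tendsto_upperbound) simp
    then show ?thesis by (simp only: mult.assoc)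
  qed
  have lim: "((\<lambda>r. r * (t * surface K)) \<longlongrightarrow> 1 * (t * surface K)) (at_left 1)"
    by (intro tendsto_intros)
  have "eventually (\<lambda>r. r * (t * surface K) \<le> parvol K t - vol n K) (at_left 1)"
    unfolding eventually_at_left_field using * by (intro exI[of _ 0]) auto
  from tendsto_upperbound[OF lim this] show ?thesis by simp
qed

lemma vol_add_ball_Rn_segment:
  assumes \<xi>: "on_sphere n \<xi>" and K: "conv_cpt n K" and s: "s \<ge> 0"
  shows "vol n (K + (ball_Rn n t + segment (scl s \<xi>))) = parvol K t + s * shadow_vol m \<xi> (K + ball_Rn n t)"
  unfolding add.assoc[symmetric] by (rule vol_add_segment[OF \<xi> conv_cpt_add[OF K conv_cpt_ball_Rn] s])

section \<open>Surface area of projections\<close>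

definition shadow_surface :: "vec \<Rightarrow> vec set \<Rightarrow> real" where
  "shadow_surface \<xi> K = Lim (at_right 0) (\<lambda>t. (shadow_vol m \<xi> (K + ball_Rn n t) - shadow_vol m \<xi> K) / t)"

lemma perp_surface_area_eq:
  assumes \<xi>: "on_sphere n \<xi>" and K: "K \<subseteq> Rn n"
  shows "perp_surface_area n \<xi> (proj_perp n \<xi> ` K) = shadow_surface \<xi> K"
proof -
  have "perp_surface_area n \<xi> (proj_perp n \<xi> ` K) = surface_area m (shadow m \<xi> K)"
    unfolding perp_surface_area_def diff_Suc_1 shadow_eq[OF \<xi> K] ..
  also have "\<dots> = shadow_surface \<xi> K"
    unfolding surface_area_def shadow_surface_def
    by (rule Lim_at_right_cong) (simp add: parallel_body_eq shadow_vol_def shadow_add shadow_ball_Rn[OF \<xi>])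
  finally show ?thesis .
qed

text \<open>Adding the unit segment raises each parallel volume of \<open>K\<close> by the shadow
  volume of that parallel body, so the quotient is the difference of the quotients for
  \<open>K + ?I\<close> and for \<open>K\<close>, both of which converge.\<close>

lemma shadow_surface_tendsto:
  assumes \<xi>: "on_sphere n \<xi>" and K: "conv_cpt n K" "vol n K > 0"
  shows "((\<lambda>t. (shadow_vol m \<xi> (K + ball_Rn n t) - shadow_vol m \<xi> K) / t) \<longlongrightarrow> shadow_surface \<xi> K) (at_right 0)"
proof -
  let ?I = "segment (scl 1 \<xi>)"
  have I: "conv_cpt n (K + ?I)" using \<xi> K by (intro conv_cpt_add conv_cpt_segment Rn_scl on_sphere_in_Rn)
  have volI: "vol n (K + ?I) = vol n K + shadow_vol m \<xi> K"
    using vol_add_segment[OF \<xi> K(1), of 1] by simp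
  have parI: "parvol (K + ?I) t = parvol K t + shadow_vol m \<xi> (K + ball_Rn n t)" for t
  proof -
    have "K + ?I + ball_Rn n t = K + (ball_Rn n t + ?I)" by (simp only: add.assoc add.commute[of ?I])
    then show ?thesis using vol_add_ball_Rn_segment[OF \<xi> K(1), of 1 t] by (simp only: mult_1_left zero_le_one)
  qed
  have "((\<lambda>t. (parvol (K + ?I) t - vol n (K + ?I)) / t - (parvol K t - vol n K) / t)
      \<longlongrightarrow> surface (K + ?I) - surface K) (at_right 0)"
    using I K volI by (intro tendsto_diff surface_tendsto) (auto simp: add_pos_nonneg)
  moreover have "(\<lambda>t. (parvol (K + ?I) t - vol n (K + ?I)) / t - (parvol K t - vol n K) / t)
      = (\<lambda>t. (shadow_vol m \<xi> (K + ball_Rn n t) - shadow_vol m \<xi> K) / t)"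
    unfolding parI volI by (simp add: fun_eq_iff add_divide_distrib diff_divide_distrib)
  ultimately have "((\<lambda>t. (shadow_vol m \<xi> (K + ball_Rn n t) - shadow_vol m \<xi> K) / t) \<longlongrightarrow> surface (K + ?I) - surface K) (at_right 0)"
    by simp
  note D = this
  then have "shadow_surface \<xi> K = surface (K + ?I) - surface K"
    unfolding shadow_surface_def by (rule tendsto_Lim[OF trivial_limit_at_right_real])
  with D show ?thesis by (simp only:)
qed

text \<open>
  Second-order comparison at \<open>t = 0\<close> of the volume of \<open>K + t (B + [-\<tau>\<xi>/2, \<tau>\<xi>/2])\<close>
  with the bound from the concavity of its \<open>n\<close>-th root.
\<close>
lemma shadow_surface_quadratic_bound:
  assumes \<xi>: "on_sphere n \<xi>" and K: "conv_cpt n K" "vol n K > 0" and \<tau>: "\<tau> > 0"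
  shows "\<tau> * (vol n K * shadow_surface \<xi> K) \<le> (real n - 1) / (2 * real n) * (surface K + \<tau> * shadow_vol m \<xi> K)\<^sup>2"
proof -
  define V D g where "V = vol n K" and "D = surface K" and "g = (\<lambda>t. shadow_vol m \<xi> (K + ball_Rn n t))"
  define g0 where "g0 = shadow_vol m \<xi> K"
  define E where "E = D + \<tau> * g0"
  define C where "C = ball_Rn n 1 + segment (scl \<tau> \<xi>)"
  have V: "V > 0" using K by (simp add: V_def)
  have E: "E \<ge> 0" using surface_nonneg[OF K] \<tau> by (simp add: E_def D_def g0_def)
  have C: "conv_cpt n C" unfolding C_def using \<xi> by (intro conv_cpt_add conv_cpt_ball_Rn conv_cpt_segment Rn_scl on_sphere_in_Rn)
  have "0 + 0 \<in> C" unfolding C_def by (intro set_plus_intro zero_in_ball_Rn zero_in_segment) simp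
  then have C0: "0 \<in> C" by (simp only: add_0_left)
  have tC: "scl t ` C = ball_Rn n t + segment (scl (t * \<tau>) \<xi>)" if "t \<ge> 0" for t
  proof -
    have "scl t ` segment (scl \<tau> \<xi>) = segment (scl (t * \<tau>) \<xi>)"
      unfolding segment_def image_image by (simp add: mult.left_commute)
    then show ?thesis
      unfolding C_def using linear_image_add[of "scl t", OF scl_add] scl_unit_ball_Rn[OF that] by metis
  qed
  have F: "vol n (K + scl t ` C) = parvol K t + t * \<tau> * g t" if "t \<ge> 0" for t
    unfolding tC[OF that] g_def using vol_add_ball_Rn_segment[OF \<xi> K(1)] that \<tau> by simp
  have glim: "((\<lambda>t. (g t - g0) / t) \<longlongrightarrow> shadow_surface \<xi> K) (at_right 0)"
    unfolding g_def g0_def by (rule shadow_surface_tendsto[OF \<xi> K])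
  have idlim: "((\<lambda>t. t) \<longlongrightarrow> (0::real)) (at_right 0)" by (rule tendsto_ident_at)
  have "((\<lambda>t. g0 + t * ((g t - g0) / t)) \<longlongrightarrow> g0 + 0 * shadow_surface \<xi> K) (at_right 0)"
    by (intro tendsto_add tendsto_const tendsto_mult idlim glim)
  moreover have "eventually (\<lambda>t. g0 + t * ((g t - g0) / t) = g t) (at_right 0)"
    unfolding eventually_at_right_field by (intro exI[of _ 1]) auto
  ultimately have g: "(g \<longlongrightarrow> g0) (at_right 0)" by (simp add: tendsto_cong)
  have "((\<lambda>t. (parvol K t - V) / t + \<tau> * g t) \<longlongrightarrow> E) (at_right 0)"
    unfolding E_def D_def V_def by (intro tendsto_add tendsto_mult tendsto_const surface_tendsto K g)
  moreover have "eventually (\<lambda>t. (parvol K t - V) / t + \<tau> * g t = (vol n (K + scl t ` C) - vol n K) / t) (at_right 0)"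
    unfolding eventually_at_right_field by (intro exI[of _ 1]) (auto simp: F V_def field_simps)
  ultimately have dF: "((\<lambda>t. (vol n (K + scl t ` C) - vol n K) / t) \<longlongrightarrow> E) (at_right 0)"
    by (simp add: tendsto_cong)
  define e where "e = E / (n * V)"
  have e: "e \<ge> 0" using E V by (simp add: e_def)
  obtain c where c: "\<forall>x\<in>{0..1}. (1 + x) ^ n \<le> 1 + real n * x + real n * (real n - 1) / 2 * x\<^sup>2 + c * x ^ 3"
    using one_plus_power_le[of n] by blast
  \<comment> \<open>The restriction on \<open>t\<close> keeps \<open>t * e\<close> in
    \<open>{0..1}\<close>, where the expansion with cubic remainder holds.\<close>
  have main: "\<tau> * ((g t - g0) / t) \<le> V * (real n * (real n - 1) / 2 * e\<^sup>2 + c * t * e ^ 3)"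
    if t: "0 < t" "t \<le> 1 / (e + 1)" for t
  proof -
    have te: "t * e \<le> 1" "0 \<le> t * e"
    proof -
      have "t * e \<le> t * (e + 1)" using t by simp
      also have "\<dots> \<le> 1" using t e by (simp add: field_simps)
      finally show "t * e \<le> 1" .
    qed (use t e in simp)
    have "V + t * D + t * \<tau> * g t \<le> vol n (K + scl t ` C)"
      using parvol_ge_tangent[OF K t(1)] F[of t] t by (simp add: V_def D_def)
    also have "\<dots> \<le> V * (1 + t * E / (n * V)) ^ n"
      unfolding V_def by (rule vol_le_tangent_power[OF K C C0 _ t(1) dF]) simp
    also have "t * E / (n * V) = t * e" by (simp add: e_def)
    also have "V * (1 + t * e) ^ n \<le> V * (1 + real n * (t * e) + real n * (real n - 1) / 2 * (t * e)\<^sup>2 + c * (t * e) ^ 3)"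
      using V te by (intro mult_left_mono bspec[OF c]) auto
    also have "\<dots> = V + t * (real n * V * e) + V * (real n * (real n - 1) / 2 * (t * e)\<^sup>2 + c * (t * e) ^ 3)"
      by (simp add: algebra_simps)
    \<comment> \<open>Lower and upper bound have the same first-order part at 0, so it cancels and
      the rest is of order two in \<open>t\<close>.\<close>
    also have "real n * V * e = D + \<tau> * g0" using V by (simp add: e_def E_def)
    finally have "t * \<tau> * (g t - g0) \<le> V * (real n * (real n - 1) / 2 * (t * e)\<^sup>2 + c * (t * e) ^ 3)"
      by (simp add: algebra_simps)
    also have "\<dots> = t\<^sup>2 * (V * (real n * (real n - 1) / 2 * e\<^sup>2 + c * t * e ^ 3))"
      by (simp add: power2_eq_square power3_eq_cube algebra_simps)
    finally have "t\<^sup>2 * (\<tau> * ((g t - g0) / t)) \<le> t\<^sup>2 * (V * (real n * (real n - 1) / 2 * e\<^sup>2 + c * t * e ^ 3))"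
      using t by (simp add: power2_eq_square mult.assoc)
    then show ?thesis using t by (simp only: mult_le_cancel_left_pos zero_less_power)
  qed
  have "((\<lambda>t. V * (real n * (real n - 1) / 2 * e\<^sup>2 + c * t * e ^ 3)) \<longlongrightarrow>
      V * (real n * (real n - 1) / 2 * e\<^sup>2 + c * 0 * e ^ 3)) (at_right 0)"
    by (intro tendsto_mult tendsto_add tendsto_const idlim)
  moreover have "((\<lambda>t. \<tau> * ((g t - g0) / t)) \<longlongrightarrow> \<tau> * shadow_surface \<xi> K) (at_right 0)"
    by (intro tendsto_mult tendsto_const glim)
  moreover have "eventually (\<lambda>t. \<tau> * ((g t - g0) / t) \<le> V * (real n * (real n - 1) / 2 * e\<^sup>2 + c * t * e ^ 3)) (at_right 0)"
    unfolding eventually_at_right_field using main e by (intro exI[of _ "1 / (e + 1)"]) auto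
  ultimately have "\<tau> * shadow_surface \<xi> K \<le> V * (real n * (real n - 1) / 2 * e\<^sup>2 + c * 0 * e ^ 3)"
    by (intro tendsto_le[OF trivial_limit_at_right_real])
  then have "V * (\<tau> * shadow_surface \<xi> K) \<le> V * (V * (real n * (real n - 1) / 2 * e\<^sup>2))"
    using V by (intro mult_left_mono) auto
  \<comment> \<open>Since \<open>e = E / (n * V)\<close>, both factors \<open>V\<close> disappear
    and \<open>n * (n - 1) / 2\<close> becomes \<open>(n - 1) / (2 * n)\<close>.\<close>
  also have "\<dots> = (real n - 1) / (2 * real n) * E\<^sup>2"
    using V by (simp add: e_def power2_eq_square)
  finally show ?thesis unfolding E_def D_def g0_def V_def by (simp only: mult.left_commute)
qed

lemma vol_shadow_surface_le:
  assumes "on_sphere n \<xi>" "conv_cpt n K" "vol n K > 0"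
  shows "vol n K * shadow_surface \<xi> K \<le> 2 * (real n - 1) / n * (surface K * shadow_vol m \<xi> K)"
proof -
  have "vol n K * shadow_surface \<xi> K \<le> 4 * ((real n - 1) / (2 * real n)) * surface K * shadow_vol m \<xi> K"
    using assms shadow_surface_quadratic_bound surface_nonneg by (intro le_4_mult_if_quadratic) auto
  moreover have "4 * (a / (2 * k)) = 2 * a / k" for a k :: real by simp
  ultimately show ?thesis by (simp only: mult.assoc)
qed

section \<open>Cauchy's bound and the average over the sphere\<close>

lemma zonotope_sum_le_surface:
  assumes l: "generators m l" "zonotope l \<subseteq> ball_Rn n c" and c: "c > 0" and K: "conv_cpt n K" "vol n K > 0"
  shows "zonotope_sum m l K \<le> c * surface K"
proof -
  have "zonotope_sum m l K / c \<le> (parvol K t - vol n K) / t" if t: "t > 0" for t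
  proof -
    have tc: "t / c \<ge> 0" using t c by simp
    have g: "generators m (map (\<lambda>(s, \<xi>). (t / c * s, \<xi>)) l)" using generators_scale[OF l(1) tc] .
    \<comment> \<open>Shrunk by \<open>t / c\<close> the zonotope fits into the ball of radius
      \<open>t\<close>, so its first-order growth is at most that of the parallel volume.\<close>
    have "scl (t / c) ` zonotope l \<subseteq> scl (t / c) ` ball_Rn n c" using l(2) by (rule image_mono)
    also have "\<dots> = ball_Rn n t" using scl_ball_Rn[OF tc, of c n] c by simp
    finally have "vol n (K + scl (t / c) ` zonotope l) \<le> parvol K t"
      using K l by (intro vol_mono cpt_add cpt_ball_Rn conv_cpt_cpt conv_cpt_scl conv_cpt_zonotope set_plus_mono2 order_refl)
    moreover have "vol n K + t / c * zonotope_sum m l K \<le> vol n (K + scl (t / c) ` zonotope l)"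
      unfolding scl_zonotope using vol_add_zonotope_lower[OF g K(1)] by (simp only: zonotope_sum_scale)
    ultimately have "t * (zonotope_sum m l K / c) \<le> parvol K t - vol n K" by (simp add: algebra_simps)
    then show ?thesis using t by (simp add: pos_le_divide_eq mult.commute)
  qed
  then have "eventually (\<lambda>t. zonotope_sum m l K / c \<le> (parvol K t - vol n K) / t) (at_right 0)"
    unfolding eventually_at_right_field by (intro exI[of _ 1]) auto
  from tendsto_lowerbound[OF surface_tendsto[OF K] this]
  show ?thesis using c by (simp add: field_simps)
qed

lemma zonotope_sum_ball_Rn:
  assumes "generators m l" "r > 0"
  shows "zonotope_sum m l (ball_Rn n r) = (\<Sum>(s, \<xi>)\<leftarrow>l. s) * (\<omega> m * r ^ m)"
  using assms(1) by (induction l rule: zonotope.induct) (simp_all add: shadow_vol_ball_Rn assms(2) distrib_right)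

text \<open>The unit ball plus a small zonotope contains a ball of radius \<open>1 + t * a\<close>,
  whose volume is at least \<open>\<omega> n * (1 + n * t * a)\<close> by Bernoulli. From above, all
  shadows lie in balls of radius \<open>1 + t * b\<close> of dimension \<open>m\<close>, so the
  volume exceeds \<open>\<omega> n\<close> by at most
  \<open>t * \<omega> m * (1 + t * b) ^ m\<close>. Dividing by \<open>t\<close>, letting
  \<open>t\<close> and then \<delta> tend to 0, gives the claim.\<close>

lemma \<kappa>_le: "real n * \<omega> n * (\<kappa> / 2) \<le> \<omega> m"
proof -
  have *: "real n * \<omega> n * (\<kappa> / 2 - \<delta>) \<le> \<omega> m" if \<delta>: "0 < \<delta>" "\<delta> < \<kappa> / 2" for \<delta>
  proof -
    define a b where "a = \<kappa> / 2 - \<delta>" and "b = \<kappa> / 2 + \<delta>"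
    have ab: "a > 0" "b > 0" using \<delta> \<kappa>_pos by (auto simp: a_def b_def)
    obtain l where l: "generators m l" "(\<Sum>(s, \<xi>)\<leftarrow>l. s) = 1" "ball_Rn n a \<subseteq> zonotope l" "zonotope l \<subseteq> ball_Rn n b"
      using zonotope_approx[OF \<delta> integrable_zero] unfolding a_def b_def by metis
    have "real n * \<omega> n * a \<le> \<omega> m * (1 + t * b) ^ m" if t: "t > 0" for t
    proof -
      define l' where "l' = map (\<lambda>(s, \<xi>). (t * s, \<xi>)) l"
      have l': "generators m l'" "zonotope l' = scl t ` zonotope l"
        unfolding l'_def scl_zonotope using generators_scale[OF l(1), of t] t by simp_all
      have z: "cpt n (ball_Rn n 1 + zonotope l')" by (intro cpt_add cpt_ball_Rn conv_cpt_cpt conv_cpt_zonotope l')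
      have "scl t ` ball_Rn n a \<subseteq> zonotope l'" "zonotope l' \<subseteq> scl t ` ball_Rn n b"
        unfolding l' using l by (simp_all add: image_mono)
      then have sub: "ball_Rn n (t * a) \<subseteq> zonotope l'" "zonotope l' \<subseteq> ball_Rn n (t * b)"
        using scl_ball_Rn[of t a n] scl_ball_Rn[of t b n] t ab by simp_all
      have "ball_Rn n (1 + t * a) = ball_Rn n 1 + ball_Rn n (t * a)" using ball_Rn_add[of 1 "t * a" n] t ab by simp
      also have "\<dots> \<subseteq> ball_Rn n 1 + zonotope l'" by (rule set_plus_mono2[OF order_refl sub(1)])
      finally have "vol n (ball_Rn n (1 + t * a)) \<le> vol n (ball_Rn n 1 + zonotope l')"
        by (intro vol_mono cpt_ball_Rn z)
      moreover have "vol n (ball_Rn n (1 + t * a)) = \<omega> n * (1 + t * a) ^ n"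
        using t ab by (intro vol_ball_Rn) (simp add: add_pos_pos)
      moreover have "\<omega> n * (1 + real n * (t * a)) \<le> \<omega> n * (1 + t * a) ^ n"
        using \<omega>_pos[of n] t ab by (intro mult_left_mono Bernoulli_inequality) (auto intro: less_imp_le order_trans[of _ 0])
      moreover have "vol n (ball_Rn n 1 + zonotope l') \<le> vol n (ball_Rn n 1) + zonotope_sum m l' (ball_Rn n 1 + zonotope l')"
        by (rule vol_add_zonotope_upper[OF l'(1) conv_cpt_ball_Rn])
      moreover have "vol n (ball_Rn n 1) = \<omega> n" using vol_ball_Rn[of 1 n] by simp
      moreover have "zonotope_sum m l' (ball_Rn n 1 + zonotope l') \<le> t * (\<omega> m * (1 + t * b) ^ m)"
      proof -
        have "ball_Rn n 1 + zonotope l' \<subseteq> ball_Rn n 1 + ball_Rn n (t * b)" by (rule set_plus_mono2[OF order_refl sub(2)])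
        also have "\<dots> = ball_Rn n (1 + t * b)" using t ab by (intro ball_Rn_add) auto
        finally have "zonotope_sum m l' (ball_Rn n 1 + zonotope l') \<le> zonotope_sum m l' (ball_Rn n (1 + t * b))"
          by (intro zonotope_sum_mono l' z cpt_ball_Rn)
        also have "\<dots> = t * zonotope_sum m l (ball_Rn n (1 + t * b))"
          unfolding l'_def by (rule zonotope_sum_scale)
        also have "zonotope_sum m l (ball_Rn n (1 + t * b)) = \<omega> m * (1 + t * b) ^ m"
          using zonotope_sum_ball_Rn[OF l(1), of "1 + t * b"] l(2) t ab by (simp add: add_pos_pos)
        finally show ?thesis .
      qed
      ultimately have "\<omega> n * (1 + real n * (t * a)) \<le> \<omega> n + t * (\<omega> m * (1 + t * b) ^ m)" by linarith
      then have "t * (real n * \<omega> n * a) \<le> t * (\<omega> m * (1 + t * b) ^ m)" by (simp add: algebra_simps)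
      then show ?thesis using t by (simp only: mult_le_cancel_left_pos)
    qed
    then have ev: "eventually (\<lambda>t. real n * \<omega> n * a \<le> \<omega> m * (1 + t * b) ^ m) (at_right 0)"
      unfolding eventually_at_right_field by (intro exI[of _ 1]) auto
    have "((\<lambda>t. \<omega> m * (1 + t * b) ^ m) \<longlongrightarrow> \<omega> m * (1 + 0 * b) ^ m) (at_right 0)"
      by (intro tendsto_intros)
    from tendsto_lowerbound[OF this ev] show ?thesis by (simp add: a_def)
  qed
  have "eventually (\<lambda>\<delta>. real n * \<omega> n * (\<kappa> / 2 - \<delta>) \<le> \<omega> m) (at_right 0)"
    unfolding eventually_at_right_field using * \<kappa>_pos by (intro exI[of _ "\<kappa> / 2"]) auto
  moreover have "((\<lambda>\<delta>. real n * \<omega> n * (\<kappa> / 2 - \<delta>)) \<longlongrightarrow> real n * \<omega> n * (\<kappa> / 2 - 0)) (at_right 0)"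
    by (intro tendsto_mult tendsto_const tendsto_diff tendsto_ident_at)
  ultimately have "real n * \<omega> n * (\<kappa> / 2 - 0) \<le> \<omega> m"
    by (intro tendsto_upperbound[of _ _ "at_right 0"]) auto
  then show ?thesis by simp
qed

text \<open>The quadrature rule built for \<open>shadow_surface\<close> bounds the integral by a
  finite sum. Term by term this passes to shadow volumes, whose sum with the same weights is
  controlled because the same rule yields a zonotope inside a ball of radius
  \<open>\<kappa> / 2 + \<delta>\<close>.\<close>

lemma integral_shadow_surface_le:
  assumes K: "conv_cpt n K" "vol n K > 0" and \<phi>: "integrable \<sigma> (\<lambda>\<xi>. shadow_surface \<xi> K)"
  shows "vol n K * (\<integral>\<xi>. shadow_surface \<xi> K \<partial>\<sigma>) \<le> 2 * (real n - 1) / n * (\<kappa> / 2 * (surface K)\<^sup>2)"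
proof -
  have *: "vol n K * (\<integral>\<xi>. shadow_surface \<xi> K \<partial>\<sigma>) \<le> 2 * (real n - 1) / n * ((\<kappa> / 2 + \<delta>) * (surface K)\<^sup>2)"
    if \<delta>: "0 < \<delta>" "\<delta> < \<kappa> / 2" for \<delta>
  proof -
    obtain l where l: "generators m l" "(\<integral>\<xi>. shadow_surface \<xi> K \<partial>\<sigma>) \<le> (\<Sum>(s, \<xi>)\<leftarrow>l. s * shadow_surface \<xi> K)" "zonotope l \<subseteq> ball_Rn n (\<kappa> / 2 + \<delta>)"
      using zonotope_approx[OF \<delta> \<phi>] by metis
    have "vol n K * (\<Sum>(s, \<xi>)\<leftarrow>l. s * shadow_surface \<xi> K) \<le> 2 * (real n - 1) / n * surface K * zonotope_sum m l K"
      using l(1)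
    proof (induction l rule: zonotope.induct)
      case 1
      show ?case by (simp only: list.map sum_list.Nil zonotope_sum_simps mult_zero_right order_refl)
    next
      case (2 s \<xi> l)
      then have s: "s \<ge> 0" "on_sphere n \<xi>" "generators m l" by auto
      have "s * (vol n K * shadow_surface \<xi> K) \<le> s * (2 * (real n - 1) / n * (surface K * shadow_vol m \<xi> K))"
        by (rule mult_left_mono[OF vol_shadow_surface_le[OF s(2) K] s(1)])
      moreover have "vol n K * (\<Sum>(s, \<xi>)\<leftarrow>(s, \<xi>) # l. s * shadow_surface \<xi> K)
          = s * (vol n K * shadow_surface \<xi> K) + vol n K * (\<Sum>(s, \<xi>)\<leftarrow>l. s * shadow_surface \<xi> K)"
        by (simp add: distrib_left)
      moreover have "2 * (real n - 1) / n * surface K * zonotope_sum m ((s, \<xi>) # l) K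
          = s * (2 * (real n - 1) / n * (surface K * shadow_vol m \<xi> K)) + 2 * (real n - 1) / n * surface K * zonotope_sum m l K"
        unfolding zonotope_sum_simps distrib_left by (simp only: ac_simps)
      ultimately show ?case using 2(1)[OF s(3)] by linarith
    qed
    moreover have "vol n K * (\<integral>\<xi>. shadow_surface \<xi> K \<partial>\<sigma>) \<le> vol n K * (\<Sum>(s, \<xi>)\<leftarrow>l. s * shadow_surface \<xi> K)"
      using l(2) by (intro mult_left_mono) auto
    moreover have "2 * (real n - 1) / n * surface K * zonotope_sum m l K \<le> 2 * (real n - 1) / n * surface K * ((\<kappa> / 2 + \<delta>) * surface K)"
      using surface_nonneg[OF K] \<delta> \<kappa>_pos l K by (intro mult_left_mono zonotope_sum_le_surface) auto
    ultimately show ?thesis by (simp add: power2_eq_square mult.assoc mult.left_commute)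
  qed
  have ev: "eventually (\<lambda>\<delta>. vol n K * (\<integral>\<xi>. shadow_surface \<xi> K \<partial>\<sigma>) \<le> 2 * (real n - 1) / n * ((\<kappa> / 2 + \<delta>) * (surface K)\<^sup>2)) (at_right 0)"
    unfolding eventually_at_right_field using * \<kappa>_pos by (intro exI[of _ "\<kappa> / 2"]) auto
  have "((\<lambda>\<delta>. 2 * (real n - 1) / n * ((\<kappa> / 2 + \<delta>) * (surface K)\<^sup>2)) \<longlongrightarrow>
      2 * (real n - 1) / n * ((\<kappa> / 2 + 0) * (surface K)\<^sup>2)) (at_right 0)"
    by (intro tendsto_mult tendsto_const tendsto_add tendsto_ident_at)
  from tendsto_lowerbound[OF this ev] show ?thesis by simp
qed

lemma main_inequality:
  assumes "convex_body n K"
  shows "vol n K * (\<integral>\<xi>. perp_surface_area n \<xi> (proj_perp n \<xi> ` K) \<partial>\<sigma>)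
    \<le> 2 * (real n - 1) * \<omega> m / ((real n)\<^sup>2 * \<omega> n) * (surface_area n K)\<^sup>2"
proof -
  have K: "conv_cpt n K" "vol n K > 0" using assms by (auto simp: convex_body_conv_cpt convex_body_vol_pos)
  have KR: "K \<subseteq> Rn n" using K by (auto simp: conv_cpt_def cpt_def)
  have eq: "(\<integral>\<xi>. perp_surface_area n \<xi> (proj_perp n \<xi> ` K) \<partial>\<sigma>) = (\<integral>\<xi>. shadow_surface \<xi> K \<partial>\<sigma>)"
    by (intro Bochner_Integration.integral_cong refl) (simp add: space_\<sigma> perp_surface_area_eq KR del: topspace_Euclidean_space)
  have nn: "0 \<le> 2 * (real n - 1) * \<omega> m / ((real n)\<^sup>2 * \<omega> n) * (surface K)\<^sup>2"
    using \<omega>_pos[of m] \<omega>_pos[of n] by simp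
  have k: "\<kappa> / 2 \<le> \<omega> m / (real n * \<omega> n)"
    using \<kappa>_le \<omega>_pos[of n] by (simp add: pos_le_divide_eq mult.commute)
  show ?thesis
  proof (cases "integrable \<sigma> (\<lambda>\<xi>. shadow_surface \<xi> K)")
    case True
    have "vol n K * (\<integral>\<xi>. shadow_surface \<xi> K \<partial>\<sigma>) \<le> 2 * (real n - 1) / n * (\<kappa> / 2 * (surface K)\<^sup>2)"
      by (rule integral_shadow_surface_le[OF K True])
    also have "\<dots> \<le> 2 * (real n - 1) / n * (\<omega> m / (real n * \<omega> n) * (surface K)\<^sup>2)"
      using k by (intro mult_left_mono mult_right_mono) auto
    also have "\<dots> = 2 * (real n - 1) * \<omega> m / ((real n)\<^sup>2 * \<omega> n) * (surface K)\<^sup>2"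
      by (simp add: power2_eq_square mult.assoc)
    finally show ?thesis unfolding eq surface_area_eq .
  next
    case False
    \<comment> \<open>The Bochner integral of a function that is not integrable is 0 by convention,
      and the right-hand side is nonnegative.\<close>
    then have "(\<integral>\<xi>. shadow_surface \<xi> K \<partial>\<sigma>) = 0" by (rule not_integrable_integral_eq)
    then show ?thesis unfolding eq surface_area_eq using nn by simp
  qed
qed

end

section \<open>The ratio of consecutive ball volumes\<close>

lemma Gamma_plus_half_le:
  fixes x :: real
  assumes "x > 0"
  shows "Gamma (x + 1 / 2) \<le> sqrt x * Gamma x"
proof -
  have G: "Gamma x > 0" "Gamma (x + 1 / 2) > 0" "Gamma (x + 1) = x * Gamma x"
    using assms by (auto intro!: Gamma_real_pos Gamma_plus1 simp: add_pos_pos elim!: nonpos_Ints_cases)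
  \<comment> \<open>Log-convexity at the midpoint of \<open>x\<close> and
    \<open>x + 1\<close>.\<close>
  have "ln (Gamma ((1 - 1/2) *\<^sub>R x + (1/2) *\<^sub>R (x + 1))) \<le> (1 - 1/2) * ln (Gamma x) + 1/2 * ln (Gamma (x + 1))"
    using convex_onD[OF log_convex_Gamma_real, of "1/2" x "x + 1"] assms by simp
  moreover have "(1 - 1/2) *\<^sub>R x + (1/2) *\<^sub>R (x + 1) = x + 1 / 2" by (simp add: field_simps)
  ultimately have "ln (Gamma (x + 1 / 2)) \<le> 1/2 * ln (Gamma x) + 1/2 * ln (x * Gamma x)"
    unfolding G(3) by simp
  also have "\<dots> = ln (sqrt x * Gamma x)"
    using assms G by (simp add: ln_mult ln_sqrt add_divide_distrib)
  finally show ?thesis using assms G by simp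
qed

lemma \<omega>_ratio_le: "\<omega> m / \<omega> (Suc m) \<le> sqrt (real (Suc m))"
proof -
  define x where "x = (real m + 2) / 2"
  have x: "x > 0" by (simp add: x_def add_nonneg_pos)
  have pm: "pi powr (real (Suc m) / 2) = pi powr (real m / 2) * sqrt pi"
  proof -
    have "real (Suc m) / 2 = real m / 2 + 1 / 2" by (simp add: add_divide_distrib)
    then show ?thesis by (simp only: powr_add powr_half_sqrt pi_ge_zero)
  qed
  have e1: "\<omega> m = pi powr (real m / 2) / Gamma x"
    unfolding \<omega>_eq unit_ball_vol_def x_def by (simp add: add_divide_distrib)
  have e2: "\<omega> (Suc m) = pi powr (real m / 2) * sqrt pi / Gamma (x + 1 / 2)"
    unfolding \<omega>_eq unit_ball_vol_def pm x_def by (simp add: add_divide_distrib add.commute)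
  have G: "Gamma x > 0" "Gamma (x + 1 / 2) > 0"
    using x by (auto intro!: Gamma_real_pos)
  have "\<omega> m / \<omega> (Suc m) = Gamma (x + 1 / 2) / Gamma x / sqrt pi"
    unfolding e1 e2 using G by (simp add: field_simps)
  \<comment> \<open>Only the order of magnitude matters for the constant, so the divisor
    \<open>sqrt pi\<close> is lowered to 1.\<close>
  also have "\<dots> \<le> Gamma (x + 1 / 2) / Gamma x / 1"
    using G pi_ge_two by (intro divide_left_mono) auto
  also have "\<dots> \<le> sqrt x" using Gamma_plus_half_le[OF x] G by (simp add: pos_divide_le_eq)
  also have "\<dots> \<le> sqrt (real (Suc m))" by (simp add: x_def)
  finally show ?thesis .
qed

theorem theorem1p4:
  shows "\<exists>c\<^sub>2 :: real. c\<^sub>2 > 0 \<and>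
    (\<forall>n \<sigma> K. n \<ge> 2 \<and> rotation_invariant_prob n \<sigma> \<and> convex_body n K \<longrightarrow>
       vol n K * (\<integral>\<xi>. perp_surface_area n \<xi> (proj_perp n \<xi> ` K) \<partial>\<sigma>)
         \<le> 2 * (real n - 1) * \<omega> (n - 1) / ((real n)\<^sup>2 * \<omega> n) * (surface_area n K)\<^sup>2 \<and>
       2 * (real n - 1) * \<omega> (n - 1) / ((real n)\<^sup>2 * \<omega> n) * (surface_area n K)\<^sup>2
         \<le> c\<^sub>2 / sqrt (real n) * (surface_area n K)\<^sup>2)"
proof (intro exI[of _ 2] conjI allI impI)
  fix n :: nat and \<sigma> and K
  assume *: "n \<ge> 2 \<and> rotation_invariant_prob n \<sigma> \<and> convex_body n K"
  then obtain m where n: "n = Suc m" by (cases n) auto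
  interpret sphere_measure m \<sigma>
    by unfold_locales (use * in \<open>simp add: n\<close>)
  show "vol n K * (\<integral>\<xi>. perp_surface_area n \<xi> (proj_perp n \<xi> ` K) \<partial>\<sigma>)
      \<le> 2 * (real n - 1) * \<omega> (n - 1) / ((real n)\<^sup>2 * \<omega> n) * (surface_area n K)\<^sup>2"
    using main_inequality[of K] * unfolding n diff_Suc_1 by blast
  have "2 * (real n - 1) * \<omega> (n - 1) / ((real n)\<^sup>2 * \<omega> n) = 2 * (real n - 1) / (real n)\<^sup>2 * (\<omega> m / \<omega> (Suc m))"
    by (simp add: n)
  \<comment> \<open>The ratio contributes \<open>sqrt n\<close> against the remaining
    \<open>2 * (n - 1) / n\<^sup>2 \<le> 2 / n\<close>; this is where the constant 2 comes
    from.\<close>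
  also have "\<dots> \<le> 2 * (real n - 1) / (real n)\<^sup>2 * sqrt (real n)"
    using \<omega>_ratio_le[of m] by (intro mult_left_mono) (auto simp: n)
  also have "\<dots> \<le> 2 * real n / (real n)\<^sup>2 * sqrt (real n)"
    by (intro mult_right_mono divide_right_mono) auto
  also have "\<dots> = 2 * (sqrt (real n) / (sqrt (real n) * sqrt (real n)))"
    by (simp add: power2_eq_square)
  also have "\<dots> = 2 / sqrt (real n)" using n by (subst nonzero_divide_mult_cancel_left) auto
  finally show "2 * (real n - 1) * \<omega> (n - 1) / ((real n)\<^sup>2 * \<omega> n) * (surface_area n K)\<^sup>2
      \<le> 2 / sqrt (real n) * (surface_area n K)\<^sup>2"
    by (intro mult_right_mono) auto
qed simp

end
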